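(* Let $T$ be an endomorphism of $(X,\mathcal{A},\mu)$. The following are equivalent: (a) there is no $T$-invariant probability measure on $(X,\mathcal{A})$ that is absolutely continuous with respect to $\mu$; (b) for every $f\in L^{1}(\mu)$, $\left\|\frac{1}{n}\sum_{k=1}^{n}f\circ T^{k}\right\|_{*}\to0$ as $n\to+\infty$; (c) for every $f\in L^{\Phi}(\mu)$, $\left\|\frac{1}{n}\sum_{k=1}^{n}f\circ T^{k}\right\|_{*}\to0$ as $n\to+\infty$.
   Context: $(X,\mathcal{A},\mu)$ is a non-atomic infinite Borel measure space, i.e. measurably isomorphic to the real line with its Borel sets and Lebesgue measure. An endomorphism $T$ is a measurable map $T:X\to X$ with $\mu(T^{-1}A)=\mu(A)$ for all $A\in\mathcal{A}$. Poisson space $(X^{*},\mathcal{A}^{*},\mu^{*})$: $X^{*}$ is the set of measures of the form $\sum_{i\in I}\delta_{x_i}$, $x_i\in X$, $I$ countable; $\mathcal{A}^{*}=\sigma\{N(A): A\in\mathcal{A}\}$ with $N(A)(\omega)=\omega(A)$; $\mu^{*}$ is the unique probability measure such that for pairwise disjoint $A_1,\dots,A_k\in\mathcal{A}$ of finite $\mu$-measure, $N(A_1),\dots,N(A_k)$ are independent and Poisson distributed with parameters $\mu(A_1),\dots,\mu(A_k)$. For $f\in L^1(\mu)$, $N(f)(\omega)=\int_X f\,d\omega$ and $\mu(f)=\int_X f\,d\mu$. Let $\Phi(x)=x^{2}$ for $0\le x\le1$ and $\Phi(x)=2x-1$ for $x>1$; $L^{\Phi}(\mu)=\{f\in L^{0}(\mu):\int_X\Phi(|f|)\,d\mu<\infty\}$,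 which contains $L^1(\mu)$. For $f\in L^{\Phi}(\mu)$, $I_1(f):=\lim_{\epsilon\to0}\big(N(f1_{|f|>\epsilon})-\mu(f1_{|f|>\epsilon})\big)$ (limit in $\mu^{*}$-measure), an integrable centered random variable, and the Poisson-Orlicz norm is $\|f\|_{*}:=\|I_1(f)\|_{L^{1}(\mu^{*})}$, a norm on $L^\Phi(\mu)$. *)

theory Defs
  imports "HOL-Probability.Probability"
begin

definition iso_real_line :: "'a measure \<Rightarrow> bool" where
  "iso_real_line M \<longleftrightarrow>
     (\<exists>\<phi> :: 'a \<Rightarrow> real. bij_betw \<phi> (space M) UNIV
        \<and> \<phi> \<in> M \<rightarrow>\<^sub>M borel
        \<and> the_inv_into (space M) \<phi> \<in> borel \<rightarrow>\<^sub>M M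
        \<and> distr M borel \<phi> = lborel)"

definition invariant_measure :: "('a \<Rightarrow> 'a) \<Rightarrow> 'a measure \<Rightarrow> bool" where
  "invariant_measure T \<nu> \<longleftrightarrow> (\<forall>A\<in>sets \<nu>. emeasure \<nu> (T -` A \<inter> space \<nu>) = emeasure \<nu> A)"

definition endomorphism :: "'a measure \<Rightarrow> ('a \<Rightarrow> 'a) \<Rightarrow> bool" where
  "endomorphism M T \<longleftrightarrow> T \<in> M \<rightarrow>\<^sub>M M \<and> invariant_measure T M"

(* Countable sums of Dirac measures.  A countable index set may be taken to be a set of
   naturals; it may be empty, and points may be repeated. *)
definition point_configurations :: "'a measure \<Rightarrow> 'a measure set" where
  "point_configurations M =
     {\<omega>. sets \<omega> = sets M \<and>
        (\<exists>(I :: nat set) x. (\<forall>i\<in>I. x i \<in> space M) \<and>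
           (\<forall>A\<in>sets M. emeasure \<omega> A = (\<Sum>\<^sub>\<infinity>i\<in>I. emeasure (return M (x i)) A)))}"

definition configuration_algebra :: "'a measure \<Rightarrow> 'a measure measure" where
  "configuration_algebra M =
     sigma (point_configurations M)
       {{\<omega> \<in> point_configurations M. emeasure \<omega> A \<in> B} | A B.
          A \<in> sets M \<and> B \<in> sets (borel :: ennreal measure)}"

(* P is the law of the Poisson process with intensity M; this determines P uniquely when M is
   sigma-finite.  The Poisson weights are written out because poisson_pmf needs a positive rate;
   here parameter 0 gives the point mass at 0, since 0 ^ 0 = 1. *)
definition poisson_law :: "'a measure \<Rightarrow> 'a measure measure \<Rightarrow> bool" where
  "poisson_law M P \<longleftrightarrow>
     prob_space P \<and> sets P = sets (configuration_algebra M) \<and>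
     (\<forall>(k :: nat) A.
        (\<forall>i<k. A i \<in> sets M \<and> emeasure M (A i) < \<infinity>) \<and> disjoint_family_on A {..<k} \<longrightarrow>
          prob_space.indep_vars P (\<lambda>_. borel) (\<lambda>i \<omega>. emeasure \<omega> (A i)) {..<k} \<and>
          (\<forall>i<k. \<forall>j :: nat.
             measure P {\<omega> \<in> space P. emeasure \<omega> (A i) = of_nat j}
               = exp (- measure M (A i)) * measure M (A i) ^ j / fact j))"

definition Phi :: "real \<Rightarrow> real" where
  "Phi x = (if x \<le> 1 then x\<^sup>2 else 2 * x - 1)"

definition L_Phi :: "'a measure \<Rightarrow> ('a \<Rightarrow> real) set" where
  "L_Phi M = {f \<in> borel_measurable M. (\<integral>\<^sup>+x. ennreal (Phi \<bar>f x\<bar>) \<partial>M) < \<infinity>}"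

definition tendsto_in_measure ::
  "'b measure \<Rightarrow> ('i \<Rightarrow> 'b \<Rightarrow> real) \<Rightarrow> ('b \<Rightarrow> real) \<Rightarrow> 'i filter \<Rightarrow> bool" where
  "tendsto_in_measure P X Y F \<longleftrightarrow>
     (\<forall>\<delta>>0. ((\<lambda>i. emeasure P {\<omega> \<in> space P. \<bar>X i \<omega> - Y \<omega>\<bar> > \<delta>}) \<longlongrightarrow> 0) F)"

definition truncate_below :: "real \<Rightarrow> ('a \<Rightarrow> real) \<Rightarrow> 'a \<Rightarrow> real" where
  "truncate_below \<epsilon> f x = f x * indicator {y. \<bar>f y\<bar> > \<epsilon>} x"

(* A chosen version of the limit in measure, which is unique up to P-null sets. *)
definition I1 :: "'a measure \<Rightarrow> 'a measure measure \<Rightarrow> ('a \<Rightarrow> real) \<Rightarrow> 'a measure \<Rightarrow> real" where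
  "I1 M P f = (SOME Y. Y \<in> borel_measurable P \<and>
     tendsto_in_measure P
       (\<lambda>\<epsilon> \<omega>. (\<integral>x. truncate_below \<epsilon> f x \<partial>\<omega>) - (\<integral>x. truncate_below \<epsilon> f x \<partial>M))
       Y (at_right 0))"

(* Taken in ennreal, so that no integrability side condition is hidden in the value. *)
definition poisson_orlicz_norm ::
  "'a measure \<Rightarrow> 'a measure measure \<Rightarrow> ('a \<Rightarrow> real) \<Rightarrow> ennreal" where
  "poisson_orlicz_norm M P f = (\<integral>\<^sup>+\<omega>. ennreal \<bar>I1 M P f \<omega>\<bar> \<partial>P)"

definition ergodic_average :: "('a \<Rightarrow> 'a) \<Rightarrow> ('a \<Rightarrow> real) \<Rightarrow> nat \<Rightarrow> 'a \<Rightarrow> real" where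
  "ergodic_average T f n x = (1 / real n) * (\<Sum>k=1..n. f ((T ^^ k) x))"

end

(* A Poisson integral satisfies E|I_1(f)| <= ||g||_2 + 2 ||h||_1 whenever f = g + h.  An f in L^Phi is
   the sum of a function in L^2 and one that is small in L^1, so the averages of f are small once the
   L^2 averages are.  The L^2 norms of the averages A_n g always converge, and the parallelogram law
   makes A_n g Cauchy; if the limit norm is not 0, the L^1 limit of (A_n g)^2 is an invariant
   integrable density, which yields an absolutely continuous invariant probability.

   Conversely, for f >= 0 and mu(D) < infinity, restricting to the event N(D) = 0 gives
   E|N(f) - mu(f)| >= exp(-mu(D)) mu(f 1_D).  For an invariant nu << mu choose D with nu(D) > 1/2:
   convergence of the averages of 1_D would force them to 0 nu-almost everywhere on D along a
   subsequence, while their nu-integrals are all equal to nu(D). *)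
theory Submission
  imports Defs
begin

text \<open>The L^2 norm of A_n g tends to its infimum d over n >= 1: A_n is a contraction, and A_n
  A_m g differs from A_n g by at most 2 m ||g|| / n. The same estimate for A_i g + A_j g gives ||A_i
  g + A_j g|| >= 2 d, which is what the parallelogram law has to be fed with. Squares pass to the
  limit in L^1 because u^2 - v^2 = (u - v)(u + v), and testing that limit on sets is enough for its
  invariance.

  In the norm bound, ||g||_2 is the standard deviation of a compensated Poisson integral, and 2
  ||h||_1 counts N(h) and mu(h) separately. The obstacle is that I_1 is a chosen limit over
  truncations by the size of f, not of g or h. So g and h are restricted to the same sets {|f| >
  eps}, on which g becomes integrable, and the compensated integrals are shown to be Cauchy in L^1.

  In the converse, exp(-mu(D)) is the probability that D contains no point. The bound 1/2 enters
  because the averages are at most 1 outside D, so their nu-integral over D is at least nu(D) - (1 -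
  nu(D)).\<close>

section \<open>Square integrable functions and completeness of \<open>L\<^sup>1\<close>\<close>

text \<open>A subsequence converges almost everywhere, and Fatou's lemma carries the Cauchy estimate
  over to its limit. It serves twice: for squared averages under \<open>M\<close> and for
  compensated integrals of truncations under \<open>P\<close>.\<close>

lemma L1_complete:
  fixes s :: "nat \<Rightarrow> 'a \<Rightarrow> real"
  assumes int: "\<And>n. integrable M (s n)"
    and cauchy: "\<And>e. e > 0 \<Longrightarrow> \<exists>N. \<forall>i\<ge>N. \<forall>j\<ge>N. (\<integral>x. \<bar>s i x - s j x\<bar> \<partial>M) < e"
  obtains F where "integrable M F" "(\<lambda>n. \<integral>x. \<bar>s n x - F x\<bar> \<partial>M) \<longlonglongrightarrow> 0"
proof -
  have [measurable]: "s n \<in> borel_measurable M" for n using int by auto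
  have cauchy': "\<And>e. e > 0 \<Longrightarrow> \<exists>N. \<forall>i\<ge>N. \<forall>j\<ge>N. (\<integral>x. norm (s i x - s j x) \<partial>M) < e"
    using cauchy by simp
  obtain r where r: "strict_mono r" "AE x in M. Cauchy (\<lambda>i. s (r i) x)"
    using cauchy_L1_AE_cauchy_subseq[OF int cauchy'] by metis
  define F where "F x = lim (\<lambda>i. s (r i) x)" for x
  have F [measurable]: "F \<in> borel_measurable M" unfolding F_def by measurable
  have lim: "AE x in M. (\<lambda>i. s (r i) x) \<longlonglongrightarrow> F x"
    using r(2) by eventually_elim (simp add: F_def Cauchy_convergent_iff convergent_LIMSEQ_iff)
  \<comment> \<open>Fatou with \<open>n\<close> fixed and the second index running along
    \<open>r\<close>. The nonnegative integral is used because integrability of \<open>F\<close> is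
    not yet known; it follows from this bound with \<open>e = 1\<close>.\<close>
  have bound: "(\<integral>\<^sup>+x. ennreal \<bar>s n x - F x\<bar> \<partial>M) \<le> ennreal e"
    if N: "\<forall>i\<ge>N. \<forall>j\<ge>N. (\<integral>x. \<bar>s i x - s j x\<bar> \<partial>M) < e" and n: "n \<ge> N" for n N e
  proof -
    have "(\<integral>\<^sup>+x. ennreal \<bar>s n x - F x\<bar> \<partial>M) = (\<integral>\<^sup>+x. liminf (\<lambda>i. ennreal \<bar>s n x - s (r i) x\<bar>) \<partial>M)"
    proof (rule nn_integral_cong_AE)
      show "AE x in M. ennreal \<bar>s n x - F x\<bar> = liminf (\<lambda>i. ennreal \<bar>s n x - s (r i) x\<bar>)"
        using lim
      proof eventually_elim
        fix x assume "(\<lambda>i. s (r i) x) \<longlonglongrightarrow> F x"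
        then have "(\<lambda>i. ennreal \<bar>s n x - s (r i) x\<bar>) \<longlonglongrightarrow> ennreal \<bar>s n x - F x\<bar>"
          by (intro tendsto_ennrealI tendsto_rabs tendsto_diff tendsto_const)
        from lim_imp_Liminf[OF _ this] show "ennreal \<bar>s n x - F x\<bar> = liminf (\<lambda>i. ennreal \<bar>s n x - s (r i) x\<bar>)"
          by simp
      qed
    qed
    also have "\<dots> \<le> liminf (\<lambda>i. \<integral>\<^sup>+x. ennreal \<bar>s n x - s (r i) x\<bar> \<partial>M)"
      by (intro nn_integral_liminf) measurable
    also have "\<dots> \<le> liminf (\<lambda>i. ennreal e)"
    proof (rule Liminf_mono, rule eventually_sequentiallyI)
      fix i assume "i \<ge> N"
      then have "r i \<ge> N" using r(1) le_trans seq_suble by blast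
      have "(\<integral>\<^sup>+x. ennreal \<bar>s n x - s (r i) x\<bar> \<partial>M) = ennreal (\<integral>x. \<bar>s n x - s (r i) x\<bar> \<partial>M)"
        by (intro nn_integral_eq_integral) (auto intro!: integrable_abs Bochner_Integration.integrable_diff int)
      also have "\<dots> \<le> ennreal e"
        using N n \<open>r i \<ge> N\<close> by (intro ennreal_leI) (auto intro: less_imp_le)
      finally show "(\<integral>\<^sup>+x. ennreal \<bar>s n x - s (r i) x\<bar> \<partial>M) \<le> ennreal e" .
    qed
    finally show ?thesis by (simp add: Liminf_const)
  qed
  obtain N1 where N1: "\<forall>i\<ge>N1. \<forall>j\<ge>N1. (\<integral>x. \<bar>s i x - s j x\<bar> \<partial>M) < 1"
    using cauchy[of 1] by auto
  have "(\<integral>\<^sup>+x. ennreal (norm (s N1 x - F x)) \<partial>M) < \<infinity>"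
    using le_less_trans[OF bound[OF N1, of N1] ennreal_less_top] by simp
  then have "integrable M (\<lambda>x. s N1 x - F x)"
    by (intro integrableI_bounded) measurable
  then have "integrable M (\<lambda>x. s N1 x - (s N1 x - F x))"
    by (rule Bochner_Integration.integrable_diff[OF int])
  also have "(\<lambda>x. s N1 x - (s N1 x - F x)) = F" by auto
  finally have intF: "integrable M F" .
  have "(\<lambda>n. \<integral>x. \<bar>s n x - F x\<bar> \<partial>M) \<longlonglongrightarrow> 0"
  proof (rule LIMSEQ_I)
    fix e :: real assume "e > 0"
    then obtain N where N: "\<forall>i\<ge>N. \<forall>j\<ge>N. (\<integral>x. \<bar>s i x - s j x\<bar> \<partial>M) < e / 2"
      using cauchy[of "e / 2"] by auto
    have "(\<integral>x. \<bar>s n x - F x\<bar> \<partial>M) \<le> e / 2" if "n \<ge> N" for n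
    proof -
      have "ennreal (\<integral>x. \<bar>s n x - F x\<bar> \<partial>M) = (\<integral>\<^sup>+x. ennreal \<bar>s n x - F x\<bar> \<partial>M)"
        by (intro nn_integral_eq_integral[symmetric])
          (auto intro!: integrable_abs Bochner_Integration.integrable_diff int intF)
      then have "ennreal (\<integral>x. \<bar>s n x - F x\<bar> \<partial>M) \<le> ennreal (e / 2)"
        using bound[OF N that] by (simp only:)
      then show ?thesis
        using \<open>e > 0\<close> by (subst (asm) ennreal_le_iff) auto
    qed
    then have "norm ((\<integral>x. \<bar>s n x - F x\<bar> \<partial>M) - 0) < e" if "n \<ge> N" for n
      using \<open>e > 0\<close> that by fastforce
    then show "\<exists>no. \<forall>n\<ge>no. norm ((\<integral>x. \<bar>s n x - F x\<bar> \<partial>M) - 0) < e" by blast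
  qed
  with intF that show ?thesis by blast
qed

section \<open>Square integrable real functions and their seminorm\<close>

definition square_integrable :: "'a measure \<Rightarrow> ('a \<Rightarrow> real) \<Rightarrow> bool" where
  "square_integrable M f \<longleftrightarrow> f \<in> borel_measurable M \<and> integrable M (\<lambda>x. (f x)\<^sup>2)"

text \<open>If the square is not integrable, the Bochner integral defaults to 0 and so does this
  value. Hence the Cauchy-Schwarz and triangle inequalities carry \<open>square_integrable\<close>
  hypotheses.\<close>

definition L2_norm :: "'a measure \<Rightarrow> ('a \<Rightarrow> real) \<Rightarrow> real" where
  "L2_norm M f = sqrt (\<integral>x. (f x)\<^sup>2 \<partial>M)"

lemma square_integrable_measurable [measurable_dest]:
  "square_integrable M f \<Longrightarrow> f \<in> borel_measurable M"
  by (simp add: square_integrable_def)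

lemma L2_norm_nonneg [simp]: "L2_norm M f \<ge> 0"
  by (simp add: L2_norm_def)

lemma L2_norm_square: "(L2_norm M f)\<^sup>2 = (\<integral>x. (f x)\<^sup>2 \<partial>M)"
  by (simp add: L2_norm_def)

lemma L2_integrable_mult:
  assumes f: "square_integrable M f" and g: "square_integrable M g"
  shows "integrable M (\<lambda>x. f x * g x)"
proof (rule Bochner_Integration.integrable_bound)
  show "integrable M (\<lambda>x. (f x)\<^sup>2 + (g x)\<^sup>2)"
    using f g by (auto simp: square_integrable_def)
  show "(\<lambda>x. f x * g x) \<in> borel_measurable M"
    using f g by (auto simp: square_integrable_def)
  have "\<bar>f x * g x\<bar> \<le> (f x)\<^sup>2 + (g x)\<^sup>2" for x
  proof -
    have "2 * (\<bar>f x\<bar> * \<bar>g x\<bar>) \<le> (f x)\<^sup>2 + (g x)\<^sup>2"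
      using sum_squares_bound[of "\<bar>f x\<bar>" "\<bar>g x\<bar>"] by (simp add: mult.assoc)
    moreover have "0 \<le> \<bar>f x\<bar> * \<bar>g x\<bar>" by simp
    ultimately show ?thesis unfolding abs_mult by linarith
  qed
  then show "AE x in M. norm (f x * g x) \<le> norm ((f x)\<^sup>2 + (g x)\<^sup>2)" by simp
qed

text \<open>The absolute value stays inside the integral, so that the L^1 norm of a product is
  bounded. This is needed for differences of squares and, with the constant 1, for passing from L^2
  to L^1 under \<open>P\<close>.\<close>

lemma L2_Cauchy_Schwarz:
  assumes f: "square_integrable M f" and g: "square_integrable M g"
  shows "(\<integral>x. \<bar>f x * g x\<bar> \<partial>M) \<le> L2_norm M f * L2_norm M g"
proof -
  have [measurable]: "f \<in> borel_measurable M" "g \<in> borel_measurable M"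
    using f g by (auto simp: square_integrable_def)
  have sq: "(\<integral>\<^sup>+x. (ennreal \<bar>h x\<bar>)\<^sup>2 \<partial>M) = ennreal ((L2_norm M h)\<^sup>2)"
    if "square_integrable M h" for h
  proof -
    have "(\<integral>\<^sup>+x. (ennreal \<bar>h x\<bar>)\<^sup>2 \<partial>M) = (\<integral>\<^sup>+x. ennreal ((h x)\<^sup>2) \<partial>M)"
      by (simp add: ennreal_power)
    also have "\<dots> = ennreal (\<integral>x. (h x)\<^sup>2 \<partial>M)"
      using that by (intro nn_integral_eq_integral) (auto simp: square_integrable_def)
    finally show ?thesis by (simp add: L2_norm_square)
  qed
  have "(\<integral>\<^sup>+x. ennreal \<bar>f x\<bar> * ennreal \<bar>g x\<bar> \<partial>M) = ennreal (\<integral>x. \<bar>f x * g x\<bar> \<partial>M)"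
    using L2_integrable_mult[OF f g, THEN integrable_abs]
    by (subst nn_integral_eq_integral[symmetric]) (auto simp: abs_mult ennreal_mult)
  then have "ennreal ((\<integral>x. \<bar>f x * g x\<bar> \<partial>M)\<^sup>2) \<le> ennreal ((L2_norm M f * L2_norm M g)\<^sup>2)"
    using Cauchy_Schwarz_nn_integral[of "\<lambda>x. ennreal \<bar>f x\<bar>" M "\<lambda>x. ennreal \<bar>g x\<bar>"] sq[OF f] sq[OF g]
    by (simp add: ennreal_power ennreal_mult[symmetric] power_mult_distrib)
  then have "(\<integral>x. \<bar>f x * g x\<bar> \<partial>M)\<^sup>2 \<le> (L2_norm M f * L2_norm M g)\<^sup>2"
    by (simp add: ennreal_le_iff)
  then show ?thesis
    by (rule power2_le_imp_le) simp
qed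

lemma square_integrable_add:
  assumes f: "square_integrable M f" and g: "square_integrable M g"
  shows "square_integrable M (\<lambda>x. f x + g x)"
proof -
  have "integrable M (\<lambda>x. (f x)\<^sup>2 + (g x)\<^sup>2 + 2 * (f x * g x))"
    using f g L2_integrable_mult[OF f g] by (auto simp: square_integrable_def)
  moreover have "(\<lambda>x. (f x + g x)\<^sup>2) = (\<lambda>x. (f x)\<^sup>2 + (g x)\<^sup>2 + 2 * (f x * g x))"
    by (auto simp: power2_sum)
  ultimately show ?thesis
    using f g by (auto simp: square_integrable_def)
qed

lemma square_integrable_cmult:
  assumes f: "square_integrable M f"
  shows "square_integrable M (\<lambda>x. c * f x)"
  using f by (auto simp: square_integrable_def power_mult_distrib)

lemma square_integrable_diff:
  assumes f: "square_integrable M f" and g: "square_integrable M g"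
  shows "square_integrable M (\<lambda>x. f x - g x)"
  using square_integrable_add[OF f square_integrable_cmult[OF g, of "-1"]] by simp

lemma square_integrable_sum:
  assumes "\<And>i. i \<in> I \<Longrightarrow> square_integrable M (f i)"
  shows "square_integrable M (\<lambda>x. \<Sum>i\<in>I. f i x)"
  using assms
  by (induction I rule: infinite_finite_induct)
    (auto intro: square_integrable_add simp: square_integrable_def[of _ "\<lambda>_. 0"])

lemma L2_norm_cmult: "L2_norm M (\<lambda>x. c * f x) = \<bar>c\<bar> * L2_norm M f"
  by (simp add: L2_norm_def power_mult_distrib real_sqrt_mult)

lemma L2_norm_add_le:
  assumes f: "square_integrable M f" and g: "square_integrable M g"
  shows "L2_norm M (\<lambda>x. f x + g x) \<le> L2_norm M f + L2_norm M g"
proof (rule power2_le_imp_le)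
  note [simp] = L2_integrable_mult[OF f g]
  have [simp]: "integrable M (\<lambda>x. (f x)\<^sup>2)" "integrable M (\<lambda>x. (g x)\<^sup>2)"
    using f g by (auto simp: square_integrable_def)
  have "(L2_norm M (\<lambda>x. f x + g x))\<^sup>2 = (\<integral>x. (f x)\<^sup>2 + (g x)\<^sup>2 + 2 * (f x * g x) \<partial>M)"
    by (simp add: L2_norm_square power2_sum mult.assoc)
  also have "\<dots> = (L2_norm M f)\<^sup>2 + (L2_norm M g)\<^sup>2 + 2 * (\<integral>x. f x * g x \<partial>M)"
    by (simp add: L2_norm_square)
  also have "(\<integral>x. f x * g x \<partial>M) \<le> (\<integral>x. \<bar>f x * g x\<bar> \<partial>M)"
    by (intro integral_mono) auto
  also have "\<dots> \<le> L2_norm M f * L2_norm M g"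
    by (rule L2_Cauchy_Schwarz[OF f g])
  finally show "(L2_norm M (\<lambda>x. f x + g x))\<^sup>2 \<le> (L2_norm M f + L2_norm M g)\<^sup>2"
    by (simp add: power2_sum)
qed simp

lemma L2_norm_diff_le:
  assumes f: "square_integrable M f" and g: "square_integrable M g"
  shows "L2_norm M (\<lambda>x. f x - g x) \<le> L2_norm M f + L2_norm M g"
  using L2_norm_add_le[OF f square_integrable_cmult[OF g, of "-1"]] L2_norm_cmult[of M "-1" g] by simp

lemma L2_norm_sum_le:
  assumes "\<And>i. i \<in> I \<Longrightarrow> square_integrable M (f i)"
  shows "L2_norm M (\<lambda>x. \<Sum>i\<in>I. f i x) \<le> (\<Sum>i\<in>I. L2_norm M (f i))"
  using assms
proof (induction I rule: infinite_finite_induct)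
  case (insert i I)
  have "L2_norm M (\<lambda>x. \<Sum>i\<in>insert i I. f i x) \<le> L2_norm M (f i) + L2_norm M (\<lambda>x. \<Sum>i\<in>I. f i x)"
    using insert by (simp add: L2_norm_add_le square_integrable_sum)
  also have "L2_norm M (\<lambda>x. \<Sum>i\<in>I. f i x) \<le> (\<Sum>i\<in>I. L2_norm M (f i))"
    using insert by simp
  finally show ?case using insert by simp
qed (auto simp: L2_norm_def)

text \<open>Solved for the difference: sums of averages will be bounded from below and differences
  must be bounded from above.\<close>

lemma L2_parallelogram:
  assumes f: "square_integrable M f" and g: "square_integrable M g"
  shows "(L2_norm M (\<lambda>x. f x - g x))\<^sup>2
    = 2 * (L2_norm M f)\<^sup>2 + 2 * (L2_norm M g)\<^sup>2 - (L2_norm M (\<lambda>x. f x + g x))\<^sup>2"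
proof -
  have [simp]: "integrable M (\<lambda>x. (f x)\<^sup>2)" "integrable M (\<lambda>x. (g x)\<^sup>2)"
     "integrable M (\<lambda>x. (f x + g x)\<^sup>2)"
    using f g square_integrable_add[OF f g] by (auto simp: square_integrable_def)
  have "(\<integral>x. (f x - g x)\<^sup>2 \<partial>M) = (\<integral>x. 2 * (f x)\<^sup>2 + 2 * (g x)\<^sup>2 - (f x + g x)\<^sup>2 \<partial>M)"
    by (intro Bochner_Integration.integral_cong) (auto simp: power2_eq_square algebra_simps)
  then show ?thesis by (simp add: L2_norm_square)
qed

section \<open>The mean ergodic theorem\<close>

text \<open>Invariance is an equation between measures, so every change of variables is an instance
  of \<open>integral_distr\<close>. The locale is interpreted both for the infinite measure and for
  an invariant probability.\<close>

locale measure_endomorphism =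
  fixes M :: "'a measure" and T :: "'a \<Rightarrow> 'a"
  assumes T_measurable [measurable]: "T \<in> M \<rightarrow>\<^sub>M M"
    and distr_T: "distr M M T = M"
begin

lemma funpow_measurable [measurable]: "(T ^^ k) \<in> M \<rightarrow>\<^sub>M M"
  by (rule measurable_compose_n) measurable

lemma distr_funpow: "distr M M (T ^^ k) = M"
proof (induction k)
  case 0
  then show ?case by (simp add: distr_id)
next
  case (Suc k)
  have "distr M M (T ^^ Suc k) = distr (distr M M (T ^^ k)) M T"
    by (subst distr_distr) auto
  then show ?case by (simp only: Suc distr_T)
qed

lemma integral_funpow:
  fixes f :: "'a \<Rightarrow> real"
  assumes "f \<in> borel_measurable M"
  shows "(\<integral>x. f ((T ^^ k) x) \<partial>M) = (\<integral>x. f x \<partial>M)"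
  using integral_distr[of "T ^^ k" M M f] assms by (simp add: distr_funpow)

lemma integrable_funpow:
  fixes f :: "'a \<Rightarrow> real"
  assumes "integrable M f"
  shows "integrable M (\<lambda>x. f ((T ^^ k) x))"
  using integrable_distr[of "T ^^ k" M M f] assms by (simp add: distr_funpow)

lemma integral_comp_T:
  fixes f :: "'a \<Rightarrow> real"
  assumes "f \<in> borel_measurable M"
  shows "(\<integral>x. f (T x) \<partial>M) = (\<integral>x. f x \<partial>M)"
  using integral_funpow[OF assms, of 1] by simp

lemma square_integrable_funpow:
  assumes "square_integrable M f"
  shows "square_integrable M (\<lambda>x. f ((T ^^ k) x))"
  using assms integrable_funpow[of "\<lambda>x. (f x)\<^sup>2" k]
  by (auto simp: square_integrable_def)

lemma L2_norm_funpow: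
  assumes "square_integrable M f"
  shows "L2_norm M (\<lambda>x. f ((T ^^ k) x)) = L2_norm M f"
  using assms integral_funpow[of "\<lambda>x. (f x)\<^sup>2" k]
  by (auto simp: square_integrable_def L2_norm_def)

section \<open>Ergodic averages as contractions and their shifts\<close>

lemma ergodic_average_measurable [measurable]:
  "f \<in> borel_measurable M \<Longrightarrow> ergodic_average T f n \<in> borel_measurable M"
  unfolding ergodic_average_def
  by (intro borel_measurable_times borel_measurable_const borel_measurable_sum)
    (rule measurable_compose[OF funpow_measurable])

lemma integrable_ergodic_average:
  assumes "integrable M f"
  shows "integrable M (ergodic_average T f n)"
  unfolding ergodic_average_def using assms by (auto intro!: integrable_funpow)

lemma square_integrable_ergodic_average:
  assumes "square_integrable M f"
  shows "square_integrable M (ergodic_average T f n)"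
  unfolding ergodic_average_def
  by (intro square_integrable_cmult square_integrable_sum square_integrable_funpow assms)

lemma ergodic_average_add:
  "ergodic_average T (\<lambda>x. f x + g x) n x = ergodic_average T f n x + ergodic_average T g n x"
  by (simp add: ergodic_average_def sum.distrib algebra_simps)

lemma integral_abs_ergodic_average_le:
  assumes f: "integrable M f"
  shows "(\<integral>x. \<bar>ergodic_average T f n x\<bar> \<partial>M) \<le> (\<integral>x. \<bar>f x\<bar> \<partial>M)"
proof -
  have "(\<integral>x. \<bar>ergodic_average T f n x\<bar> \<partial>M)
      \<le> (\<integral>x. (1 / real n) * (\<Sum>k=1..n. \<bar>f ((T ^^ k) x)\<bar>) \<partial>M)"
  proof (rule integral_mono)
    show "\<bar>ergodic_average T f n x\<bar> \<le> (1 / real n) * (\<Sum>k=1..n. \<bar>f ((T ^^ k) x)\<bar>)" for x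
      unfolding ergodic_average_def abs_mult
      by (intro mult_mono sum_abs) auto
  qed (auto intro!: integrable_abs integrable_ergodic_average integrable_funpow f)
  also have "\<dots> = (1 / real n) * (\<Sum>k=1..n. \<integral>x. \<bar>f ((T ^^ k) x)\<bar> \<partial>M)"
    using f by (simp add: Bochner_Integration.integral_sum integrable_funpow)
  also have "\<dots> = (1 / real n) * (\<Sum>k=1..n. \<integral>x. \<bar>f x\<bar> \<partial>M)"
    using integral_funpow[of "\<lambda>x. \<bar>f x\<bar>"] f by auto
  \<comment> \<open>At \<open>n = 0\<close> the average is 0, since division by zero gives 0; the
    estimate then only needs a nonnegative right side.\<close>
  also have "\<dots> \<le> (\<integral>x. \<bar>f x\<bar> \<partial>M)"
    by (cases "n = 0") (auto intro: integral_nonneg_AE)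
  finally show ?thesis .
qed

lemma L2_norm_ergodic_average_le:
  assumes f: "square_integrable M f"
  shows "L2_norm M (ergodic_average T f n) \<le> L2_norm M f"
proof -
  have "L2_norm M (ergodic_average T f n)
      = (1 / real n) * L2_norm M (\<lambda>x. \<Sum>k=1..n. f ((T ^^ k) x))"
    unfolding ergodic_average_def by (subst L2_norm_cmult) simp
  also have "\<dots> \<le> (1 / real n) * (\<Sum>k=1..n. L2_norm M (\<lambda>x. f ((T ^^ k) x)))"
    by (intro mult_left_mono L2_norm_sum_le square_integrable_funpow f) auto
  also have "\<dots> = (1 / real n) * (real n * L2_norm M f)"
    by (simp add: L2_norm_funpow f)
  also have "\<dots> \<le> L2_norm M f"
    by (cases "n = 0") auto
  finally show ?thesis .
qed

text \<open>The sum telescopes, leaving two boundary terms; for \<open>n = 0\<close> both sides are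
  0.\<close>

lemma ergodic_average_shift_T:
  "ergodic_average T (\<lambda>x. f (T x)) n x - ergodic_average T f n x
     = (1 / real n) * (f ((T ^^ Suc n) x) - f (T x))"
proof -
  have "(\<Sum>k=1..n. f (T ((T ^^ k) x))) - (\<Sum>k=1..n. f ((T ^^ k) x)) = f ((T ^^ Suc n) x) - f (T x)"
    by (induction n) auto
  then show ?thesis
    by (simp add: ergodic_average_def right_diff_distrib[symmetric] diff_divide_distrib[symmetric])
qed

text \<open>Each single shift by \<open>T\<close> costs at most twice the norm divided by
  \<open>n\<close>, by telescoping. The next shift is a single shift of \<open>f\<close> composed
  with \<open>T ^^ m\<close>, which has the same norm as \<open>f\<close>, so the costs add up to
  the factor \<open>m\<close>.\<close>

lemma L2_norm_ergodic_average_shift_le: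
  assumes f: "square_integrable M f"
  shows "L2_norm M (\<lambda>x. ergodic_average T (\<lambda>x. f ((T ^^ m) x)) n x - ergodic_average T f n x)
     \<le> 2 * real m * L2_norm M f / real n"
proof (induction m)
  case 0
  then show ?case by (simp add: L2_norm_def)
next
  case (Suc m)
  define h where "h x = f ((T ^^ m) x)" for x
  have h: "square_integrable M h" unfolding h_def by (rule square_integrable_funpow[OF f])
  have hn: "L2_norm M h = L2_norm M f" unfolding h_def by (rule L2_norm_funpow[OF f])
  have hT: "square_integrable M (\<lambda>x. h (T x))" using square_integrable_funpow[OF h, of 1] by simp
  have hTn: "L2_norm M (\<lambda>x. h (T x)) = L2_norm M f" using L2_norm_funpow[OF h, of 1] hn by simp
  have "L2_norm M (\<lambda>x. ergodic_average T (\<lambda>x. h (T x)) n x - ergodic_average T h n x)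
    = (1 / real n) * L2_norm M (\<lambda>x. h ((T ^^ Suc n) x) - h (T x))"
    unfolding ergodic_average_shift_T by (subst L2_norm_cmult) simp
  also have "\<dots> \<le> (1 / real n) * (L2_norm M (\<lambda>x. h ((T ^^ Suc n) x)) + L2_norm M (\<lambda>x. h (T x)))"
    by (intro mult_left_mono L2_norm_diff_le square_integrable_funpow[OF h] hT) auto
  also have "\<dots> = 2 * L2_norm M f / real n"
    unfolding L2_norm_funpow[OF h] hTn hn by simp
  finally have 1: "L2_norm M (\<lambda>x. ergodic_average T (\<lambda>x. h (T x)) n x - ergodic_average T h n x)
    \<le> 2 * L2_norm M f / real n" .
  have eq: "(\<lambda>x. f ((T ^^ Suc m) x)) = (\<lambda>x. h (T x))"
    by (simp add: h_def funpow_swap1)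
  have "L2_norm M (\<lambda>x. ergodic_average T (\<lambda>x. h (T x)) n x - ergodic_average T f n x)
    = L2_norm M (\<lambda>x. (ergodic_average T (\<lambda>x. h (T x)) n x - ergodic_average T h n x)
        + (ergodic_average T h n x - ergodic_average T f n x))" by simp
  also have "\<dots> \<le> L2_norm M (\<lambda>x. ergodic_average T (\<lambda>x. h (T x)) n x - ergodic_average T h n x)
      + L2_norm M (\<lambda>x. ergodic_average T h n x - ergodic_average T f n x)"
    by (intro L2_norm_add_le square_integrable_diff square_integrable_ergodic_average f h hT)
  also have "\<dots> \<le> 2 * L2_norm M f / real n + 2 * real m * L2_norm M f / real n"
    using 1 Suc.IH unfolding h_def[symmetric] by (intro add_mono)
  also have "\<dots> = 2 * real (Suc m) * L2_norm M f / real n"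
    by (simp add: field_simps add_divide_distrib)
  finally show ?case unfolding eq .
qed

text \<open>Averaging over \<open>m\<close> first and over \<open>n\<close> afterwards is the mean,
  for \<open>k\<close> from 1 to \<open>m\<close>, of the \<open>n\<close>-averages of
  \<open>f\<close> shifted by \<open>k\<close>. Each shift costs at most what the shift by
  \<open>m\<close> may cost, hence so does the mean.\<close>

lemma L2_norm_ergodic_average_iterate_le:
  assumes f: "square_integrable M f" and m: "m \<ge> 1"
  shows "L2_norm M (\<lambda>x. ergodic_average T (ergodic_average T f m) n x - ergodic_average T f n x)
     \<le> 2 * real m * L2_norm M f / real n"
proof -
  define D where "D k x = ergodic_average T (\<lambda>x. f ((T ^^ k) x)) n x - ergodic_average T f n x" for k x
  have D: "square_integrable M (D k)" for k
    unfolding D_def by (intro square_integrable_diff square_integrable_ergodic_average square_integrable_funpow f)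
  have "ergodic_average T (ergodic_average T f m) n x - ergodic_average T f n x
      = (1 / real m) * (\<Sum>k=1..m. D k x)" for x
  proof -
    have "ergodic_average T (ergodic_average T f m) n x
      = (1 / real m) * (\<Sum>k=1..m. ergodic_average T (\<lambda>x. f ((T ^^ k) x)) n x)"
      unfolding ergodic_average_def
      by (simp add: sum_distrib_left sum_divide_distrib) (subst sum.swap, simp add: mult.commute)
    moreover have "(\<Sum>k=1..m. ergodic_average T f n x) = real m * ergodic_average T f n x" by simp
    ultimately show ?thesis
      using m by (simp add: D_def sum_subtractf right_diff_distrib diff_divide_distrib)
  qed
  then have "L2_norm M (\<lambda>x. ergodic_average T (ergodic_average T f m) n x - ergodic_average T f n x)
      = (1 / real m) * L2_norm M (\<lambda>x. \<Sum>k=1..m. D k x)"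
    by (simp only:) (subst L2_norm_cmult, simp)
  also have "\<dots> \<le> (1 / real m) * (\<Sum>k=1..m. L2_norm M (D k))"
    by (intro mult_left_mono L2_norm_sum_le D) auto
  also have "\<dots> \<le> (1 / real m) * (\<Sum>k=1..m. 2 * real m * L2_norm M f / real n)"
  proof (intro mult_left_mono sum_mono)
    fix k assume "k \<in> {1..m}"
    then have "2 * real k * L2_norm M f / real n \<le> 2 * real m * L2_norm M f / real n"
      by (intro divide_right_mono mult_right_mono mult_left_mono) auto
    then show "L2_norm M (D k) \<le> 2 * real m * L2_norm M f / real n"
      using L2_norm_ergodic_average_shift_le[OF f, of k n] unfolding D_def by linarith
  qed auto
  also have "\<dots> = 2 * real m * L2_norm M f / real n"
    using m by simp
  finally show ?thesis .
qed


text \<open>The limit \<open>d\<close> is the infimum of the norms. A sum of two late averages has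
  norm at least \<open>2 * d\<close> while each has norm close to \<open>d\<close>, so the
  parallelogram law leaves no room for their difference.\<close>

lemma L2_norm_ergodic_average_Cauchy:
  assumes f: "square_integrable M f"
  obtains d where "d \<ge> 0" "(\<lambda>n. L2_norm M (ergodic_average T f n)) \<longlonglongrightarrow> d"
    "\<And>e. e > 0 \<Longrightarrow> \<exists>N. \<forall>i\<ge>N. \<forall>j\<ge>N.
       (L2_norm M (\<lambda>x. ergodic_average T f i x - ergodic_average T f j x))\<^sup>2 < e"
proof -
  define a where "a = ergodic_average T f"
  have a: "square_integrable M (a n)" for n
    unfolding a_def by (rule square_integrable_ergodic_average[OF f])
  \<comment> \<open>The index 0 is left out because the average is 0 there, which would force the
    infimum to be 0.\<close>
  define d where "d = (INF n\<in>{1..}. L2_norm M (a n))"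
  have bdd: "bdd_below ((\<lambda>n. L2_norm M (a n)) ` {1..})"
    by (intro bdd_belowI[of _ 0]) auto
  have d_le: "d \<le> L2_norm M (a n)" if "n \<ge> 1" for n
    unfolding d_def using that by (intro cINF_lower[OF bdd]) auto
  have d0: "d \<ge> 0"
    unfolding d_def by (intro cINF_greatest) auto
  \<comment> \<open>Averaging \<open>a m\<close> again cannot increase its norm and reproduces
    \<open>a n\<close> up to an error of order 1 / \<open>n\<close>. So one small norm makes all
    later ones small.\<close>
  have near: "L2_norm M (a n) \<le> L2_norm M (a m) + 2 * real m * L2_norm M f / real n"
    if m: "m \<ge> 1" for m n
  proof -
    have "L2_norm M (a n) = L2_norm M (\<lambda>x. ergodic_average T (a m) n x
        - (ergodic_average T (a m) n x - a n x))"
      by simp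
    also have "\<dots> \<le> L2_norm M (ergodic_average T (a m) n)
        + L2_norm M (\<lambda>x. ergodic_average T (a m) n x - a n x)"
      by (intro L2_norm_diff_le square_integrable_diff square_integrable_ergodic_average a)
    also have "\<dots> \<le> L2_norm M (a m) + 2 * real m * L2_norm M f / real n"
      unfolding a_def
      by (intro add_mono L2_norm_ergodic_average_le L2_norm_ergodic_average_iterate_le
          square_integrable_ergodic_average f m)
    finally show ?thesis .
  qed
  have lim: "(\<lambda>n. L2_norm M (a n)) \<longlonglongrightarrow> d"
  proof (rule LIMSEQ_I)
    fix e :: real assume "e > 0"
    have "d < d + e / 2" using \<open>e > 0\<close> by simp
    then obtain m where m: "m \<ge> 1" "L2_norm M (a m) < d + e / 2"
      unfolding d_def cINF_less_iff[OF _ bdd, simplified] by (subst (asm) cINF_less_iff[OF _ bdd]) auto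
    have "(\<lambda>n. 2 * real m * L2_norm M f / real n) \<longlonglongrightarrow> 0"
      by (rule lim_const_over_n)
    then obtain N where N: "\<And>n. n \<ge> N \<Longrightarrow> norm (2 * real m * L2_norm M f / real n - 0) < e / 2"
      using LIMSEQ_D[of _ 0 "e / 2"] \<open>e > 0\<close> by (metis half_gt_zero)
    have "norm (L2_norm M (a n) - d) < e" if n: "n \<ge> max N 1" for n
    proof -
      have "2 * real m * L2_norm M f / real n < e / 2"
        using N[of n] n by (simp only: real_norm_def diff_0_right) linarith
      then show ?thesis
        using near[OF m(1), of n] m(2) d_le[of n] n unfolding real_norm_def by linarith
    qed
    then show "\<exists>no. \<forall>n\<ge>no. norm (L2_norm M (a n) - d) < e" by blast
  qed
  \<comment> \<open>The \<open>n\<close>-average of \<open>a i + a j\<close> is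
    \<open>2 * a n\<close> up to an error vanishing with \<open>n\<close>, and its norm is at most
    that of \<open>a i + a j\<close>. Letting \<open>n\<close> grow gives the bound.\<close>
  have sum_ge: "2 * d \<le> L2_norm M (\<lambda>x. a i x + a j x)" if i: "i \<ge> 1" and j: "j \<ge> 1" for i j
  proof -
    let ?s = "\<lambda>x. a i x + a j x"
    have s: "square_integrable M ?s" by (intro square_integrable_add a)
    have "2 * d \<le> L2_norm M ?s + (2 * real i + 2 * real j) * L2_norm M f / real n" if n: "n \<ge> 1" for n
    proof -
      let ?D = "\<lambda>m x. ergodic_average T (a m) n x - a n x"
      have D: "square_integrable M (?D m)" for m
        by (intro square_integrable_diff square_integrable_ergodic_average a)
      have "2 * L2_norm M (a n) = L2_norm M (\<lambda>x. ergodic_average T ?s n x - (?D i x + ?D j x))"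
        using L2_norm_cmult[of M 2 "a n"] by (simp add: ergodic_average_add)
      also have "\<dots> \<le> L2_norm M (ergodic_average T ?s n) + L2_norm M (\<lambda>x. ?D i x + ?D j x)"
        by (intro L2_norm_diff_le square_integrable_add D square_integrable_ergodic_average a)
      also have "L2_norm M (\<lambda>x. ?D i x + ?D j x) \<le> L2_norm M (?D i) + L2_norm M (?D j)"
        by (intro L2_norm_add_le D)
      also have "L2_norm M (?D i) \<le> 2 * real i * L2_norm M f / real n"
        unfolding a_def by (rule L2_norm_ergodic_average_iterate_le[OF f i])
      also have "L2_norm M (?D j) \<le> 2 * real j * L2_norm M f / real n"
        unfolding a_def by (rule L2_norm_ergodic_average_iterate_le[OF f j])
      also have "L2_norm M (ergodic_average T ?s n) \<le> L2_norm M ?s"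
        by (rule L2_norm_ergodic_average_le[OF s])
      finally show ?thesis
        using d_le[OF n] by (simp add: add_divide_distrib distrib_right)
    qed
    moreover have "(\<lambda>n. L2_norm M ?s + (2 * real i + 2 * real j) * L2_norm M f / real n)
        \<longlonglongrightarrow> L2_norm M ?s + 0"
      by (intro tendsto_add tendsto_const lim_const_over_n)
    ultimately show ?thesis
      by (intro LIMSEQ_le_const[of _ "L2_norm M ?s" "2 * d"]) auto
  qed
  \<comment> \<open>With both squared norms below \<open>d^2 + e / 4\<close>, the parallelogram law
    gives less than \<open>4 * d^2 + e - 4 * d^2 = e\<close>.\<close>
  have cauchy: "\<exists>N. \<forall>i\<ge>N. \<forall>j\<ge>N. (L2_norm M (\<lambda>x. a i x - a j x))\<^sup>2 < e" if e: "e > 0" for e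
  proof -
    have "(\<lambda>n. (L2_norm M (a n))\<^sup>2) \<longlonglongrightarrow> d\<^sup>2"
      by (intro tendsto_power lim)
    then obtain N where N: "\<And>n. n \<ge> N \<Longrightarrow> norm ((L2_norm M (a n))\<^sup>2 - d\<^sup>2) < e / 4"
      using LIMSEQ_D[of _ "d\<^sup>2" "e / 4"] e by (metis zero_less_divide_iff zero_less_numeral)
    have "(L2_norm M (\<lambda>x. a i x - a j x))\<^sup>2 < e" if i: "i \<ge> max N 1" and j: "j \<ge> max N 1" for i j
    proof -
      have "(2 * d)\<^sup>2 \<le> (L2_norm M (\<lambda>x. a i x + a j x))\<^sup>2"
        using sum_ge[of i j] i j d0 by (intro power_mono) auto
      then have "4 * d\<^sup>2 \<le> (L2_norm M (\<lambda>x. a i x + a j x))\<^sup>2"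
        by (simp add: power_mult_distrib)
      moreover have "(L2_norm M (a i))\<^sup>2 < d\<^sup>2 + e / 4" "(L2_norm M (a j))\<^sup>2 < d\<^sup>2 + e / 4"
        using N[of i] N[of j] i j unfolding real_norm_def by linarith+
      ultimately show ?thesis
        unfolding L2_parallelogram[OF a[of i] a[of j]] by linarith
    qed
    then show ?thesis by blast
  qed
  show ?thesis
    using that[OF d0 lim[unfolded a_def] cauchy[unfolded a_def]] by blast
qed


section \<open>An invariant density from the squared averages\<close>

lemma ergodic_average_T:
  "ergodic_average T f n (T x) = ergodic_average T (\<lambda>x. f (T x)) n x"
  by (simp add: ergodic_average_def funpow_swap1)

text \<open>Factoring u^2 - v^2 as (u - v)(u + v) turns L^2 closeness of averages into L^1 closeness
  of their squares. The L^1 limit has mass \<open>d^2 > 0\<close>. It is invariant as a density: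
  integrals of squared averages over \<open>A\<close> are those over the preimage of
  \<open>A\<close> after composing with \<open>T\<close>, and an average composed with
  \<open>T\<close> is close to itself.\<close>

lemma invariant_density:
  assumes f: "square_integrable M f"
    and not_zero: "\<not> (\<lambda>n. L2_norm M (ergodic_average T f n)) \<longlonglongrightarrow> 0"
  obtains G :: "'a \<Rightarrow> real" and c :: real where "integrable M G" "\<And>x. G x \<ge> 0" "c > 0" "(\<integral>x. G x \<partial>M) = c"
    "\<And>A. A \<in> sets M \<Longrightarrow> (\<integral>x. indicator A (T x) * G x \<partial>M) = (\<integral>x. indicator A x * G x \<partial>M)"
proof -
  define a where "a = ergodic_average T f"
  have a: "square_integrable M (a n)" for n
    unfolding a_def by (rule square_integrable_ergodic_average[OF f])
  note [measurable] = square_integrable_measurable[OF a]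
  have a_le: "L2_norm M (a n) \<le> L2_norm M f" for n
    unfolding a_def by (rule L2_norm_ergodic_average_le[OF f])
  have aT: "square_integrable M (\<lambda>x. a n (T x))" for n
    using square_integrable_funpow[OF a, of n 1] by simp
  have aT_le: "L2_norm M (\<lambda>x. a n (T x)) \<le> L2_norm M f" for n
    using L2_norm_funpow[OF a, of n 1] a_le by simp
  have int: "integrable M (\<lambda>x. (a n x)\<^sup>2)" for n
    using a by (simp add: square_integrable_def)
  have intT: "integrable M (\<lambda>x. (a n (T x))\<^sup>2)" for n
    using aT by (simp add: square_integrable_def)
  have diff_squares: "(\<integral>x. \<bar>(u x)\<^sup>2 - (v x)\<^sup>2\<bar> \<partial>M) \<le> L2_norm M (\<lambda>x. u x - v x) * (2 * L2_norm M f)"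
    if u: "square_integrable M u" and v: "square_integrable M v"
      and "L2_norm M u \<le> L2_norm M f" "L2_norm M v \<le> L2_norm M f" for u v
  proof -
    have "(\<integral>x. \<bar>(u x)\<^sup>2 - (v x)\<^sup>2\<bar> \<partial>M) = (\<integral>x. \<bar>(u x - v x) * (u x + v x)\<bar> \<partial>M)"
      by (intro Bochner_Integration.integral_cong) (auto simp: power2_eq_square algebra_simps)
    also have "\<dots> \<le> L2_norm M (\<lambda>x. u x - v x) * L2_norm M (\<lambda>x. u x + v x)"
      by (intro L2_Cauchy_Schwarz square_integrable_diff square_integrable_add u v)
    also have "\<dots> \<le> L2_norm M (\<lambda>x. u x - v x) * (2 * L2_norm M f)"
      using L2_norm_add_le[OF u v] that by (intro mult_left_mono) auto
    finally show ?thesis .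
  qed
  obtain d where d: "d \<ge> 0" "(\<lambda>n. L2_norm M (a n)) \<longlonglongrightarrow> d"
    and cauchy: "\<And>e. e > 0 \<Longrightarrow> \<exists>N. \<forall>i\<ge>N. \<forall>j\<ge>N. (L2_norm M (\<lambda>x. a i x - a j x))\<^sup>2 < e"
    using L2_norm_ergodic_average_Cauchy[OF f] unfolding a_def by metis
  have "d > 0"
    using d not_zero unfolding a_def by (cases "d = 0") auto
  have "\<exists>N. \<forall>i\<ge>N. \<forall>j\<ge>N. (\<integral>x. \<bar>(a i x)\<^sup>2 - (a j x)\<^sup>2\<bar> \<partial>M) < e" if e: "e > 0" for e
  proof -
    \<comment> \<open>Adding 1 allows division by \<open>K\<close> even when the norm of
      \<open>f\<close> is 0.\<close>
    define K where "K = 2 * L2_norm M f + 1"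
    have K: "K > 0" unfolding K_def using L2_norm_nonneg[of M f] by linarith
    obtain N where N: "\<forall>i\<ge>N. \<forall>j\<ge>N. (L2_norm M (\<lambda>x. a i x - a j x))\<^sup>2 < (e / K)\<^sup>2"
      using cauchy[of "(e / K)\<^sup>2"] e K by auto
    have "(\<integral>x. \<bar>(a i x)\<^sup>2 - (a j x)\<^sup>2\<bar> \<partial>M) < e" if "i \<ge> N" "j \<ge> N" for i j
    proof -
      have "L2_norm M (\<lambda>x. a i x - a j x) < e / K"
        using N that e K by (intro power_less_imp_less_base[of _ 2 "e / K"]) auto
      then have "L2_norm M (\<lambda>x. a i x - a j x) * K < e"
        using K by (simp add: pos_less_divide_eq)
      moreover have "L2_norm M (\<lambda>x. a i x - a j x) * (2 * L2_norm M f) \<le> L2_norm M (\<lambda>x. a i x - a j x) * K"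
        unfolding K_def by (intro mult_left_mono) auto
      ultimately show ?thesis
        using diff_squares[OF a a a_le a_le, of i j] by linarith
    qed
    then show ?thesis by blast
  qed
  with L1_complete[of M "\<lambda>n x. (a n x)\<^sup>2"] int
  obtain F where F: "integrable M F" "(\<lambda>n. \<integral>x. \<bar>(a n x)\<^sup>2 - F x\<bar> \<partial>M) \<longlonglongrightarrow> 0" by blast
  \<comment> \<open>The limit of squares is nonnegative only almost everywhere. Taking the absolute
    value makes it so everywhere and does not increase the distance to a square.\<close>
  define G where "G x = \<bar>F x\<bar>" for x
  have G: "integrable M G" unfolding G_def using F by auto
  then have [measurable]: "G \<in> borel_measurable M" by auto
  have limG: "(\<lambda>n. \<integral>x. indicator B x * (a n x)\<^sup>2 \<partial>M) \<longlonglongrightarrow> (\<integral>x. indicator B x * G x \<partial>M)"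
    if B [measurable]: "B \<in> sets M" for B
  proof -
    have "\<bar>(\<integral>x. indicator B x * (a n x)\<^sup>2 \<partial>M) - (\<integral>x. indicator B x * G x \<partial>M)\<bar>
        \<le> (\<integral>x. \<bar>(a n x)\<^sup>2 - F x\<bar> \<partial>M)" for n
    proof -
      have i: "integrable M (\<lambda>x. indicator B x * (a n x)\<^sup>2)" "integrable M (\<lambda>x. indicator B x * G x)"
        using integrable_mult_indicator[OF B int] integrable_mult_indicator[OF B G] by auto
      then have "\<bar>(\<integral>x. indicator B x * (a n x)\<^sup>2 \<partial>M) - (\<integral>x. indicator B x * G x \<partial>M)\<bar>
          = \<bar>\<integral>x. indicator B x * (a n x)\<^sup>2 - indicator B x * G x \<partial>M\<bar>" by simp
      also have "\<dots> \<le> (\<integral>x. \<bar>indicator B x * (a n x)\<^sup>2 - indicator B x * G x\<bar> \<partial>M)"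
        by (rule integral_abs_bound)
      also have "\<dots> \<le> (\<integral>x. \<bar>(a n x)\<^sup>2 - F x\<bar> \<partial>M)"
      proof (rule integral_mono)
        show "integrable M (\<lambda>x. \<bar>indicator B x * (a n x)\<^sup>2 - indicator B x * G x\<bar>)"
          using i by (intro integrable_abs Bochner_Integration.integrable_diff)
        show "integrable M (\<lambda>x. \<bar>(a n x)\<^sup>2 - F x\<bar>)"
          using int F by (intro integrable_abs Bochner_Integration.integrable_diff)
        fix x
        have "\<bar>(a n x)\<^sup>2 - \<bar>F x\<bar>\<bar> \<le> \<bar>(a n x)\<^sup>2 - F x\<bar>"
          using zero_le_power2[of "a n x"] by linarith
        then show "\<bar>indicator B x * (a n x)\<^sup>2 - indicator B x * G x\<bar> \<le> \<bar>(a n x)\<^sup>2 - F x\<bar>"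
          by (auto simp: G_def indicator_def)
      qed
      finally show ?thesis .
    qed
    then have "(\<lambda>n. (\<integral>x. indicator B x * (a n x)\<^sup>2 \<partial>M) - (\<integral>x. indicator B x * G x \<partial>M)) \<longlonglongrightarrow> 0"
      by (intro Lim_null_comparison[OF _ F(2)]) auto
    then show ?thesis by (simp add: LIM_zero_iff)
  qed
  have total: "(\<integral>x. G x \<partial>M) = d\<^sup>2"
  proof (rule LIMSEQ_unique)
    have *: "(\<integral>x. indicator (space M) x * u x \<partial>M) = (\<integral>x. u x \<partial>M)" for u :: "'a \<Rightarrow> real"
      by (intro Bochner_Integration.integral_cong) auto
    show "(\<lambda>n. (L2_norm M (a n))\<^sup>2) \<longlonglongrightarrow> (\<integral>x. G x \<partial>M)"
      using limG[of "space M"] by (simp add: * L2_norm_square)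
    show "(\<lambda>n. (L2_norm M (a n))\<^sup>2) \<longlonglongrightarrow> d\<^sup>2"
      by (intro tendsto_power d)
  qed
  have inv: "(\<integral>x. indicator A (T x) * G x \<partial>M) = (\<integral>x. indicator A x * G x \<partial>M)"
    if A [measurable]: "A \<in> sets M" for A
  proof -
    let ?B = "T -` A \<inter> space M"
    have B: "?B \<in> sets M" by measurable
    have preimage: "(\<integral>x. indicator ?B x * u x \<partial>M) = (\<integral>x. indicator A (T x) * u x \<partial>M)" for u :: "'a \<Rightarrow> real"
      by (intro Bochner_Integration.integral_cong) (auto simp: indicator_def)
    have shift: "(\<integral>x. indicator A x * (a n x)\<^sup>2 \<partial>M) = (\<integral>x. indicator A (T x) * (a n (T x))\<^sup>2 \<partial>M)" for n
      by (rule integral_comp_T[symmetric]) measurable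
    \<comment> \<open>The constant is the product of the two factors in \<open>diff_squares\<close>:
      one shift by \<open>T\<close> costs \<open>2 * L2_norm M f / real n\<close>, and the sum of
      the two functions has norm at most \<open>2 * L2_norm M f\<close>.\<close>
    have close: "\<bar>(\<integral>x. indicator A x * (a n x)\<^sup>2 \<partial>M) - (\<integral>x. indicator ?B x * (a n x)\<^sup>2 \<partial>M)\<bar>
        \<le> 4 * (L2_norm M f)\<^sup>2 / real n" for n
    proof -
      have i: "integrable M (\<lambda>x. indicator ?B x * (a n (T x))\<^sup>2)" "integrable M (\<lambda>x. indicator ?B x * (a n x)\<^sup>2)"
        using integrable_mult_indicator[OF B int] integrable_mult_indicator[OF B intT] by auto
      have "\<bar>(\<integral>x. indicator A x * (a n x)\<^sup>2 \<partial>M) - (\<integral>x. indicator ?B x * (a n x)\<^sup>2 \<partial>M)\<bar>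
        = \<bar>\<integral>x. indicator ?B x * (a n (T x))\<^sup>2 - indicator ?B x * (a n x)\<^sup>2 \<partial>M\<bar>"
        unfolding shift preimage[symmetric] using i by simp
      also have "\<dots> \<le> (\<integral>x. \<bar>indicator ?B x * (a n (T x))\<^sup>2 - indicator ?B x * (a n x)\<^sup>2\<bar> \<partial>M)"
        by (rule integral_abs_bound)
      also have "\<dots> \<le> (\<integral>x. \<bar>(a n (T x))\<^sup>2 - (a n x)\<^sup>2\<bar> \<partial>M)"
      proof (rule integral_mono)
        show "integrable M (\<lambda>x. \<bar>indicator ?B x * (a n (T x))\<^sup>2 - indicator ?B x * (a n x)\<^sup>2\<bar>)"
          using i by (intro integrable_abs Bochner_Integration.integrable_diff)
        show "integrable M (\<lambda>x. \<bar>(a n (T x))\<^sup>2 - (a n x)\<^sup>2\<bar>)"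
          using int intT by (intro integrable_abs Bochner_Integration.integrable_diff)
      qed (auto simp: indicator_def)
      also have "\<dots> \<le> L2_norm M (\<lambda>x. a n (T x) - a n x) * (2 * L2_norm M f)"
        by (rule diff_squares[OF aT a aT_le a_le])
      also have "\<dots> \<le> (2 * real 1 * L2_norm M f / real n) * (2 * L2_norm M f)"
        using L2_norm_ergodic_average_shift_le[OF f, of 1 n]
        unfolding a_def ergodic_average_T by (intro mult_right_mono) auto
      finally show ?thesis by (simp add: power2_eq_square)
    qed
    have "(\<lambda>n. (\<integral>x. indicator A x * (a n x)\<^sup>2 \<partial>M) - (\<integral>x. indicator ?B x * (a n x)\<^sup>2 \<partial>M)) \<longlonglongrightarrow> 0"
      by (rule Lim_null_comparison[OF _ lim_const_over_n[of "4 * (L2_norm M f)\<^sup>2"]]) (use close in auto)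
    moreover have "(\<lambda>n. (\<integral>x. indicator A x * (a n x)\<^sup>2 \<partial>M) - (\<integral>x. indicator ?B x * (a n x)\<^sup>2 \<partial>M))
        \<longlonglongrightarrow> (\<integral>x. indicator A x * G x \<partial>M) - (\<integral>x. indicator ?B x * G x \<partial>M)"
      by (intro tendsto_diff limG A B)
    ultimately have "(\<integral>x. indicator A x * G x \<partial>M) - (\<integral>x. indicator ?B x * G x \<partial>M) = 0"
      using LIMSEQ_unique by blast
    then show ?thesis unfolding preimage by simp
  qed
  show ?thesis
    using that[of G "d\<^sup>2"] G total inv \<open>d > 0\<close> by (auto simp: G_def)
qed

lemma invariant_probability_exists:
  assumes f: "square_integrable M f"
    and not_zero: "\<not> (\<lambda>n. L2_norm M (ergodic_average T f n)) \<longlonglongrightarrow> 0"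
  shows "\<exists>\<nu>. prob_space \<nu> \<and> sets \<nu> = sets M \<and> invariant_measure T \<nu> \<and> absolutely_continuous M \<nu>"
proof -
  obtain G c where G: "integrable M G" "\<And>x. G x \<ge> 0" and c: "c > 0" "(\<integral>x. G x \<partial>M) = c"
    and inv: "\<And>A. A \<in> sets M \<Longrightarrow>
      (\<integral>x. indicat_real A (T x) * G x \<partial>M) = (\<integral>x. indicat_real A x * G x \<partial>M)"
    by (rule invariant_density[OF assms]) (rule that)
  have [measurable]: "G \<in> borel_measurable M" using G by auto
  define \<nu> where "\<nu> = density M (\<lambda>x. ennreal (G x / c))"
  have \<nu>: "emeasure \<nu> A = ennreal ((\<integral>x. indicator A x * G x \<partial>M) / c)" if A [measurable]: "A \<in> sets M" for A
  proof -
    have "emeasure \<nu> A = (\<integral>\<^sup>+x. ennreal (indicator A x * G x / c) \<partial>M)"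
      unfolding \<nu>_def by (subst emeasure_density) (auto intro!: nn_integral_cong simp: indicator_def)
    also have "\<dots> = ennreal (\<integral>x. indicator A x * G x / c \<partial>M)"
    proof (rule nn_integral_eq_integral)
      show "integrable M (\<lambda>x. indicator A x * G x / c)"
        using integrable_mult_indicator[OF A G(1)] by auto
    qed (use G c in auto)
    finally show ?thesis by simp
  qed
  have "prob_space \<nu>"
  proof
    have "(\<integral>x. indicator (space M) x * G x \<partial>M) = (\<integral>x. G x \<partial>M)"
      by (intro Bochner_Integration.integral_cong) auto
    then show "emeasure \<nu> (space \<nu>) = 1"
      using \<nu>[of "space M"] c by (simp add: \<nu>_def)
  qed
  moreover have "invariant_measure T \<nu>"
    unfolding invariant_measure_def
  proof
    fix A assume "A \<in> sets \<nu>"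
    then have A [measurable]: "A \<in> sets M" by (simp add: \<nu>_def)
    have "(\<integral>x. indicator (T -` A \<inter> space M) x * G x \<partial>M) = (\<integral>x. indicator A (T x) * G x \<partial>M)"
      by (intro Bochner_Integration.integral_cong) (auto simp: indicator_def)
    then have "emeasure \<nu> (T -` A \<inter> space M) = emeasure \<nu> A"
      by (subst \<nu>, measurable) (simp add: \<nu>[OF A] inv[OF A])
    then show "emeasure \<nu> (T -` A \<inter> space \<nu>) = emeasure \<nu> A" by (simp add: \<nu>_def)
  qed
  moreover have "absolutely_continuous M \<nu>"
    unfolding \<nu>_def by (rule absolutely_continuousI_density) measurable
  moreover have "sets \<nu> = sets M" by (simp add: \<nu>_def)
  ultimately show ?thesis by blast
qed

end

section \<open>Moments of Poisson integrals\<close>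

text \<open>The weights satisfy (j + 1) p(j + 1) = r p(j). Shifting the index therefore reduces each
  moment to lower ones; the vanishing term at \<open>j = 0\<close> makes the shift harmless.\<close>

lemma poisson_series:
  fixes r :: real
  defines "p \<equiv> \<lambda>j. exp (- r) * r ^ j / fact j"
  shows "p sums 1" "(\<lambda>j. real j * p j) sums r" "(\<lambda>j. (real j)\<^sup>2 * p j) sums (r\<^sup>2 + r)"
proof -
  have "(\<lambda>j. exp (- r) * (r ^ j /\<^sub>R fact j)) sums (exp (- r) * exp r)"
    by (intro sums_mult exp_converges)
  then show 0: "p sums 1"
    by (simp add: p_def exp_minus_inverse field_simps exp_minus)
  have p_Suc: "real (Suc j) * p (Suc j) = r * p j" for j
    unfolding p_def fact_Suc by (simp add: field_simps del: of_nat_Suc)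
  have "(\<lambda>j. real (Suc j) * p (Suc j)) sums (r * 1)"
    unfolding p_Suc by (intro sums_mult 0)
  then show 1: "(\<lambda>j. real j * p j) sums r"
    by (subst (asm) sums_Suc_iff) simp
  have "(real (Suc j))\<^sup>2 * p (Suc j) = r * (real j * p j + p j)" for j
  proof -
    have "(real (Suc j))\<^sup>2 * p (Suc j) = real (Suc j) * (real (Suc j) * p (Suc j))"
      by (simp add: power2_eq_square)
    then show ?thesis unfolding p_Suc by (simp add: algebra_simps)
  qed
  moreover have "(\<lambda>j. r * (real j * p j + p j)) sums (r * (r + 1))"
    by (intro sums_mult sums_add 0 1)
  ultimately have "(\<lambda>j. (real (Suc j))\<^sup>2 * p (Suc j)) sums (r * (r + 1))" by simp
  then show "(\<lambda>j. (real j)\<^sup>2 * p j) sums (r\<^sup>2 + r)"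
    by (subst (asm) sums_Suc_iff) (simp add: power2_eq_square algebra_simps)
qed

text \<open>The law prescribes counts on sets of finite measure only; sigma-finiteness is what
  extends moment formulas to all measurable functions.\<close>

locale poisson_process = M: sigma_finite_measure M + prob_space P
  for M :: "'a measure" and P :: "'a measure measure" +
  assumes law: "poisson_law M P"
begin

section \<open>Measurability on the configuration space\<close>

lemma space_P: "space P = point_configurations M"
proof -
  have "space P = space (configuration_algebra M)"
    using law by (intro sets_eq_imp_space_eq) (simp add: poisson_law_def)
  then show ?thesis
    unfolding configuration_algebra_def by (subst (asm) space_measure_of) auto
qed

lemma sets_configuration: "\<omega> \<in> space P \<Longrightarrow> sets \<omega> = sets M"
  by (simp add: space_P point_configurations_def)

lemma space_configuration: "\<omega> \<in> space P \<Longrightarrow> space \<omega> = space M"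
  using sets_configuration sets_eq_imp_space_eq by blast

lemma measurable_configuration: "\<omega> \<in> space P \<Longrightarrow> u \<in> M \<rightarrow>\<^sub>M N \<Longrightarrow> u \<in> \<omega> \<rightarrow>\<^sub>M N"
  using measurable_cong_sets[OF sets_configuration refl] by blast

lemma count_measurable [measurable]:
  assumes A: "A \<in> sets M"
  shows "(\<lambda>\<omega>. emeasure \<omega> A) \<in> borel_measurable P"
proof (rule measurableI)
  fix B :: "ennreal set" assume B: "B \<in> sets borel"
  have "{\<omega> \<in> point_configurations M. emeasure \<omega> A \<in> B} \<in> sets (configuration_algebra M)"
    unfolding configuration_algebra_def
    by (subst sets_measure_of) (use A B in auto)
  moreover have "(\<lambda>\<omega>. emeasure \<omega> A) -` B \<inter> space P = {\<omega> \<in> point_configurations M. emeasure \<omega> A \<in> B}"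
    by (auto simp: space_P)
  ultimately show "(\<lambda>\<omega>. emeasure \<omega> A) -` B \<inter> space P \<in> sets P"
    using law by (simp add: poisson_law_def)
qed simp

lemma nn_integral_configuration_measurable [measurable]:
  assumes "u \<in> borel_measurable M"
  shows "(\<lambda>\<omega>. \<integral>\<^sup>+x. u x \<partial>\<omega>) \<in> borel_measurable P"
  using assms
proof (induction rule: borel_measurable_induct)
  case (cong f g)
  have "(\<integral>\<^sup>+x. f x \<partial>\<omega>) = (\<integral>\<^sup>+x. g x \<partial>\<omega>)" if "\<omega> \<in> space P" for \<omega>
    using cong(3) by (intro nn_integral_cong) (simp add: space_configuration[OF that])
  with cong(4) show ?case by (simp cong: measurable_cong)
next
  case (set A)
  have "(\<integral>\<^sup>+x. indicator A x \<partial>\<omega>) = emeasure \<omega> A" if "\<omega> \<in> space P" for \<omega>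
    using set by (intro nn_integral_indicator) (simp add: sets_configuration[OF that])
  then show ?case using count_measurable[OF set] by (simp cong: measurable_cong)
next
  case (mult u c)
  have "(\<integral>\<^sup>+x. c * u x \<partial>\<omega>) = c * (\<integral>\<^sup>+x. u x \<partial>\<omega>)" if "\<omega> \<in> space P" for \<omega>
    by (intro nn_integral_cmult measurable_configuration[OF that] mult)
  with mult(4) show ?case by (simp cong: measurable_cong)
next
  case (add u v)
  have "(\<integral>\<^sup>+x. v x + u x \<partial>\<omega>) = (\<integral>\<^sup>+x. v x \<partial>\<omega>) + (\<integral>\<^sup>+x. u x \<partial>\<omega>)" if "\<omega> \<in> space P" for \<omega>
    by (intro nn_integral_add measurable_configuration[OF that] add)
  with add show ?case by (simp cong: measurable_cong)
next
  case (seq U)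
  have "(\<integral>\<^sup>+x. (SUP i. U i) x \<partial>\<omega>) = (SUP i. \<integral>\<^sup>+x. U i x \<partial>\<omega>)" if "\<omega> \<in> space P" for \<omega>
    unfolding SUP_apply
    by (intro nn_integral_monotone_convergence_SUP measurable_configuration[OF that] seq)
  with seq show ?case by (simp cong: measurable_cong)
qed

text \<open>The Campbell and Mecke type formulas below are instances that differ only in the weights \<open>G\<close> and \<open>g\<close>.\<close>
lemma campbell_extend:
  assumes G [measurable]: "G \<in> borel_measurable P" and g [measurable]: "g \<in> borel_measurable M"
    and fin: "\<And>A. A \<in> sets M \<Longrightarrow> emeasure M A < \<infinity> \<Longrightarrow>
      (\<integral>\<^sup>+\<omega>. emeasure \<omega> A * G \<omega> \<partial>P) = (\<integral>\<^sup>+x. indicator A x * g x \<partial>M)"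
    and u: "u \<in> borel_measurable M"
  shows "(\<integral>\<^sup>+\<omega>. (\<integral>\<^sup>+x. u x \<partial>\<omega>) * G \<omega> \<partial>P) = (\<integral>\<^sup>+x. u x * g x \<partial>M)"
  using u
proof (induction rule: borel_measurable_induct)
  case (cong f h)
  have "(\<integral>\<^sup>+\<omega>. (\<integral>\<^sup>+x. f x \<partial>\<omega>) * G \<omega> \<partial>P) = (\<integral>\<^sup>+\<omega>. (\<integral>\<^sup>+x. h x \<partial>\<omega>) * G \<omega> \<partial>P)"
    using cong(3) by (intro nn_integral_cong arg_cong2[where f = "(*)"] refl) (simp add: space_configuration)
  also have "\<dots> = (\<integral>\<^sup>+x. f x * g x \<partial>M)"
    unfolding cong(4) using cong(3) by (intro nn_integral_cong) simp
  finally show ?case .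
next
  case (set A)
  \<comment> \<open>The hypothesis \<open>fin\<close> covers finite measure only, so
    \<open>A\<close> is exhausted by the sets \<open>A \<inter> B i\<close> and monotone convergence
    is applied under both integrals.\<close>
  obtain B :: "nat \<Rightarrow> 'a set" where B: "range B \<subseteq> sets M" "(\<Union>i. B i) = space M"
      "\<And>i. emeasure M (B i) \<noteq> \<infinity>" "incseq B"
    using M.sigma_finite_incseq by metis
  have [measurable]: "B i \<in> sets M" for i using B by auto
  note [measurable] = set
  have fin_i: "emeasure M (A \<inter> B i) < \<infinity>" for i
  proof -
    have "emeasure M (A \<inter> B i) \<le> emeasure M (B i)" by (intro emeasure_mono) auto
    then show ?thesis using B(3)[of i] by (simp add: less_top[symmetric] top_unique) (metis top_unique)
  qed
  have inc: "incseq (\<lambda>i. A \<inter> B i)" using B(4) by (auto simp: incseq_def)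
  have un: "(\<Union>i. A \<inter> B i) = A" using B(2) sets.sets_into_space[OF set] by blast
  have "(\<integral>\<^sup>+\<omega>. (\<integral>\<^sup>+x. indicator A x \<partial>\<omega>) * G \<omega> \<partial>P) = (\<integral>\<^sup>+\<omega>. (SUP i. emeasure \<omega> (A \<inter> B i) * G \<omega>) \<partial>P)"
  proof (rule nn_integral_cong)
    fix \<omega> assume \<omega>: "\<omega> \<in> space P"
    have "(\<integral>\<^sup>+x. indicator A x \<partial>\<omega>) = emeasure \<omega> A"
      using set by (intro nn_integral_indicator) (simp add: sets_configuration[OF \<omega>])
    also have "\<dots> = (SUP i. emeasure \<omega> (A \<inter> B i))"
      using SUP_emeasure_incseq[of "\<lambda>i. A \<inter> B i" \<omega>] inc un
      by (auto simp: sets_configuration[OF \<omega>] image_subset_iff)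
    finally show "(\<integral>\<^sup>+x. indicator A x \<partial>\<omega>) * G \<omega> = (SUP i. emeasure \<omega> (A \<inter> B i) * G \<omega>)"
      by (simp add: SUP_mult_right_ennreal)
  qed
  also have "\<dots> = (SUP i. \<integral>\<^sup>+\<omega>. emeasure \<omega> (A \<inter> B i) * G \<omega> \<partial>P)"
  proof (rule nn_integral_monotone_convergence_SUP_AE)
    show "AE \<omega> in P. emeasure \<omega> (A \<inter> B i) * G \<omega> \<le> emeasure \<omega> (A \<inter> B (Suc i)) * G \<omega>" for i
      using incseq_SucD[OF inc, of i]
      by (intro AE_I2 mult_right_mono emeasure_mono) (auto simp: sets_configuration)
  qed measurable
  also have "\<dots> = (SUP i. \<integral>\<^sup>+x. indicator (A \<inter> B i) x * g x \<partial>M)"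
    by (intro SUP_cong refl fin fin_i) measurable
  also have "\<dots> = (\<integral>\<^sup>+x. (SUP i. indicator (A \<inter> B i) x * g x) \<partial>M)"
  proof (rule nn_integral_monotone_convergence_SUP[symmetric])
    show "incseq (\<lambda>i x. indicator (A \<inter> B i) x * g x)"
      using inc by (auto simp: incseq_def le_fun_def indicator_def)
  qed measurable
  also have "\<dots> = (\<integral>\<^sup>+x. indicator A x * g x \<partial>M)"
  proof (rule nn_integral_cong)
    fix x
    show "(SUP i. indicator (A \<inter> B i) x * g x) = indicator A x * g x"
    proof (cases "x \<in> A")
      case True
      then obtain i where "x \<in> A \<inter> B i" using un by blast
      then show ?thesis
        by (intro antisym SUP_least SUP_upper2[of i]) (auto simp: indicator_def)
    qed simp
  qed
  finally show ?case .
next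
  case (mult u c)
  note [measurable] = mult(2)
  have "(\<integral>\<^sup>+\<omega>. (\<integral>\<^sup>+x. c * u x \<partial>\<omega>) * G \<omega> \<partial>P) = (\<integral>\<^sup>+\<omega>. c * ((\<integral>\<^sup>+x. u x \<partial>\<omega>) * G \<omega>) \<partial>P)"
    by (intro nn_integral_cong) (simp add: nn_integral_cmult measurable_configuration mult(2) mult.assoc)
  also have "\<dots> = c * (\<integral>\<^sup>+\<omega>. (\<integral>\<^sup>+x. u x \<partial>\<omega>) * G \<omega> \<partial>P)"
    by (intro nn_integral_cmult) measurable
  also have "\<dots> = (\<integral>\<^sup>+x. c * (u x * g x) \<partial>M)"
    unfolding mult(4) by (intro nn_integral_cmult[symmetric]) measurable
  finally show ?case by (simp add: mult.assoc)
next
  case (add u v)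
  note [measurable] = \<open>u \<in> borel_measurable M\<close> \<open>v \<in> borel_measurable M\<close>
  have "(\<integral>\<^sup>+\<omega>. (\<integral>\<^sup>+x. v x + u x \<partial>\<omega>) * G \<omega> \<partial>P)
      = (\<integral>\<^sup>+\<omega>. (\<integral>\<^sup>+x. v x \<partial>\<omega>) * G \<omega> + (\<integral>\<^sup>+x. u x \<partial>\<omega>) * G \<omega> \<partial>P)"
  proof (rule nn_integral_cong)
    fix \<omega> assume \<omega>: "\<omega> \<in> space P"
    have "(\<integral>\<^sup>+x. v x + u x \<partial>\<omega>) = (\<integral>\<^sup>+x. v x \<partial>\<omega>) + (\<integral>\<^sup>+x. u x \<partial>\<omega>)"
      by (intro nn_integral_add measurable_configuration[OF \<omega>] \<open>u \<in> borel_measurable M\<close> \<open>v \<in> borel_measurable M\<close>)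
    then show "(\<integral>\<^sup>+x. v x + u x \<partial>\<omega>) * G \<omega> = (\<integral>\<^sup>+x. v x \<partial>\<omega>) * G \<omega> + (\<integral>\<^sup>+x. u x \<partial>\<omega>) * G \<omega>"
      by (simp add: distrib_right)
  qed
  also have "\<dots> = (\<integral>\<^sup>+\<omega>. (\<integral>\<^sup>+x. v x \<partial>\<omega>) * G \<omega> \<partial>P) + (\<integral>\<^sup>+\<omega>. (\<integral>\<^sup>+x. u x \<partial>\<omega>) * G \<omega> \<partial>P)"
    by (intro nn_integral_add) measurable
  also have "\<dots> = (\<integral>\<^sup>+x. v x * g x + u x * g x \<partial>M)"
    unfolding add.IH by (intro nn_integral_add[symmetric]) measurable
  finally show ?case by (simp add: distrib_right)
next
  case (seq U)
  note [measurable] = seq.hyps(1)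
  have mono: "U i x \<le> U (Suc i) x" for i x using \<open>incseq U\<close> by (auto simp: incseq_Suc_iff le_fun_def)
  have "(\<integral>\<^sup>+\<omega>. (\<integral>\<^sup>+x. (SUP i. U i) x \<partial>\<omega>) * G \<omega> \<partial>P) = (\<integral>\<^sup>+\<omega>. (SUP i. (\<integral>\<^sup>+x. U i x \<partial>\<omega>) * G \<omega>) \<partial>P)"
  proof (rule nn_integral_cong)
    fix \<omega> assume \<omega>: "\<omega> \<in> space P"
    have "(\<integral>\<^sup>+x. (SUP i. U i) x \<partial>\<omega>) = (SUP i. \<integral>\<^sup>+x. U i x \<partial>\<omega>)"
      unfolding SUP_apply
      by (intro nn_integral_monotone_convergence_SUP measurable_configuration[OF \<omega>] seq)
    then show "(\<integral>\<^sup>+x. (SUP i. U i) x \<partial>\<omega>) * G \<omega> = (SUP i. (\<integral>\<^sup>+x. U i x \<partial>\<omega>) * G \<omega>)"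
      by (simp add: SUP_mult_right_ennreal)
  qed
  also have "\<dots> = (SUP i. \<integral>\<^sup>+\<omega>. (\<integral>\<^sup>+x. U i x \<partial>\<omega>) * G \<omega> \<partial>P)"
    by (rule nn_integral_monotone_convergence_SUP_AE)
      (auto intro!: mult_right_mono nn_integral_mono mono)
  also have "\<dots> = (SUP i. \<integral>\<^sup>+x. U i x * g x \<partial>M)"
    unfolding seq.IH ..
  also have "\<dots> = (\<integral>\<^sup>+x. (SUP i. U i x * g x) \<partial>M)"
    by (rule nn_integral_monotone_convergence_SUP[symmetric])
      (auto simp: incseq_Suc_iff le_fun_def intro!: mult_right_mono mono)
  also have "\<dots> = (\<integral>\<^sup>+x. (SUP i. U i) x * g x \<partial>M)"
    by (simp add: SUP_mult_right_ennreal image_image)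
  finally show ?case .
qed

section \<open>Moments of counts on sets of finite measure\<close>

lemma poisson_lawD:
  fixes k :: nat
  assumes "\<And>i. i < k \<Longrightarrow> A i \<in> sets M" "\<And>i. i < k \<Longrightarrow> emeasure M (A i) < \<infinity>"
    and "disjoint_family_on A {..<k}"
  shows "indep_vars (\<lambda>_. borel) (\<lambda>i \<omega>. emeasure \<omega> (A i)) {..<k}"
    and "i < k \<Longrightarrow> prob {\<omega> \<in> space P. emeasure \<omega> (A i) = of_nat j}
      = exp (- measure M (A i)) * measure M (A i) ^ j / fact j"
proof -
  have "(\<forall>i<k. A i \<in> sets M \<and> emeasure M (A i) < \<infinity>) \<and> disjoint_family_on A {..<k}"
    using assms by simp
  with law[unfolded poisson_law_def, THEN conjunct2, THEN conjunct2, THEN spec[of _ k], THEN spec[of _ A]]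
  have *: "indep_vars (\<lambda>_. borel) (\<lambda>i \<omega>. emeasure \<omega> (A i)) {..<k} \<and>
    (\<forall>i<k. \<forall>j :: nat. prob {\<omega> \<in> space P. emeasure \<omega> (A i) = of_nat j}
      = exp (- measure M (A i)) * measure M (A i) ^ j / fact j)"
    by (rule mp)
  show "indep_vars (\<lambda>_. borel) (\<lambda>i \<omega>. emeasure \<omega> (A i)) {..<k}"
    by (rule conjunct1[OF *])
  show "i < k \<Longrightarrow> prob {\<omega> \<in> space P. emeasure \<omega> (A i) = of_nat j}
      = exp (- measure M (A i)) * measure M (A i) ^ j / fact j"
    using conjunct2[OF *] by simp
qed

lemma prob_count:
  assumes A: "A \<in> sets M" "emeasure M A < \<infinity>"
  shows "prob {\<omega> \<in> space P. emeasure \<omega> A = of_nat j} = exp (- measure M A) * measure M A ^ j / fact j"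
  by (rule poisson_lawD(2)[where A = "\<lambda>_. A" and k = 1 and i = 0])
    (use A in \<open>auto simp: disjoint_family_on_def\<close>)

text \<open>The Poisson weights already sum to 1, so no probability is left for any other value, in
  particular for infinity.\<close>

lemma AE_count_nat:
  assumes A: "A \<in> sets M" "emeasure M A < \<infinity>"
  shows "AE \<omega> in P. \<exists>j. emeasure \<omega> A = of_nat j"
proof -
  note [measurable] = A(1)
  define E where "E j = {\<omega> \<in> space P. emeasure \<omega> A = of_nat j}" for j :: nat
  have E: "E j \<in> events" for j unfolding E_def by measurable
  have "(\<lambda>j. prob (E j)) sums prob (\<Union>j. E j)"
  proof (rule finite_measure_UNION)
    show "disjoint_family E" by (auto simp: disjoint_family_on_def E_def)
  qed (use E in auto)
  moreover have "(\<lambda>j. prob (E j)) sums 1"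
    unfolding E_def prob_count[OF A] by (rule poisson_series(1))
  ultimately have "prob (\<Union>j. E j) = 1" by (rule sums_unique2)
  then have "AE \<omega> in P. \<omega> \<in> (\<Union>j. E j)"
    by (rule AE_prob_1)
  then show ?thesis by eventually_elim (auto simp: E_def)
qed

text \<open>The level sets of the count partition almost all of the space, which turns the
  expectation into a series. Taking \<open>F\<close> to be the identity, the square or the indicator
  of 0 gives the moments and the void probability.\<close>

lemma nn_integral_count:
  assumes A: "A \<in> sets M" "emeasure M A < \<infinity>" and [measurable]: "F \<in> borel_measurable borel"
  shows "(\<integral>\<^sup>+\<omega>. F (emeasure \<omega> A) \<partial>P)
    = (\<Sum>j. F (of_nat j) * ennreal (exp (- measure M A) * measure M A ^ j / fact j))"
proof -
  note [measurable] = A(1)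
  define E where "E j = {\<omega> \<in> space P. emeasure \<omega> A = of_nat j}" for j :: nat
  have E [measurable]: "E j \<in> events" for j unfolding E_def by measurable
  have "(\<integral>\<^sup>+\<omega>. F (emeasure \<omega> A) \<partial>P) = (\<integral>\<^sup>+\<omega>. (\<Sum>j. F (of_nat j) * indicator (E j) \<omega>) \<partial>P)"
  proof (rule nn_integral_cong_AE)
    show "AE \<omega> in P. F (emeasure \<omega> A) = (\<Sum>j. F (of_nat j) * indicator (E j) \<omega>)"
      using AE_count_nat[OF A] AE_space
    proof eventually_elim
      fix \<omega> assume "\<exists>j. emeasure \<omega> A = of_nat j" and \<omega>: "\<omega> \<in> space P"
      then obtain i where i: "emeasure \<omega> A = of_nat i" by blast
      have "(\<Sum>j. F (of_nat j) * indicator (E j) \<omega>) = (\<Sum>j\<in>{i}. F (of_nat j) * indicator (E j) \<omega>)"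
        by (intro suminf_finite) (auto simp: E_def i indicator_def)
      then show "F (emeasure \<omega> A) = (\<Sum>j. F (of_nat j) * indicator (E j) \<omega>)"
        using i \<omega> by (simp add: E_def)
    qed
  qed
  also have "\<dots> = (\<Sum>j. \<integral>\<^sup>+\<omega>. F (of_nat j) * indicator (E j) \<omega> \<partial>P)"
    by (intro nn_integral_suminf) measurable
  also have "\<dots> = (\<Sum>j. F (of_nat j) * emeasure P (E j))"
    by (simp add: nn_integral_cmult_indicator)
  finally show ?thesis
    unfolding emeasure_eq_measure unfolding E_def prob_count[OF A] .
qed

lemma expectation_count:
  assumes A: "A \<in> sets M" "emeasure M A < \<infinity>"
  shows "(\<integral>\<^sup>+\<omega>. emeasure \<omega> A \<partial>P) = emeasure M A"
proof -
  let ?p = "\<lambda>j. exp (- measure M A) * measure M A ^ j / fact j"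
  have *: "(of_nat j :: ennreal) * ennreal (?p j) = ennreal (real j * ?p j)" for j
    by (subst ennreal_mult) (auto simp: ennreal_of_nat_eq_real_of_nat)
  have "(\<integral>\<^sup>+\<omega>. emeasure \<omega> A \<partial>P) = (\<Sum>j. ennreal (real j * ?p j))"
    unfolding *[symmetric] by (rule nn_integral_count[OF A]) measurable
  also have "\<dots> = ennreal (measure M A)"
    by (intro suminf_ennreal_eq poisson_series) auto
  finally show ?thesis
    using A by (simp add: emeasure_eq_ennreal_measure less_top)
qed

lemma second_moment_count:
  assumes A: "A \<in> sets M" "emeasure M A < \<infinity>"
  shows "(\<integral>\<^sup>+\<omega>. emeasure \<omega> A * emeasure \<omega> A \<partial>P) = emeasure M A * emeasure M A + emeasure M A"
proof -
  let ?p = "\<lambda>j. exp (- measure M A) * measure M A ^ j / fact j"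
  have *: "(of_nat j :: ennreal) * of_nat j * ennreal (?p j) = ennreal ((real j)\<^sup>2 * ?p j)" for j
    by (subst ennreal_mult) (auto simp: ennreal_of_nat_eq_real_of_nat ennreal_mult power2_eq_square)
  have "(\<integral>\<^sup>+\<omega>. emeasure \<omega> A * emeasure \<omega> A \<partial>P) = (\<Sum>j. ennreal ((real j)\<^sup>2 * ?p j))"
    unfolding *[symmetric] by (rule nn_integral_count[OF A]) measurable
  also have "\<dots> = ennreal ((measure M A)\<^sup>2 + measure M A)"
    by (intro suminf_ennreal_eq poisson_series) auto
  also have "\<dots> = ennreal (measure M A) * ennreal (measure M A) + ennreal (measure M A)"
    by (simp add: power2_eq_square ennreal_mult ennreal_plus)
  finally show ?thesis
    using A by (simp add: emeasure_eq_ennreal_measure less_top)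
qed

lemma void_probability:
  assumes A: "A \<in> sets M" "emeasure M A < \<infinity>"
  shows "(\<integral>\<^sup>+\<omega>. indicator {0} (emeasure \<omega> A) \<partial>P) = ennreal (exp (- measure M A))"
proof -
  have "(\<integral>\<^sup>+\<omega>. indicator {0} (emeasure \<omega> A) \<partial>P)
      = (\<Sum>j. indicator {0} (of_nat j :: ennreal) * ennreal (exp (- measure M A) * measure M A ^ j / fact j))"
    by (intro nn_integral_count A) measurable
  also have "\<dots> = (\<Sum>j\<in>{0::nat}. indicator {0} (of_nat j :: ennreal) * ennreal (exp (- measure M A) * measure M A ^ j / fact j))"
    by (intro suminf_finite) (auto simp: indicator_def)
  finally show ?thesis by simp
qed

lemma nn_integral_disjoint_counts:
  assumes A: "A \<in> sets M" "emeasure M A < \<infinity>" and B: "B \<in> sets M" "emeasure M B < \<infinity>"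
    and disj: "A \<inter> B = {}"
    and [measurable]: "F \<in> borel_measurable borel" "H \<in> borel_measurable borel"
  shows "(\<integral>\<^sup>+\<omega>. F (emeasure \<omega> A) * H (emeasure \<omega> B) \<partial>P)
    = (\<integral>\<^sup>+\<omega>. F (emeasure \<omega> A) \<partial>P) * (\<integral>\<^sup>+\<omega>. H (emeasure \<omega> B) \<partial>P)"
proof -
  \<comment> \<open>Independence in the law is stated for families indexed by an initial segment of
    the naturals, so the two sets and the two functions are packed into families over
    \<open>{..<2}\<close>.\<close>
  define C where "C i = (if i = 0 then A else B)" for i :: nat
  define K where "K i = (if i = 0 then F else H)" for i :: nat
  have "indep_vars (\<lambda>_. borel) (\<lambda>i \<omega>. emeasure \<omega> (C i)) {..<2}"
    by (rule poisson_lawD(1)) (use A B disj in \<open>auto simp: C_def disjoint_family_on_def\<close>)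
  then have "indep_vars (\<lambda>_. borel) (\<lambda>i \<omega>. K i (emeasure \<omega> (C i))) {..<2}"
    by (rule indep_vars_compose2) (auto simp: K_def)
  then have "(\<integral>\<^sup>+\<omega>. (\<Prod>i<2. K i (emeasure \<omega> (C i))) \<partial>P) = (\<Prod>i<2. \<integral>\<^sup>+\<omega>. K i (emeasure \<omega> (C i)) \<partial>P)"
    by (intro indep_vars_nn_integral) auto
  then show ?thesis
    by (simp add: numeral_2_eq_2 lessThan_Suc C_def K_def mult.commute)
qed


text \<open>Splitting both sets along their intersection leaves products of independent counts plus
  the square of the count of \<open>A \<inter> B\<close>. Only that square deviates from the product
  of the means, and by exactly the variance, which is the measure of
  \<open>A \<inter> B\<close>.\<close>

lemma product_moment_counts:
  assumes A: "A \<in> sets M" "emeasure M A < \<infinity>" and B: "B \<in> sets M" "emeasure M B < \<infinity>"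
  shows "(\<integral>\<^sup>+\<omega>. emeasure \<omega> A * emeasure \<omega> B \<partial>P) = emeasure M A * emeasure M B + emeasure M (A \<inter> B)"
proof -
  note [measurable] = A(1) B(1)
  define C where "C = A \<inter> B"
  have C: "C \<in> sets M" "emeasure M C < \<infinity>"
    and A': "A - B \<in> sets M" "emeasure M (A - B) < \<infinity>"
    and B': "B - A \<in> sets M" "emeasure M (B - A) < \<infinity>"
    using A B unfolding C_def
    by (auto intro: le_less_trans[OF emeasure_mono[of _ A M]] le_less_trans[OF emeasure_mono[of _ B M]])
  note [measurable] = C(1)
  have split: "emeasure N A = emeasure N (A - B) + emeasure N C" "emeasure N B = emeasure N (B - A) + emeasure N C"
    if "sets N = sets M" for N
    using A(1) B(1) unfolding C_def
    by (subst plus_emeasure; auto simp: that intro!: arg_cong[where f = "emeasure N"])+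
  have ind: "(\<integral>\<^sup>+\<omega>. emeasure \<omega> D * emeasure \<omega> E \<partial>P) = emeasure M D * emeasure M E"
    if "D \<in> sets M" "emeasure M D < \<infinity>" "E \<in> sets M" "emeasure M E < \<infinity>" "D \<inter> E = {}" for D E
    using nn_integral_disjoint_counts[OF that, of "\<lambda>x. x" "\<lambda>x. x"] that
    by (simp add: expectation_count)
  have "(\<integral>\<^sup>+\<omega>. emeasure \<omega> A * emeasure \<omega> B \<partial>P)
    = (\<integral>\<^sup>+\<omega>. (emeasure \<omega> (A - B) * emeasure \<omega> (B - A) + emeasure \<omega> (A - B) * emeasure \<omega> C)
        + (emeasure \<omega> C * emeasure \<omega> (B - A) + emeasure \<omega> C * emeasure \<omega> C) \<partial>P)"
  proof (rule nn_integral_cong)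
    fix \<omega> assume "\<omega> \<in> space P"
    then have \<omega>: "sets \<omega> = sets M" by (rule sets_configuration)
    show "emeasure \<omega> A * emeasure \<omega> B
      = (emeasure \<omega> (A - B) * emeasure \<omega> (B - A) + emeasure \<omega> (A - B) * emeasure \<omega> C)
        + (emeasure \<omega> C * emeasure \<omega> (B - A) + emeasure \<omega> C * emeasure \<omega> C)"
      unfolding split[OF \<omega>] by (simp add: algebra_simps)
  qed
  also have "\<dots> = ((\<integral>\<^sup>+\<omega>. emeasure \<omega> (A - B) * emeasure \<omega> (B - A) \<partial>P) + (\<integral>\<^sup>+\<omega>. emeasure \<omega> (A - B) * emeasure \<omega> C \<partial>P))
      + ((\<integral>\<^sup>+\<omega>. emeasure \<omega> C * emeasure \<omega> (B - A) \<partial>P) + (\<integral>\<^sup>+\<omega>. emeasure \<omega> C * emeasure \<omega> C \<partial>P))"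
    using A' B' C by (simp add: nn_integral_add count_measurable)
  also have "(\<integral>\<^sup>+\<omega>. emeasure \<omega> (A - B) * emeasure \<omega> (B - A) \<partial>P) = emeasure M (A - B) * emeasure M (B - A)"
    using A' B' by (intro ind) auto
  also have "(\<integral>\<^sup>+\<omega>. emeasure \<omega> (A - B) * emeasure \<omega> C \<partial>P) = emeasure M (A - B) * emeasure M C"
    using A' C by (intro ind) (auto simp: C_def)
  also have "(\<integral>\<^sup>+\<omega>. emeasure \<omega> C * emeasure \<omega> (B - A) \<partial>P) = emeasure M C * emeasure M (B - A)"
    using B' C by (intro ind) (auto simp: C_def)
  also have "(\<integral>\<^sup>+\<omega>. emeasure \<omega> C * emeasure \<omega> C \<partial>P) = emeasure M C * emeasure M C + emeasure M C"
    by (rule second_moment_count[OF C])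
  finally show ?thesis
    unfolding split[OF refl] C_def[symmetric] by (simp add: algebra_simps)
qed

section \<open>Campbell formulas\<close>

lemma campbell:
  assumes [measurable]: "u \<in> borel_measurable M"
  shows "(\<integral>\<^sup>+\<omega>. (\<integral>\<^sup>+x. u x \<partial>\<omega>) \<partial>P) = (\<integral>\<^sup>+x. u x \<partial>M)"
proof -
  have "(\<integral>\<^sup>+\<omega>. (\<integral>\<^sup>+x. u x \<partial>\<omega>) * 1 \<partial>P) = (\<integral>\<^sup>+x. u x * 1 \<partial>M)"
  proof (rule campbell_extend)
    fix A assume A: "A \<in> sets M" "emeasure M A < \<infinity>"
    show "(\<integral>\<^sup>+\<omega>. emeasure \<omega> A * 1 \<partial>P) = (\<integral>\<^sup>+x. indicator A x * 1 \<partial>M)"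
      unfolding mult_1_right expectation_count[OF A] using A by simp
  qed (rule borel_measurable_const borel_measurable_const assms)+
  then show ?thesis unfolding mult_1_right .
qed

text \<open>\<open>campbell_extend\<close> is used once per factor. First \<open>u\<close> is an
  indicator of \<open>A\<close> and \<open>v\<close> is extended, with the count of \<open>A\<close>
  as weight; then \<open>u\<close> is extended, with the integral of \<open>v\<close> as weight. The
  diagonal term of \<open>product_moment_counts\<close> becomes the integral of
  \<open>u * v\<close>.\<close>

lemma campbell_product:
  assumes [measurable]: "u \<in> borel_measurable M" "v \<in> borel_measurable M"
  shows "(\<integral>\<^sup>+\<omega>. (\<integral>\<^sup>+x. u x \<partial>\<omega>) * (\<integral>\<^sup>+x. v x \<partial>\<omega>) \<partial>P)
    = (\<integral>\<^sup>+x. u x \<partial>M) * (\<integral>\<^sup>+x. v x \<partial>M) + (\<integral>\<^sup>+x. u x * v x \<partial>M)"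
proof -
  have set: "(\<integral>\<^sup>+\<omega>. emeasure \<omega> A * (\<integral>\<^sup>+x. v x \<partial>\<omega>) \<partial>P)
     = (\<integral>\<^sup>+x. indicator A x * ((\<integral>\<^sup>+x. v x \<partial>M) + v x) \<partial>M)"
    if A [measurable]: "A \<in> sets M" and fin: "emeasure M A < \<infinity>" for A
  proof -
    have "(\<integral>\<^sup>+\<omega>. (\<integral>\<^sup>+x. v x \<partial>\<omega>) * emeasure \<omega> A \<partial>P) = (\<integral>\<^sup>+x. v x * (emeasure M A + indicator A x) \<partial>M)"
    proof (rule campbell_extend[OF count_measurable[OF A]])
      show "v \<in> borel_measurable M" by fact
      show "(\<lambda>x. emeasure M A + indicator A x) \<in> borel_measurable M" by measurable
      fix B assume B [measurable]: "B \<in> sets M" and "emeasure M B < \<infinity>"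
      then have "(\<integral>\<^sup>+\<omega>. emeasure \<omega> B * emeasure \<omega> A \<partial>P) = emeasure M A * emeasure M B + emeasure M (B \<inter> A)"
        using A fin by (subst product_moment_counts) (simp_all add: mult.commute)
      also have "\<dots> = (\<integral>\<^sup>+x. emeasure M A * indicator B x + indicator (B \<inter> A) x \<partial>M)"
        by (subst nn_integral_add) (auto simp: nn_integral_cmult_indicator)
      also have "\<dots> = (\<integral>\<^sup>+x. indicator B x * (emeasure M A + indicator A x) \<partial>M)"
        by (intro nn_integral_cong) (auto simp: indicator_def)
      finally show "(\<integral>\<^sup>+\<omega>. emeasure \<omega> B * emeasure \<omega> A \<partial>P)
        = (\<integral>\<^sup>+x. indicator B x * (emeasure M A + indicator A x) \<partial>M)" .
    qed
    also have "\<dots> = (\<integral>\<^sup>+x. v x * emeasure M A + v x * indicator A x \<partial>M)"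
      by (simp add: distrib_left)
    also have "\<dots> = (\<integral>\<^sup>+x. v x \<partial>M) * emeasure M A + (\<integral>\<^sup>+x. v x * indicator A x \<partial>M)"
      by (simp add: nn_integral_add nn_integral_multc)
    also have "\<dots> = (\<integral>\<^sup>+x. (\<integral>\<^sup>+x. v x \<partial>M) * indicator A x + v x * indicator A x \<partial>M)"
      by (subst nn_integral_add) (auto simp: nn_integral_cmult_indicator)
    also have "\<dots> = (\<integral>\<^sup>+x. indicator A x * ((\<integral>\<^sup>+x. v x \<partial>M) + v x) \<partial>M)"
      by (intro nn_integral_cong) (auto simp: indicator_def)
    finally show ?thesis by (simp add: mult.commute)
  qed
  have "(\<integral>\<^sup>+\<omega>. (\<integral>\<^sup>+x. u x \<partial>\<omega>) * (\<integral>\<^sup>+x. v x \<partial>\<omega>) \<partial>P)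
    = (\<integral>\<^sup>+x. u x * ((\<integral>\<^sup>+x. v x \<partial>M) + v x) \<partial>M)"
    by (intro campbell_extend set nn_integral_configuration_measurable borel_measurable_add
        borel_measurable_const assms)
  also have "\<dots> = (\<integral>\<^sup>+x. u x * (\<integral>\<^sup>+x. v x \<partial>M) + u x * v x \<partial>M)"
    by (simp add: distrib_left)
  also have "\<dots> = (\<integral>\<^sup>+x. u x \<partial>M) * (\<integral>\<^sup>+x. v x \<partial>M) + (\<integral>\<^sup>+x. u x * v x \<partial>M)"
    by (simp add: nn_integral_add nn_integral_multc)
  finally show ?thesis .
qed

text \<open>When \<open>D\<close> is empty of points, the counts of \<open>A\<close> and
  \<open>A - D\<close> agree, and the latter is independent of the count of \<open>D\<close>. So the
  intensity is removed from \<open>D\<close> and scaled by the void probability.\<close>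

lemma campbell_void:
  assumes [measurable]: "u \<in> borel_measurable M"
    and D: "D \<in> sets M" "emeasure M D < \<infinity>"
  shows "(\<integral>\<^sup>+\<omega>. (\<integral>\<^sup>+x. u x \<partial>\<omega>) * indicator {0} (emeasure \<omega> D) \<partial>P)
    = (\<integral>\<^sup>+x. u x * (ennreal (exp (- measure M D)) * indicator (space M - D) x) \<partial>M)"
proof (rule campbell_extend)
  note [measurable] = D(1)
  show "(\<lambda>\<omega>. indicator {0} (emeasure \<omega> D) :: ennreal) \<in> borel_measurable P"
    by measurable
  show "(\<lambda>x. ennreal (exp (- measure M D)) * indicator (space M - D) x) \<in> borel_measurable M"
    by measurable
  fix A assume A [measurable]: "A \<in> sets M" and fin: "emeasure M A < \<infinity>"
  have A': "A - D \<in> sets M" "emeasure M (A - D) < \<infinity>"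
    using A D fin by (auto intro: le_less_trans[OF emeasure_mono[of _ A M]])
  have "(\<integral>\<^sup>+\<omega>. emeasure \<omega> A * indicator {0} (emeasure \<omega> D) \<partial>P)
    = (\<integral>\<^sup>+\<omega>. emeasure \<omega> (A - D) * indicator {0} (emeasure \<omega> D) \<partial>P)"
  proof (rule nn_integral_cong)
    fix \<omega> assume "\<omega> \<in> space P"
    then have [simp]: "sets \<omega> = sets M" by (rule sets_configuration)
    show "emeasure \<omega> A * indicator {0} (emeasure \<omega> D) = emeasure \<omega> (A - D) * indicator {0} (emeasure \<omega> D)"
    proof (cases "emeasure \<omega> D = 0")
      case True
      then have "emeasure \<omega> (A - D) = emeasure \<omega> A"
        by (intro emeasure_Diff_null_set) (auto simp: null_sets_def D(1))
      then show ?thesis by simp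
    qed simp
  qed
  also have "\<dots> = (\<integral>\<^sup>+\<omega>. emeasure \<omega> (A - D) \<partial>P) * (\<integral>\<^sup>+\<omega>. indicator {0} (emeasure \<omega> D) \<partial>P)"
    using A' D by (intro nn_integral_disjoint_counts[where F = "\<lambda>x. x"]) auto
  also have "\<dots> = emeasure M (A - D) * ennreal (exp (- measure M D))"
    using A' D by (simp only: expectation_count void_probability)
  also have "\<dots> = (\<integral>\<^sup>+x. ennreal (exp (- measure M D)) * indicator (A - D) x \<partial>M)"
    by (subst nn_integral_cmult_indicator) (auto simp: mult.commute)
  also have "\<dots> = (\<integral>\<^sup>+x. indicator A x * (ennreal (exp (- measure M D)) * indicator (space M - D) x) \<partial>M)"
    by (intro nn_integral_cong) (auto simp: indicator_def)
  finally show "(\<integral>\<^sup>+\<omega>. emeasure \<omega> A * indicator {0} (emeasure \<omega> D) \<partial>P)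
    = (\<integral>\<^sup>+x. indicator A x * (ennreal (exp (- measure M D)) * indicator (space M - D) x) \<partial>M)" .
qed fact

section \<open>Poisson integrals of real functions and their norms\<close>

lemma integral_configuration_measurable [measurable]:
  fixes u :: "'a \<Rightarrow> real"
  assumes [measurable]: "u \<in> borel_measurable M"
  shows "(\<lambda>\<omega>. \<integral>x. u x \<partial>\<omega>) \<in> borel_measurable P"
proof -
  \<comment> \<open>The Bochner integral defaults to 0 on configurations where \<open>u\<close> is
    not integrable, so measurability needs the case distinction as well as the two one-sided
    integrals.\<close>
  have eq: "(\<integral>x. u x \<partial>\<omega>) = (if (\<integral>\<^sup>+x. ennreal (norm (u x)) \<partial>\<omega>) < \<infinity>
      then enn2real (\<integral>\<^sup>+x. ennreal (u x) \<partial>\<omega>) - enn2real (\<integral>\<^sup>+x. ennreal (- u x) \<partial>\<omega>) else 0)"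
    if \<omega>: "\<omega> \<in> space P" for \<omega>
  proof -
    have "u \<in> borel_measurable \<omega>" by (rule measurable_configuration[OF \<omega>]) measurable
    then have "integrable \<omega> u \<longleftrightarrow> (\<integral>\<^sup>+x. ennreal (norm (u x)) \<partial>\<omega>) < \<infinity>"
      by (simp add: integrable_iff_bounded)
    then show ?thesis
      by (simp add: real_lebesgue_integral_def not_integrable_integral_eq)
  qed
  define N where "N v \<omega> = (\<integral>\<^sup>+x. ennreal (v x) \<partial>\<omega>)" for v and \<omega> :: "'a measure"
  have [measurable]: "N v \<in> borel_measurable P" if "v \<in> borel_measurable M" for v
    unfolding N_def by (rule nn_integral_configuration_measurable) (use that in measurable)
  have "(\<lambda>\<omega>. if N (\<lambda>x. norm (u x)) \<omega> < \<infinity> then enn2real (N u \<omega>) - enn2real (N (\<lambda>x. - u x) \<omega>) else 0)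
      \<in> borel_measurable P"
    by measurable
  then show ?thesis
    unfolding N_def by (subst measurable_cong[OF eq]) auto
qed

text \<open>By Campbell's formula the integral of |u| over the configuration has finite mean, hence
  is almost surely finite. Linearity of the Poisson integral in \<open>u\<close> rests on
  this.\<close>

lemma AE_integrable_configuration:
  fixes u :: "'a \<Rightarrow> real"
  assumes u: "integrable M u"
  shows "AE \<omega> in P. integrable \<omega> u"
proof -
  have [measurable]: "u \<in> borel_measurable M" using u by auto
  have "(\<integral>\<^sup>+\<omega>. (\<integral>\<^sup>+x. ennreal (norm (u x)) \<partial>\<omega>) \<partial>P) = (\<integral>\<^sup>+x. ennreal (norm (u x)) \<partial>M)"
    by (rule campbell) measurable
  also have "\<dots> < \<infinity>" using u by (simp add: integrable_iff_bounded)
  finally have "AE \<omega> in P. (\<integral>\<^sup>+x. ennreal (norm (u x)) \<partial>\<omega>) < \<infinity>"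
    by (intro finite_nn_integral_imp_ae_finite nn_integral_configuration_measurable) measurable
  then show ?thesis
    using AE_space
  proof eventually_elim
    fix \<omega> assume "(\<integral>\<^sup>+x. ennreal (norm (u x)) \<partial>\<omega>) < \<infinity>" and \<omega>: "\<omega> \<in> space P"
    moreover have "u \<in> borel_measurable \<omega>" by (rule measurable_configuration[OF \<omega>]) measurable
    ultimately show "integrable \<omega> u" by (simp add: integrable_iff_bounded)
  qed
qed

text \<open>The compensated Poisson integral, in the very form that occurs inside \<open>I1\<close>.
  For integrable \<open>u\<close> it is a version of I_1(u).\<close>

definition centered :: "('a \<Rightarrow> real) \<Rightarrow> 'a measure \<Rightarrow> real" where
  "centered u \<omega> = (\<integral>x. u x \<partial>\<omega>) - (\<integral>x. u x \<partial>M)"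

lemma centered_measurable [measurable]:
  "u \<in> borel_measurable M \<Longrightarrow> centered u \<in> borel_measurable P"
  unfolding centered_def by (intro borel_measurable_diff integral_configuration_measurable) auto

lemma AE_centered_add:
  assumes "integrable M u" "integrable M v"
  shows "AE \<omega> in P. centered (\<lambda>x. u x + v x) \<omega> = centered u \<omega> + centered v \<omega>"
  using AE_integrable_configuration[OF assms(1)] AE_integrable_configuration[OF assms(2)]
  by eventually_elim (simp add: centered_def assms)

lemma AE_centered_diff:
  assumes "integrable M u" "integrable M v"
  shows "AE \<omega> in P. centered (\<lambda>x. u x - v x) \<omega> = centered u \<omega> - centered v \<omega>"
  using AE_integrable_configuration[OF assms(1)] AE_integrable_configuration[OF assms(2)]
  by eventually_elim (simp add: centered_def assms)

text \<open>The factor 2 is the triangle inequality: Campbell's formula gives one L^1 norm for the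
  random integral, and the subtracted mean contributes at most another.\<close>

lemma centered_L1_bound:
  assumes u: "integrable M u"
  shows "(\<integral>\<^sup>+\<omega>. ennreal \<bar>centered u \<omega>\<bar> \<partial>P) \<le> ennreal (2 * (\<integral>x. \<bar>u x\<bar> \<partial>M))"
proof -
  have [measurable]: "u \<in> borel_measurable M" using u by auto
  have int: "(\<integral>\<^sup>+x. ennreal \<bar>u x\<bar> \<partial>M) = ennreal (\<integral>x. \<bar>u x\<bar> \<partial>M)"
    using u by (intro nn_integral_eq_integral) auto
  have "(\<integral>\<^sup>+\<omega>. ennreal \<bar>centered u \<omega>\<bar> \<partial>P)
      \<le> (\<integral>\<^sup>+\<omega>. (\<integral>\<^sup>+x. ennreal \<bar>u x\<bar> \<partial>\<omega>) + ennreal (\<integral>x. \<bar>u x\<bar> \<partial>M) \<partial>P)"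
  proof (rule nn_integral_mono_AE)
    show "AE \<omega> in P. ennreal \<bar>centered u \<omega>\<bar> \<le> (\<integral>\<^sup>+x. ennreal \<bar>u x\<bar> \<partial>\<omega>) + ennreal (\<integral>x. \<bar>u x\<bar> \<partial>M)"
      using AE_integrable_configuration[OF u]
    proof eventually_elim
      fix \<omega> assume \<omega>: "integrable \<omega> u"
      have "\<bar>centered u \<omega>\<bar> \<le> (\<integral>x. \<bar>u x\<bar> \<partial>\<omega>) + (\<integral>x. \<bar>u x\<bar> \<partial>M)"
        unfolding centered_def using integral_abs_bound[of \<omega> u] integral_abs_bound[of M u] by linarith
      from ennreal_leI[OF this]
      have "ennreal \<bar>centered u \<omega>\<bar> \<le> ennreal (\<integral>x. \<bar>u x\<bar> \<partial>\<omega>) + ennreal (\<integral>x. \<bar>u x\<bar> \<partial>M)"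
        by (simp add: integral_nonneg_AE)
      also have "ennreal (\<integral>x. \<bar>u x\<bar> \<partial>\<omega>) = (\<integral>\<^sup>+x. ennreal \<bar>u x\<bar> \<partial>\<omega>)"
        using \<omega> by (intro nn_integral_eq_integral[symmetric]) auto
      finally show "ennreal \<bar>centered u \<omega>\<bar> \<le> (\<integral>\<^sup>+x. ennreal \<bar>u x\<bar> \<partial>\<omega>) + ennreal (\<integral>x. \<bar>u x\<bar> \<partial>M)" .
    qed
  qed
  also have "\<dots> = (\<integral>\<^sup>+\<omega>. (\<integral>\<^sup>+x. ennreal \<bar>u x\<bar> \<partial>\<omega>) \<partial>P) + ennreal (\<integral>x. \<bar>u x\<bar> \<partial>M)"
    by (subst nn_integral_add) (auto simp: emeasure_space_1 intro!: nn_integral_configuration_measurable)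
  also have "(\<integral>\<^sup>+\<omega>. (\<integral>\<^sup>+x. ennreal \<bar>u x\<bar> \<partial>\<omega>) \<partial>P) = ennreal (\<integral>x. \<bar>u x\<bar> \<partial>M)"
    unfolding int[symmetric] by (rule campbell) measurable
  also have "ennreal (\<integral>x. \<bar>u x\<bar> \<partial>M) + ennreal (\<integral>x. \<bar>u x\<bar> \<partial>M) = ennreal (2 * (\<integral>x. \<bar>u x\<bar> \<partial>M))"
    by (subst ennreal_plus[symmetric]) (auto intro!: integral_nonneg_AE)
  finally show ?thesis .
qed

lemma integrable_centered:
  assumes u: "integrable M u"
  shows "integrable P (centered u)"
proof (rule integrableI_bounded)
  show "centered u \<in> borel_measurable P" using u by auto
  show "(\<integral>\<^sup>+\<omega>. ennreal (norm (centered u \<omega>)) \<partial>P) < \<infinity>"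
    using le_less_trans[OF centered_L1_bound[OF u] ennreal_less_top] by simp
qed

lemma expectation_configuration_integral:
  fixes u :: "'a \<Rightarrow> real"
  assumes u: "integrable M u" and nonneg: "\<And>x. u x \<ge> 0"
  shows "integrable P (\<lambda>\<omega>. \<integral>x. u x \<partial>\<omega>)" "(\<integral>\<omega>. (\<integral>x. u x \<partial>\<omega>) \<partial>P) = (\<integral>x. u x \<partial>M)"
proof -
  have [measurable]: "u \<in> borel_measurable M" using u by auto
  have "(\<integral>\<^sup>+\<omega>. ennreal (\<integral>x. u x \<partial>\<omega>) \<partial>P) = (\<integral>\<^sup>+\<omega>. (\<integral>\<^sup>+x. ennreal (u x) \<partial>\<omega>) \<partial>P)"
  proof (rule nn_integral_cong_AE)
    show "AE \<omega> in P. ennreal (\<integral>x. u x \<partial>\<omega>) = (\<integral>\<^sup>+x. ennreal (u x) \<partial>\<omega>)"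
      using AE_integrable_configuration[OF u]
      by eventually_elim (simp add: nn_integral_eq_integral nonneg)
  qed
  also have "\<dots> = (\<integral>\<^sup>+x. ennreal (u x) \<partial>M)"
    by (rule campbell) measurable
  also have "\<dots> = ennreal (\<integral>x. u x \<partial>M)"
    using u nonneg by (intro nn_integral_eq_integral) auto
  finally have "(\<integral>\<^sup>+\<omega>. ennreal (\<integral>x. u x \<partial>\<omega>) \<partial>P) = ennreal (\<integral>x. u x \<partial>M)" .
  then have "integrable P (\<lambda>\<omega>. \<integral>x. u x \<partial>\<omega>) \<and> (\<integral>\<omega>. (\<integral>x. u x \<partial>\<omega>) \<partial>P) = (\<integral>x. u x \<partial>M)"
    by (subst (asm) nn_integral_eq_integrable) (auto intro!: integral_nonneg_AE simp: nonneg)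
  then show "integrable P (\<lambda>\<omega>. \<integral>x. u x \<partial>\<omega>)" "(\<integral>\<omega>. (\<integral>x. u x \<partial>\<omega>) \<partial>P) = (\<integral>x. u x \<partial>M)" by auto
qed

text \<open>\<open>campbell_product\<close> lives in the extended nonnegative reals. Variances need
  subtraction, hence this real form together with integrability.\<close>

lemma product_moment:
  fixes u v :: "'a \<Rightarrow> real"
  assumes u: "integrable M u" "\<And>x. u x \<ge> 0" and v: "integrable M v" "\<And>x. v x \<ge> 0"
    and uv: "integrable M (\<lambda>x. u x * v x)"
  shows "integrable P (\<lambda>\<omega>. (\<integral>x. u x \<partial>\<omega>) * (\<integral>x. v x \<partial>\<omega>))"
    "(\<integral>\<omega>. (\<integral>x. u x \<partial>\<omega>) * (\<integral>x. v x \<partial>\<omega>) \<partial>P)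
      = (\<integral>x. u x \<partial>M) * (\<integral>x. v x \<partial>M) + (\<integral>x. u x * v x \<partial>M)" (is "_ = ?R")
proof -
  have [measurable]: "u \<in> borel_measurable M" "v \<in> borel_measurable M" using u v by auto
  have R: "?R \<ge> 0" "(\<integral>x. u x \<partial>M) \<ge> 0" "(\<integral>x. v x \<partial>M) \<ge> 0" "(\<integral>x. u x * v x \<partial>M) \<ge> 0"
    using u v by (auto intro!: add_nonneg_nonneg mult_nonneg_nonneg integral_nonneg_AE)
  have "(\<integral>\<^sup>+\<omega>. ennreal ((\<integral>x. u x \<partial>\<omega>) * (\<integral>x. v x \<partial>\<omega>)) \<partial>P)
    = (\<integral>\<^sup>+\<omega>. (\<integral>\<^sup>+x. ennreal (u x) \<partial>\<omega>) * (\<integral>\<^sup>+x. ennreal (v x) \<partial>\<omega>) \<partial>P)"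
  proof (rule nn_integral_cong_AE)
    show "AE \<omega> in P. ennreal ((\<integral>x. u x \<partial>\<omega>) * (\<integral>x. v x \<partial>\<omega>))
      = (\<integral>\<^sup>+x. ennreal (u x) \<partial>\<omega>) * (\<integral>\<^sup>+x. ennreal (v x) \<partial>\<omega>)"
      using AE_integrable_configuration[OF u(1)] AE_integrable_configuration[OF v(1)]
    proof eventually_elim
      fix \<omega> assume "integrable \<omega> u" "integrable \<omega> v"
      then have "(\<integral>\<^sup>+x. ennreal (u x) \<partial>\<omega>) = ennreal (\<integral>x. u x \<partial>\<omega>)" "(\<integral>\<^sup>+x. ennreal (v x) \<partial>\<omega>) = ennreal (\<integral>x. v x \<partial>\<omega>)"
        using u v by (auto intro!: nn_integral_eq_integral)
      then show "ennreal ((\<integral>x. u x \<partial>\<omega>) * (\<integral>x. v x \<partial>\<omega>))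
        = (\<integral>\<^sup>+x. ennreal (u x) \<partial>\<omega>) * (\<integral>\<^sup>+x. ennreal (v x) \<partial>\<omega>)"
        using u v by (simp add: ennreal_mult integral_nonneg_AE)
    qed
  qed
  also have "\<dots> = (\<integral>\<^sup>+x. ennreal (u x) \<partial>M) * (\<integral>\<^sup>+x. ennreal (v x) \<partial>M) + (\<integral>\<^sup>+x. ennreal (u x) * ennreal (v x) \<partial>M)"
    by (rule campbell_product) measurable
  also have "(\<integral>\<^sup>+x. ennreal (u x) * ennreal (v x) \<partial>M) = (\<integral>\<^sup>+x. ennreal (u x * v x) \<partial>M)"
    using u v by (simp add: ennreal_mult)
  also have "(\<integral>\<^sup>+x. ennreal (u x * v x) \<partial>M) = ennreal (\<integral>x. u x * v x \<partial>M)"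
    using uv u v by (intro nn_integral_eq_integral) auto
  also have "(\<integral>\<^sup>+x. ennreal (u x) \<partial>M) = ennreal (\<integral>x. u x \<partial>M)"
    using u by (intro nn_integral_eq_integral) auto
  also have "(\<integral>\<^sup>+x. ennreal (v x) \<partial>M) = ennreal (\<integral>x. v x \<partial>M)"
    using v by (intro nn_integral_eq_integral) auto
  also have "ennreal (\<integral>x. u x \<partial>M) * ennreal (\<integral>x. v x \<partial>M) + ennreal (\<integral>x. u x * v x \<partial>M) = ennreal ?R"
    using R by (simp add: ennreal_mult ennreal_plus)
  finally have "(\<integral>\<^sup>+\<omega>. ennreal ((\<integral>x. u x \<partial>\<omega>) * (\<integral>x. v x \<partial>\<omega>)) \<partial>P) = ennreal ?R" .
  then have "integrable P (\<lambda>\<omega>. (\<integral>x. u x \<partial>\<omega>) * (\<integral>x. v x \<partial>\<omega>))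
      \<and> (\<integral>\<omega>. (\<integral>x. u x \<partial>\<omega>) * (\<integral>x. v x \<partial>\<omega>) \<partial>P) = ?R"
    using R(1) by (subst (asm) nn_integral_eq_integrable) (auto intro!: mult_nonneg_nonneg integral_nonneg_AE simp: u v)
  then show "integrable P (\<lambda>\<omega>. (\<integral>x. u x \<partial>\<omega>) * (\<integral>x. v x \<partial>\<omega>))"
    "(\<integral>\<omega>. (\<integral>x. u x \<partial>\<omega>) * (\<integral>x. v x \<partial>\<omega>) \<partial>P) = ?R" by auto
qed


text \<open>The compensated integral is an isometry from L^2 into L^2: its second moment is the
  integral of u^2. Product moments are available for nonnegative functions only, so \<open>u\<close>
  is split into positive and negative parts, whose product is 0 and whose integrals are therefore
  uncorrelated.\<close>

lemma centered_L2_bound: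
  assumes u: "integrable M u" and sq: "square_integrable M u"
  shows "(\<integral>\<^sup>+\<omega>. ennreal \<bar>centered u \<omega>\<bar> \<partial>P) \<le> ennreal (L2_norm M u)"
proof -
  have [measurable]: "u \<in> borel_measurable M" using u by auto
  define p where "p x = max 0 (u x)" for x
  define q where "q x = max 0 (- u x)" for x
  have [measurable]: "p \<in> borel_measurable M" "q \<in> borel_measurable M"
    unfolding p_def q_def by measurable
  have u_eq: "u x = p x - q x" for x unfolding p_def q_def by auto
  have nonneg: "p x \<ge> 0" "q x \<ge> 0" for x unfolding p_def q_def by auto
  have p: "integrable M p" and q: "integrable M q"
    using u unfolding p_def q_def by auto
  have sq_u: "integrable M (\<lambda>x. (u x)\<^sup>2)" using sq by (simp add: square_integrable_def)
  have pp: "integrable M (\<lambda>x. p x * p x)" and qq: "integrable M (\<lambda>x. q x * q x)"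
    by (rule Bochner_Integration.integrable_bound[OF sq_u], measurable,
        auto simp: p_def q_def max_def power2_eq_square)+
  have pq: "p x * q x = 0" for x unfolding p_def q_def by auto
  have sum_sq: "p x * p x + q x * q x = (u x)\<^sup>2" for x
    unfolding u_eq using pq[of x] by (simp add: power2_eq_square algebra_simps)
  define X where "X \<omega> = (\<integral>x. p x \<partial>\<omega>)" for \<omega>
  define Y where "Y \<omega> = (\<integral>x. q x \<partial>\<omega>)" for \<omega>
  define a where "a = (\<integral>x. p x \<partial>M)"
  define b where "b = (\<integral>x. q x \<partial>M)"
  define c where "c = (\<integral>x. (u x)\<^sup>2 \<partial>M)"
  have c_eq: "(\<integral>x. p x * p x \<partial>M) + (\<integral>x. q x * q x \<partial>M) = c"
    unfolding c_def sum_sq[symmetric] using pp qq by simp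
  have X: "integrable P X" "(\<integral>\<omega>. X \<omega> \<partial>P) = a" and Y: "integrable P Y" "(\<integral>\<omega>. Y \<omega> \<partial>P) = b"
    unfolding X_def Y_def a_def b_def
    using expectation_configuration_integral[OF p nonneg(1)] expectation_configuration_integral[OF q nonneg(2)] by auto
  have XX: "integrable P (\<lambda>\<omega>. X \<omega> * X \<omega>)" "(\<integral>\<omega>. X \<omega> * X \<omega> \<partial>P) = a * a + (\<integral>x. p x * p x \<partial>M)"
    unfolding X_def a_def by (rule product_moment[OF p nonneg(1) p nonneg(1) pp])+
  have YY: "integrable P (\<lambda>\<omega>. Y \<omega> * Y \<omega>)" "(\<integral>\<omega>. Y \<omega> * Y \<omega> \<partial>P) = b * b + (\<integral>x. q x * q x \<partial>M)"
    unfolding Y_def b_def by (rule product_moment[OF q nonneg(2) q nonneg(2) qq])+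
  have XY: "integrable P (\<lambda>\<omega>. X \<omega> * Y \<omega>)" "(\<integral>\<omega>. X \<omega> * Y \<omega> \<partial>P) = a * b"
    using product_moment[OF p nonneg(1) q nonneg(2)] unfolding X_def Y_def a_def b_def pq by auto
  have AE_eq: "AE \<omega> in P. centered u \<omega> = (X \<omega> - a) - (Y \<omega> - b)"
  proof -
    have "u = (\<lambda>x. p x - q x)" using u_eq by auto
    then show ?thesis
      using AE_centered_diff[OF p q] unfolding centered_def X_def Y_def a_def b_def by simp
  qed
  \<comment> \<open>\<open>Z\<close> agrees with \<open>centered u\<close> almost surely, and its
    square expands everywhere into the moments computed above.\<close>
  define Z where "Z \<omega> = (X \<omega> - a) - (Y \<omega> - b)" for \<omega>
  have Z_sq: "(Z \<omega>)\<^sup>2 = X \<omega> * X \<omega> + Y \<omega> * Y \<omega> + (b - a)\<^sup>2 - 2 * (X \<omega> * Y \<omega>)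
      + 2 * (b - a) * X \<omega> - 2 * (b - a) * Y \<omega>" for \<omega>
    unfolding Z_def by (simp add: power2_eq_square algebra_simps)
  have Z_meas: "Z \<in> borel_measurable P" unfolding Z_def using X Y by auto
  have int_Z: "integrable P (\<lambda>\<omega>. (Z \<omega>)\<^sup>2)"
    unfolding Z_sq using X Y XX YY XY by auto
  have "(\<integral>\<omega>. (Z \<omega>)\<^sup>2 \<partial>P) = (a * a + (\<integral>x. p x * p x \<partial>M)) + (b * b + (\<integral>x. q x * q x \<partial>M)) + (b - a)\<^sup>2
      - 2 * (a * b) + 2 * (b - a) * a - 2 * (b - a) * b"
    unfolding Z_sq using X Y XX YY XY by (simp add: prob_space)
  also have "\<dots> = c"
    unfolding c_eq[symmetric] by (simp add: power2_eq_square algebra_simps)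
  finally have "L2_norm P Z = L2_norm M u"
    unfolding L2_norm_def c_def by simp
  \<comment> \<open>Under a probability measure the constant 1 has norm 1, so Cauchy-Schwarz against
    it bounds the L^1 norm by the L^2 norm.\<close>
  moreover have one: "square_integrable P (\<lambda>_. 1)" "L2_norm P (\<lambda>_. 1) = 1"
    by (auto simp: square_integrable_def L2_norm_def prob_space)
  moreover have sq_Z: "square_integrable P Z"
    using int_Z Z_meas by (simp add: square_integrable_def)
  ultimately have le: "(\<integral>\<omega>. \<bar>Z \<omega>\<bar> \<partial>P) \<le> L2_norm M u"
    using L2_Cauchy_Schwarz[OF sq_Z one(1)] by simp
  have "integrable P Z" using L2_integrable_mult[OF sq_Z one(1)] by simp
  then have "(\<integral>\<^sup>+\<omega>. ennreal \<bar>Z \<omega>\<bar> \<partial>P) = ennreal (\<integral>\<omega>. \<bar>Z \<omega>\<bar> \<partial>P)"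
    by (intro nn_integral_eq_integral) auto
  moreover have "(\<integral>\<^sup>+\<omega>. ennreal \<bar>centered u \<omega>\<bar> \<partial>P) = (\<integral>\<^sup>+\<omega>. ennreal \<bar>Z \<omega>\<bar> \<partial>P)"
    using AE_eq by (intro nn_integral_cong_AE) (auto simp: Z_def)
  ultimately show ?thesis using ennreal_leI[OF le] by simp
qed

text \<open>Here \<open>g\<close> must also be integrable, so that the Poisson integral and the mean
  of \<open>g\<close> exist separately. \<open>poisson_orlicz_norm_le\<close> removes this
  restriction by truncation.\<close>

lemma centered_bound:
  assumes g: "integrable M g" "square_integrable M g" and h: "integrable M h"
  shows "(\<integral>\<^sup>+\<omega>. ennreal \<bar>centered (\<lambda>x. g x + h x) \<omega>\<bar> \<partial>P)
    \<le> ennreal (L2_norm M g + 2 * (\<integral>x. \<bar>h x\<bar> \<partial>M))"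
proof -
  have [measurable]: "g \<in> borel_measurable M" "h \<in> borel_measurable M" using g h by auto
  have "(\<integral>\<^sup>+\<omega>. ennreal \<bar>centered (\<lambda>x. g x + h x) \<omega>\<bar> \<partial>P)
    \<le> (\<integral>\<^sup>+\<omega>. ennreal \<bar>centered g \<omega>\<bar> + ennreal \<bar>centered h \<omega>\<bar> \<partial>P)"
  proof (rule nn_integral_mono_AE)
    show "AE \<omega> in P. ennreal \<bar>centered (\<lambda>x. g x + h x) \<omega>\<bar> \<le> ennreal \<bar>centered g \<omega>\<bar> + ennreal \<bar>centered h \<omega>\<bar>"
      using AE_centered_add[OF g(1) h]
      by eventually_elim (simp add: ennreal_plus[symmetric] ennreal_leI abs_triangle_ineq del: ennreal_plus)
  qed
  also have "\<dots> = (\<integral>\<^sup>+\<omega>. ennreal \<bar>centered g \<omega>\<bar> \<partial>P) + (\<integral>\<^sup>+\<omega>. ennreal \<bar>centered h \<omega>\<bar> \<partial>P)"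
    by (intro nn_integral_add) measurable
  also have "\<dots> \<le> ennreal (L2_norm M g) + ennreal (2 * (\<integral>x. \<bar>h x\<bar> \<partial>M))"
    by (intro add_mono centered_L2_bound centered_L1_bound g h)
  also have "\<dots> = ennreal (L2_norm M g + 2 * (\<integral>x. \<bar>h x\<bar> \<partial>M))"
    by (intro ennreal_plus[symmetric]) (auto intro!: integral_nonneg_AE)
  finally show ?thesis .
qed

end

section \<open>The Poisson-Orlicz norm\<close>

lemma tendsto_in_measureI_L1:
  assumes [measurable]: "\<And>i. X i \<in> borel_measurable P" "Y \<in> borel_measurable P"
    and lim: "((\<lambda>i. \<integral>\<^sup>+\<omega>. ennreal \<bar>X i \<omega> - Y \<omega>\<bar> \<partial>P) \<longlongrightarrow> 0) F"
  shows "tendsto_in_measure P X Y F"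
  unfolding tendsto_in_measure_def
proof (intro allI impI)
  fix \<delta> :: real assume \<delta>: "\<delta> > 0"
  have le: "emeasure P {\<omega> \<in> space P. \<bar>X i \<omega> - Y \<omega>\<bar> > \<delta>}
      \<le> ennreal (1 / \<delta>) * (\<integral>\<^sup>+\<omega>. ennreal \<bar>X i \<omega> - Y \<omega>\<bar> \<partial>P)" for i
  proof -
    have "emeasure P {\<omega> \<in> space P. \<bar>X i \<omega> - Y \<omega>\<bar> > \<delta>}
        \<le> emeasure P {\<omega> \<in> space P. 1 \<le> ennreal (1 / \<delta>) * ennreal \<bar>X i \<omega> - Y \<omega>\<bar>}"
    proof (rule emeasure_mono)
      show "{\<omega> \<in> space P. \<bar>X i \<omega> - Y \<omega>\<bar> > \<delta>}
          \<subseteq> {\<omega> \<in> space P. 1 \<le> ennreal (1 / \<delta>) * ennreal \<bar>X i \<omega> - Y \<omega>\<bar>}"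
      proof clarify
        fix \<omega> assume "\<bar>X i \<omega> - Y \<omega>\<bar> > \<delta>"
        then have "ennreal 1 \<le> ennreal (1 / \<delta> * \<bar>X i \<omega> - Y \<omega>\<bar>)"
          using \<delta> by (intro ennreal_leI) (simp add: field_simps)
        also have "\<dots> = ennreal (1 / \<delta>) * ennreal \<bar>X i \<omega> - Y \<omega>\<bar>"
          using \<delta> by (intro ennreal_mult) auto
        finally show "1 \<le> ennreal (1 / \<delta>) * ennreal \<bar>X i \<omega> - Y \<omega>\<bar>"
          unfolding ennreal_1 .
      qed
    qed measurable
    also have "\<dots> \<le> ennreal (1 / \<delta>) * (\<integral>\<^sup>+\<omega>. ennreal \<bar>X i \<omega> - Y \<omega>\<bar> * indicator (space P) \<omega> \<partial>P)"
      by (rule nn_integral_Markov_inequality) measurable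
    also have "(\<integral>\<^sup>+\<omega>. ennreal \<bar>X i \<omega> - Y \<omega>\<bar> * indicator (space P) \<omega> \<partial>P) = (\<integral>\<^sup>+\<omega>. ennreal \<bar>X i \<omega> - Y \<omega>\<bar> \<partial>P)"
      by (intro nn_integral_cong) simp
    finally show ?thesis .
  qed
  have "((\<lambda>i. ennreal (1 / \<delta>) * (\<integral>\<^sup>+\<omega>. ennreal \<bar>X i \<omega> - Y \<omega>\<bar> \<partial>P)) \<longlongrightarrow> ennreal (1 / \<delta>) * 0) F"
    by (intro ennreal_tendsto_cmult lim) simp
  then have "((\<lambda>i. ennreal (1 / \<delta>) * (\<integral>\<^sup>+\<omega>. ennreal \<bar>X i \<omega> - Y \<omega>\<bar> \<partial>P)) \<longlongrightarrow> 0) F" by simp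
  then show "((\<lambda>i. emeasure P {\<omega> \<in> space P. \<bar>X i \<omega> - Y \<omega>\<bar> > \<delta>}) \<longlongrightarrow> 0) F"
    by (rule tendsto_sandwich[OF always_eventually always_eventually tendsto_const, rotated -1])
      (use le in auto)
qed

text \<open>If \<open>Y\<close> and \<open>Z\<close> differ by more than
  \<open>2 * \<delta>\<close>, then every \<open>X i\<close> is further than \<open>\<delta>\<close>
  from one of them, and both events have vanishing measure. This is what makes the arbitrary choice
  in \<open>I1\<close> harmless.\<close>

lemma tendsto_in_measure_unique:
  assumes [measurable]: "\<And>i. X i \<in> borel_measurable P" "Y \<in> borel_measurable P" "Z \<in> borel_measurable P"
    and Y: "tendsto_in_measure P X Y F" and Z: "tendsto_in_measure P X Z F" and F: "F \<noteq> bot"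
  shows "AE \<omega> in P. Y \<omega> = Z \<omega>"
proof -
  have zero: "emeasure P {\<omega> \<in> space P. \<bar>Y \<omega> - Z \<omega>\<bar> > 2 * \<delta>} = 0" if \<delta>: "\<delta> > 0" for \<delta>
  proof -
    have le: "emeasure P {\<omega> \<in> space P. \<bar>Y \<omega> - Z \<omega>\<bar> > 2 * \<delta>}
      \<le> emeasure P {\<omega> \<in> space P. \<bar>X i \<omega> - Y \<omega>\<bar> > \<delta>} + emeasure P {\<omega> \<in> space P. \<bar>X i \<omega> - Z \<omega>\<bar> > \<delta>}" for i
    proof -
      have "emeasure P {\<omega> \<in> space P. \<bar>Y \<omega> - Z \<omega>\<bar> > 2 * \<delta>}
        \<le> emeasure P ({\<omega> \<in> space P. \<bar>X i \<omega> - Y \<omega>\<bar> > \<delta>} \<union> {\<omega> \<in> space P. \<bar>X i \<omega> - Z \<omega>\<bar> > \<delta>})"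
        by (intro emeasure_mono) auto
      also have "\<dots> \<le> emeasure P {\<omega> \<in> space P. \<bar>X i \<omega> - Y \<omega>\<bar> > \<delta>} + emeasure P {\<omega> \<in> space P. \<bar>X i \<omega> - Z \<omega>\<bar> > \<delta>}"
        by (intro emeasure_subadditive) measurable
      finally show ?thesis .
    qed
    have "((\<lambda>i. emeasure P {\<omega> \<in> space P. \<bar>X i \<omega> - Y \<omega>\<bar> > \<delta>} + emeasure P {\<omega> \<in> space P. \<bar>X i \<omega> - Z \<omega>\<bar> > \<delta>})
        \<longlongrightarrow> 0 + 0) F"
      using Y Z \<delta> unfolding tendsto_in_measure_def by (intro tendsto_add) auto
    then have "emeasure P {\<omega> \<in> space P. \<bar>Y \<omega> - Z \<omega>\<bar> > 2 * \<delta>} \<le> 0 + 0"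
      by (rule tendsto_lowerbound[OF _ always_eventually F]) (use le in blast)
    then show ?thesis by simp
  qed
  \<comment> \<open>Countably many levels suffice to exclude every positive distance.\<close>
  have "AE \<omega> in P. \<not> \<bar>Y \<omega> - Z \<omega>\<bar> > 2 * (1 / real (Suc n))" for n
    by (rule AE_I[OF _ zero[of "1 / real (Suc n)"]]) auto
  then have "AE \<omega> in P. \<forall>n. \<not> \<bar>Y \<omega> - Z \<omega>\<bar> > 2 * (1 / real (Suc n))"
    by (simp add: AE_all_countable)
  then show ?thesis
  proof eventually_elim
    fix \<omega> assume *: "\<forall>n. \<not> \<bar>Y \<omega> - Z \<omega>\<bar> > 2 * (1 / real (Suc n))"
    show "Y \<omega> = Z \<omega>"
    proof (rule ccontr)
      assume "Y \<omega> \<noteq> Z \<omega>"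
      then have "0 < \<bar>Y \<omega> - Z \<omega>\<bar> / 2" by simp
      then obtain n where "inverse (real (Suc n)) < \<bar>Y \<omega> - Z \<omega>\<bar> / 2"
        using reals_Archimedean by blast
      with *[rule_format, of n] show False by (simp add: inverse_eq_divide)
    qed
  qed
qed

lemma truncate_below_measurable [measurable]:
  assumes [measurable]: "f \<in> borel_measurable M"
  shows "truncate_below \<epsilon> f \<in> borel_measurable M"
proof -
  have "truncate_below \<epsilon> f = (\<lambda>x. if \<bar>f x\<bar> > \<epsilon> then f x else 0)"
    by (auto simp: truncate_below_def)
  then show ?thesis by simp
qed

text \<open>Dominated convergence: with the zeros of \<open>f\<close> excluded, each point leaves
  the set once \<open>\<epsilon>\<close> is below the size of \<open>f\<close> there. It provides
  the error terms when truncation levels are lowered.\<close>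

lemma integral_small_values_tendsto_0:
  fixes w f :: "'a \<Rightarrow> real"
  assumes w: "integrable M w" and [measurable]: "f \<in> borel_measurable M"
  shows "((\<lambda>\<epsilon>. \<integral>x. w x * indicator {y. f y \<noteq> 0 \<and> \<bar>f y\<bar> \<le> \<epsilon>} x \<partial>M) \<longlongrightarrow> 0) (at_right 0)"
proof (rule tendsto_at_right_sequentially[of 0 1])
  fix S :: "nat \<Rightarrow> real" assume S: "\<And>n. 0 < S n" "S \<longlonglongrightarrow> 0"
  have [measurable]: "w \<in> borel_measurable M" using w by auto
  have eq: "w x * indicator {y. f y \<noteq> 0 \<and> \<bar>f y\<bar> \<le> \<epsilon>} x = (if f x \<noteq> 0 \<and> \<bar>f x\<bar> \<le> \<epsilon> then w x else 0)" for x \<epsilon>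
    by simp
  have "(\<lambda>n. \<integral>x. (if f x \<noteq> 0 \<and> \<bar>f x\<bar> \<le> S n then w x else 0) \<partial>M) \<longlonglongrightarrow> (\<integral>x. 0 \<partial>M)"
  proof (rule integral_dominated_convergence)
    show "integrable M (\<lambda>x. \<bar>w x\<bar>)" using w by auto
    show "AE x in M. (\<lambda>n. if f x \<noteq> 0 \<and> \<bar>f x\<bar> \<le> S n then w x else 0) \<longlonglongrightarrow> 0"
    proof (rule AE_I2)
      fix x
      show "(\<lambda>n. if f x \<noteq> 0 \<and> \<bar>f x\<bar> \<le> S n then w x else 0) \<longlonglongrightarrow> 0"
      proof (cases "f x = 0")
        case False
        then have "eventually (\<lambda>n. S n < \<bar>f x\<bar>) sequentially"
          using order_tendstoD(2)[OF S(2)] by simp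
        then have "eventually (\<lambda>n. (if f x \<noteq> 0 \<and> \<bar>f x\<bar> \<le> S n then w x else 0) = 0) sequentially"
          by eventually_elim simp
        then show ?thesis by (rule tendsto_eventually)
      qed simp
    qed
  qed auto
  then show "(\<lambda>n. \<integral>x. w x * indicator {y. f y \<noteq> 0 \<and> \<bar>f y\<bar> \<le> S n} x \<partial>M) \<longlonglongrightarrow> 0"
    unfolding eq by simp
qed simp

context poisson_process
begin

text \<open>An L^1 limit is a legitimate candidate for the choice in \<open>I1\<close>; so the
  choice satisfies its specification, and by uniqueness it agrees with \<open>Y\<close> almost
  surely.\<close>

lemma poisson_orlicz_norm_eqI:
  assumes [measurable]: "f \<in> borel_measurable M" "Y \<in> borel_measurable P"
    and lim: "((\<lambda>\<epsilon>. \<integral>\<^sup>+\<omega>. ennreal \<bar>centered (truncate_below \<epsilon> f) \<omega> - Y \<omega>\<bar> \<partial>P) \<longlongrightarrow> 0) (at_right 0)"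
  shows "poisson_orlicz_norm M P f = (\<integral>\<^sup>+\<omega>. ennreal \<bar>Y \<omega>\<bar> \<partial>P)"
proof -
  let ?L = "\<lambda>Z. Z \<in> borel_measurable P \<and> tendsto_in_measure P (\<lambda>\<epsilon>. centered (truncate_below \<epsilon> f)) Z (at_right 0)"
  have Y: "?L Y"
    using tendsto_in_measureI_L1[OF _ _ lim] by simp
  have "I1 M P f = (SOME Z. ?L Z)"
    unfolding I1_def centered_def ..
  with someI[of ?L Y, OF Y] have "?L (I1 M P f)" by simp
  with Y have "AE \<omega> in P. I1 M P f \<omega> = Y \<omega>"
    by (intro tendsto_in_measure_unique[of "\<lambda>\<epsilon>. centered (truncate_below \<epsilon> f)" P _ _ "at_right (0 :: real)"]) auto
  then show ?thesis
    unfolding poisson_orlicz_norm_def by (intro nn_integral_cong_AE) auto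
qed

text \<open>The uniform modulus \<open>c\<close> makes the compensated truncations Cauchy in L^1
  along the levels 1 / (k + 1), and the same modulus then controls every level, so the limit holds
  along the whole filter. The bound \<open>K\<close> survives the passage to the limit.\<close>

lemma poisson_orlicz_norm_le_limit:
  fixes c :: "real \<Rightarrow> real"
  assumes f: "f \<in> borel_measurable M"
    and int: "\<And>\<epsilon>. \<epsilon> > 0 \<Longrightarrow> integrable M (truncate_below \<epsilon> f)"
    and bound: "\<And>\<epsilon>. \<epsilon> > 0 \<Longrightarrow> (\<integral>\<omega>. \<bar>centered (truncate_below \<epsilon> f) \<omega>\<bar> \<partial>P) \<le> K"
    and c: "(c \<longlongrightarrow> 0) (at_right 0)"
    and close: "\<And>\<delta> \<epsilon>. 0 < \<delta> \<Longrightarrow> \<delta> \<le> \<epsilon> \<Longrightarrow>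
      (\<integral>\<omega>. \<bar>centered (truncate_below \<delta> f) \<omega> - centered (truncate_below \<epsilon> f) \<omega>\<bar> \<partial>P) \<le> c \<epsilon>"
  shows "poisson_orlicz_norm M P f \<le> ennreal K"
proof -
  define X where "X \<epsilon> = centered (truncate_below \<epsilon> f)" for \<epsilon>
  define s where "s k = X (1 / real (Suc k))" for k
  have X: "integrable P (X \<epsilon>)" if "\<epsilon> > 0" for \<epsilon>
    unfolding X_def by (rule integrable_centered[OF int[OF that]])
  have s: "integrable P (s k)" for k unfolding s_def by (rule X) simp
  have "\<exists>N. \<forall>i\<ge>N. \<forall>j\<ge>N. (\<integral>\<omega>. \<bar>s i \<omega> - s j \<omega>\<bar> \<partial>P) < e" if e: "e > 0" for e
  proof -
    have "eventually (\<lambda>\<epsilon>. c \<epsilon> < e) (at_right 0)" using order_tendstoD(2)[OF c e] .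
    then obtain b where b: "b > 0" "\<And>\<epsilon>. 0 < \<epsilon> \<Longrightarrow> \<epsilon> < b \<Longrightarrow> c \<epsilon> < e"
      by (auto simp: eventually_at_right_field)
    obtain N where N: "1 / real (Suc N) < b"
      using reals_Archimedean[OF b(1)] by (auto simp: inverse_eq_divide)
    \<comment> \<open>\<open>close\<close> only compares a level with a larger one, and larger
      indices mean smaller levels; the other order follows by symmetry of the distance.\<close>
    have *: "(\<integral>\<omega>. \<bar>s i \<omega> - s j \<omega>\<bar> \<partial>P) < e" if "j \<ge> N" "i \<ge> j" for i j
    proof -
      have "1 / real (Suc i) \<le> 1 / real (Suc j)" "1 / real (Suc j) \<le> 1 / real (Suc N)"
        using that by (auto intro!: divide_left_mono)
      then have "(\<integral>\<omega>. \<bar>s i \<omega> - s j \<omega>\<bar> \<partial>P) \<le> c (1 / real (Suc j))" "c (1 / real (Suc j)) < e"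
        unfolding s_def X_def using N by (auto intro!: close b(2))
      then show ?thesis by simp
    qed
    have "(\<integral>\<omega>. \<bar>s i \<omega> - s j \<omega>\<bar> \<partial>P) < e" if "i \<ge> N" "j \<ge> N" for i j
      using *[of j i] *[of i j] that by (cases "i \<ge> j") (auto simp: abs_minus_commute)
    then show ?thesis by blast
  qed
  with L1_complete[of P s] s obtain Y
    where Y: "integrable P Y" "(\<lambda>k. \<integral>\<omega>. \<bar>s k \<omega> - Y \<omega>\<bar> \<partial>P) \<longlonglongrightarrow> 0" by blast
  have triangle: "(\<integral>\<omega>. \<bar>U \<omega> - W \<omega>\<bar> \<partial>P) \<le> (\<integral>\<omega>. \<bar>U \<omega> - V \<omega>\<bar> \<partial>P) + (\<integral>\<omega>. \<bar>V \<omega> - W \<omega>\<bar> \<partial>P)"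
    if "integrable P U" "integrable P V" "integrable P W" for U V W :: "'a measure \<Rightarrow> real"
  proof -
    have "(\<integral>\<omega>. \<bar>U \<omega> - W \<omega>\<bar> \<partial>P) \<le> (\<integral>\<omega>. \<bar>U \<omega> - V \<omega>\<bar> + \<bar>V \<omega> - W \<omega>\<bar> \<partial>P)"
      using that by (intro integral_mono) auto
    then show ?thesis using that by simp
  qed
  \<comment> \<open>Pass through \<open>s k\<close> at a level below \<open>\<epsilon>\<close>, then
    let \<open>k\<close> grow.\<close>
  have XY: "(\<integral>\<omega>. \<bar>X \<epsilon> \<omega> - Y \<omega>\<bar> \<partial>P) \<le> c \<epsilon>" if \<epsilon>: "\<epsilon> > 0" for \<epsilon>
  proof -
    obtain N where N: "1 / real (Suc N) < \<epsilon>"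
      using reals_Archimedean[OF \<epsilon>] by (auto simp: inverse_eq_divide)
    have "(\<integral>\<omega>. \<bar>X \<epsilon> \<omega> - Y \<omega>\<bar> \<partial>P) \<le> c \<epsilon> + (\<integral>\<omega>. \<bar>s k \<omega> - Y \<omega>\<bar> \<partial>P)" if k: "k \<ge> N" for k
    proof -
      have "1 / real (Suc k) \<le> 1 / real (Suc N)" using k by (auto intro!: divide_left_mono)
      then have "(\<integral>\<omega>. \<bar>s k \<omega> - X \<epsilon> \<omega>\<bar> \<partial>P) \<le> c \<epsilon>"
        unfolding s_def X_def using N by (intro close) auto
      then have "(\<integral>\<omega>. \<bar>X \<epsilon> \<omega> - s k \<omega>\<bar> \<partial>P) \<le> c \<epsilon>" by (simp add: abs_minus_commute)
      with triangle[OF X[OF \<epsilon>] s Y(1), of k] show ?thesis by linarith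
    qed
    moreover have "(\<lambda>k. c \<epsilon> + (\<integral>\<omega>. \<bar>s k \<omega> - Y \<omega>\<bar> \<partial>P)) \<longlonglongrightarrow> c \<epsilon> + 0"
      by (intro tendsto_add tendsto_const Y)
    ultimately show ?thesis
      by (intro LIMSEQ_le_const[of _ "c \<epsilon>"]) auto
  qed
  have "((\<lambda>\<epsilon>. \<integral>\<omega>. \<bar>X \<epsilon> \<omega> - Y \<omega>\<bar> \<partial>P) \<longlongrightarrow> 0) (at_right 0)"
  proof (rule tendsto_sandwich[OF _ _ tendsto_const c])
    show "eventually (\<lambda>\<epsilon>. 0 \<le> (\<integral>\<omega>. \<bar>X \<epsilon> \<omega> - Y \<omega>\<bar> \<partial>P)) (at_right 0)"
      by (auto intro!: always_eventually integral_nonneg_AE)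
    show "eventually (\<lambda>\<epsilon>. (\<integral>\<omega>. \<bar>X \<epsilon> \<omega> - Y \<omega>\<bar> \<partial>P) \<le> c \<epsilon>) (at_right 0)"
      using XY by (auto simp: eventually_at_right_field intro!: exI[of _ 1])
  qed
  then have "((\<lambda>\<epsilon>. ennreal (\<integral>\<omega>. \<bar>X \<epsilon> \<omega> - Y \<omega>\<bar> \<partial>P)) \<longlongrightarrow> ennreal 0) (at_right 0)"
    by (rule tendsto_ennrealI)
  moreover have "eventually (\<lambda>\<epsilon>. ennreal (\<integral>\<omega>. \<bar>X \<epsilon> \<omega> - Y \<omega>\<bar> \<partial>P) = (\<integral>\<^sup>+\<omega>. ennreal \<bar>X \<epsilon> \<omega> - Y \<omega>\<bar> \<partial>P)) (at_right 0)"
    using X Y by (auto simp: eventually_at_right_field intro!: exI[of _ 1] nn_integral_eq_integral[symmetric])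
  ultimately have "((\<lambda>\<epsilon>. \<integral>\<^sup>+\<omega>. ennreal \<bar>X \<epsilon> \<omega> - Y \<omega>\<bar> \<partial>P) \<longlongrightarrow> 0) (at_right 0)"
    by (simp add: filterlim_cong[OF refl refl])
  then have "poisson_orlicz_norm M P f = (\<integral>\<^sup>+\<omega>. ennreal \<bar>Y \<omega>\<bar> \<partial>P)"
    using Y f unfolding X_def by (intro poisson_orlicz_norm_eqI) auto
  also have "\<dots> = ennreal (\<integral>\<omega>. \<bar>Y \<omega>\<bar> \<partial>P)"
    using Y by (intro nn_integral_eq_integral) auto
  also have "\<dots> \<le> ennreal K"
  proof (rule ennreal_leI)
    have "(\<integral>\<omega>. \<bar>Y \<omega>\<bar> \<partial>P) \<le> (\<integral>\<omega>. \<bar>s k \<omega> - Y \<omega>\<bar> \<partial>P) + K" for k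
    proof -
      have "(\<integral>\<omega>. \<bar>s k \<omega>\<bar> \<partial>P) \<le> K" unfolding s_def X_def by (rule bound) simp
      with triangle[OF Y(1) s[of k], of "\<lambda>_. 0"] show ?thesis by (simp add: abs_minus_commute)
    qed
    moreover have "(\<lambda>k. (\<integral>\<omega>. \<bar>s k \<omega> - Y \<omega>\<bar> \<partial>P) + K) \<longlonglongrightarrow> 0 + K"
      by (intro tendsto_add tendsto_const Y)
    ultimately show "(\<integral>\<omega>. \<bar>Y \<omega>\<bar> \<partial>P) \<le> K"
      by (intro LIMSEQ_le_const[of _ K]) auto
  qed
  finally show ?thesis .
qed


lemma integral_abs_centered_le:
  assumes g: "integrable M g" "square_integrable M g" and h: "integrable M h"
  shows "(\<integral>\<omega>. \<bar>centered (\<lambda>x. g x + h x) \<omega>\<bar> \<partial>P) \<le> L2_norm M g + 2 * (\<integral>x. \<bar>h x\<bar> \<partial>M)" (is "?l \<le> ?r")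
proof -
  have "integrable P (centered (\<lambda>x. g x + h x))"
    using g h by (intro integrable_centered) auto
  then have "ennreal ?l = (\<integral>\<^sup>+\<omega>. ennreal \<bar>centered (\<lambda>x. g x + h x) \<omega>\<bar> \<partial>P)"
    by (intro nn_integral_eq_integral[symmetric]) auto
  also have "\<dots> \<le> ennreal ?r" by (rule centered_bound[OF g h])
  finally show ?thesis
    by (subst (asm) ennreal_le_iff) (auto intro!: add_nonneg_nonneg integral_nonneg_AE)
qed

text \<open>Truncating \<open>f\<close> restricts \<open>g\<close> and \<open>h\<close> to a common
  set determined by |f|. On each such set \<open>centered_bound\<close> applies; restriction
  increases neither norm, and the parts of \<open>g\<close> and \<open>h\<close> over small nonzero
  values of \<open>f\<close> vanish in the limit.\<close>

lemma poisson_orlicz_norm_le: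
  assumes g: "square_integrable M g" and h: "integrable M h" and f: "f = (\<lambda>x. g x + h x)"
  shows "poisson_orlicz_norm M P f \<le> ennreal (L2_norm M g + 2 * (\<integral>x. \<bar>h x\<bar> \<partial>M))"
proof -
  have [measurable]: "g \<in> borel_measurable M" "h \<in> borel_measurable M"
    using g h by (auto simp: square_integrable_def)
  have fm [measurable]: "f \<in> borel_measurable M" unfolding f by measurable
  have g2: "integrable M (\<lambda>x. (g x)\<^sup>2)" using g by (simp add: square_integrable_def)
  \<comment> \<open>Restriction of \<open>u\<close> to the points where |f| satisfies
    \<open>B\<close>. It respects the decomposition of \<open>f\<close>, and truncations as well as
    their differences have this shape.\<close>
  define r where "r B u x = (if B (\<bar>f x\<bar>) then u x else 0)" for B :: "real \<Rightarrow> bool" and u :: "'a \<Rightarrow> real" and x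
  have r_meas: "r B u \<in> borel_measurable M"
    if "Measurable.pred borel B" "u \<in> borel_measurable M" for B u
    using that unfolding r_def by measurable
  have r_h: "integrable M (r B h)" if "Measurable.pred borel B" for B
    by (rule Bochner_Integration.integrable_bound[OF h r_meas[OF that]]) (auto simp: r_def)
  have r_g: "square_integrable M (r B g)" if B: "Measurable.pred borel B" for B
    unfolding square_integrable_def
  proof
    show rm: "r B g \<in> borel_measurable M" by (rule r_meas[OF B]) measurable
    show "integrable M (\<lambda>x. (r B g x)\<^sup>2)"
      by (rule Bochner_Integration.integrable_bound[OF g2 borel_measurable_power[OF rm]]) (auto simp: r_def)
  qed
  have r_f: "r B f x = r B g x + r B h x" for B x by (simp add: r_def f)
  have trunc: "truncate_below \<epsilon> f = r (\<lambda>t. t > \<epsilon>) f" for \<epsilon>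
    by (auto simp: truncate_below_def r_def)
  have int_f: "integrable M (r (\<lambda>t. t > \<epsilon>) f)" if \<epsilon>: "\<epsilon> > 0" for \<epsilon>
  proof (rule Bochner_Integration.integrable_bound)
    show "integrable M (\<lambda>x. 2 / \<epsilon> * (g x)\<^sup>2 + 2 * \<bar>h x\<bar>)" using g2 h by auto
    show "r (\<lambda>t. t > \<epsilon>) f \<in> borel_measurable M" by (rule r_meas) measurable
    \<comment> \<open>Where |g| exceeds \<open>\<epsilon> / 2\<close>, it is at most
      \<open>2 / \<epsilon> * (g x)\<^sup>2\<close>. Where it does not but |f| exceeds
      \<open>\<epsilon>\<close>, less than half of |f| comes from \<open>g\<close>, so |f| is at
      most twice |h|.\<close>
    have "\<bar>r (\<lambda>t. t > \<epsilon>) f x\<bar> \<le> 2 / \<epsilon> * (g x)\<^sup>2 + 2 * \<bar>h x\<bar>" for x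
    proof (cases "\<bar>f x\<bar> > \<epsilon> \<and> \<bar>g x\<bar> > \<epsilon> / 2")
      case True
      then have "\<bar>g x\<bar> * (\<epsilon> / 2) \<le> \<bar>g x\<bar> * \<bar>g x\<bar>" by (intro mult_left_mono) auto
      then have "\<bar>g x\<bar> \<le> 2 / \<epsilon> * (g x)\<^sup>2" using \<epsilon> by (simp add: field_simps power2_eq_square)
      then show ?thesis unfolding r_def f by (auto intro: order_trans[OF abs_triangle_ineq])
    next
      case False
      have "\<bar>r (\<lambda>t. t > \<epsilon>) f x\<bar> \<le> 2 * \<bar>h x\<bar>"
      proof (cases "\<bar>f x\<bar> > \<epsilon>")
        case True
        with False have "\<bar>g x\<bar> \<le> \<epsilon> / 2" by simp
        moreover have "\<bar>f x\<bar> \<le> \<bar>g x\<bar> + \<bar>h x\<bar>" unfolding f by (rule abs_triangle_ineq)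
        moreover have "r (\<lambda>t. t > \<epsilon>) f x = f x" using True by (simp add: r_def)
        ultimately show ?thesis using True by linarith
      qed (simp add: r_def)
      moreover have "0 \<le> 2 / \<epsilon> * (g x)\<^sup>2" using \<epsilon> by simp
      ultimately show ?thesis by linarith
    qed
    moreover have "0 \<le> 2 / \<epsilon> * (g x)\<^sup>2 + 2 * \<bar>h x\<bar>" for x using \<epsilon> by simp
    ultimately show "AE x in M. norm (r (\<lambda>t. t > \<epsilon>) f x) \<le> norm (2 / \<epsilon> * (g x)\<^sup>2 + 2 * \<bar>h x\<bar>)"
      by auto
  qed
  have bound: "(\<integral>\<omega>. \<bar>centered (r B f) \<omega>\<bar> \<partial>P) \<le> L2_norm M (r B g) + 2 * (\<integral>x. \<bar>r B h x\<bar> \<partial>M)"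
    if B: "Measurable.pred borel B" and int: "integrable M (r B f)" for B
  proof -
    \<comment> \<open>On the restricted set \<open>g\<close> is the difference of two integrable
      functions, so the integrability demanded by \<open>centered_bound\<close> is
      available.\<close>
    have "integrable M (\<lambda>x. r B f x - r B h x)" using int r_h[OF B] by (rule Bochner_Integration.integrable_diff)
    then have "integrable M (r B g)" by (simp add: r_f)
    from integral_abs_centered_le[OF this r_g[OF B] r_h[OF B]] show ?thesis
      by (simp add: r_f[abs_def])
  qed
  define S where "S \<epsilon> = {y. f y \<noteq> 0 \<and> \<bar>f y\<bar> \<le> \<epsilon>}" for \<epsilon>
  define c where "c \<epsilon> = sqrt (\<integral>x. (g x)\<^sup>2 * indicator (S \<epsilon>) x \<partial>M) + 2 * (\<integral>x. \<bar>h x\<bar> * indicator (S \<epsilon>) x \<partial>M)" for \<epsilon>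
  \<comment> \<open>\<open>S \<epsilon>\<close> is a set over the whole type, so measurability can
    only be claimed after intersecting with the space; \<open>ind\<close> below bridges the same
    gap.\<close>
  have S_meas [measurable]: "S \<epsilon> \<inter> space M \<in> sets M" for \<epsilon>
  proof -
    have "{x \<in> space M. f x \<noteq> 0 \<and> \<bar>f x\<bar> \<le> \<epsilon>} \<in> sets M" by measurable
    also have "{x \<in> space M. f x \<noteq> 0 \<and> \<bar>f x\<bar> \<le> \<epsilon>} = S \<epsilon> \<inter> space M" unfolding S_def by auto
    finally show ?thesis .
  qed
  have "(c \<longlongrightarrow> sqrt 0 + 2 * 0) (at_right 0)"
    unfolding c_def S_def
    by (intro tendsto_add tendsto_mult tendsto_const tendsto_real_sqrt integral_small_values_tendsto_0 fm g2 integrable_abs h)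
  then have c: "(c \<longlongrightarrow> 0) (at_right 0)" by simp
  show ?thesis
  proof (rule poisson_orlicz_norm_le_limit[OF fm _ _ c])
    fix \<epsilon> :: real assume \<epsilon>: "\<epsilon> > 0"
    show "integrable M (truncate_below \<epsilon> f)" unfolding trunc by (rule int_f[OF \<epsilon>])
    have "L2_norm M (r (\<lambda>t. t > \<epsilon>) g) \<le> L2_norm M g"
      unfolding L2_norm_def
      by (intro real_sqrt_le_mono integral_mono) (use r_g[of "\<lambda>t. t > \<epsilon>"] g2 in \<open>auto simp: square_integrable_def r_def\<close>)
    moreover have "(\<integral>x. \<bar>r (\<lambda>t. t > \<epsilon>) h x\<bar> \<partial>M) \<le> (\<integral>x. \<bar>h x\<bar> \<partial>M)"
      by (intro integral_mono integrable_abs r_h h) (auto simp: r_def)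
    ultimately show "(\<integral>\<omega>. \<bar>centered (truncate_below \<epsilon> f) \<omega>\<bar> \<partial>P) \<le> L2_norm M g + 2 * (\<integral>x. \<bar>h x\<bar> \<partial>M)"
      unfolding trunc using bound[OF _ int_f[OF \<epsilon>]] by auto
  next
    fix \<delta> \<epsilon> :: real assume \<delta>: "0 < \<delta>" "\<delta> \<le> \<epsilon>"
    then have \<epsilon>: "\<epsilon> > 0" by simp
    \<comment> \<open>Lowering the level from \<open>\<epsilon>\<close> to \<open>\<delta>\<close>
      adds exactly the values of \<open>f\<close> whose size lies in this band, a subset of
      \<open>S \<epsilon>\<close> as \<open>\<delta>\<close> is positive.\<close>
    define B where "B t \<longleftrightarrow> \<delta> < t \<and> t \<le> \<epsilon>" for t
    have B: "Measurable.pred borel B" unfolding B_def by measurable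
    have diff: "r B f = (\<lambda>x. r (\<lambda>t. t > \<delta>) f x - r (\<lambda>t. t > \<epsilon>) f x)"
      using \<delta> by (auto simp: r_def B_def fun_eq_iff)
    have int: "integrable M (r B f)"
      unfolding diff using int_f \<delta> \<epsilon> by auto
    have "(\<integral>\<omega>. \<bar>centered (truncate_below \<delta> f) \<omega> - centered (truncate_below \<epsilon> f) \<omega>\<bar> \<partial>P)
        = (\<integral>\<omega>. \<bar>centered (r B f) \<omega>\<bar> \<partial>P)"
      unfolding trunc
    proof (rule integral_cong_AE)
      show "AE \<omega> in P. \<bar>centered (r (\<lambda>t. t > \<delta>) f) \<omega> - centered (r (\<lambda>t. t > \<epsilon>) f) \<omega>\<bar> = \<bar>centered (r B f) \<omega>\<bar>"
        using AE_centered_diff[OF int_f[OF \<delta>(1)] int_f[OF \<epsilon>]] unfolding diff by eventually_elim simp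
    qed (use int int_f \<delta> \<epsilon> integrable_centered in \<open>auto intro!: borel_measurable_abs borel_measurable_diff centered_measurable\<close>)
    also have "\<dots> \<le> L2_norm M (r B g) + 2 * (\<integral>x. \<bar>r B h x\<bar> \<partial>M)"
      by (rule bound[OF B int])
    also have "\<dots> \<le> c \<epsilon>"
      unfolding c_def L2_norm_def
    proof (intro add_mono mult_left_mono real_sqrt_le_mono integral_mono)
      show "integrable M (\<lambda>x. (r B g x)\<^sup>2)" using r_g[OF B] by (simp add: square_integrable_def)
      show "integrable M (\<lambda>x. \<bar>r B h x\<bar>)" by (intro integrable_abs r_h[OF B])
      have ind: "integrable M (\<lambda>x. u x * indicator (S \<epsilon>) x)" if u: "integrable M u" for u :: "'a \<Rightarrow> real"
      proof -
        have "integrable M (\<lambda>x. u x * indicator (S \<epsilon> \<inter> space M) x)"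
          by (rule integrable_real_mult_indicator[OF S_meas u])
        then show ?thesis
          by (rule Bochner_Integration.integrable_cong[THEN iffD1, OF refl, rotated]) (simp add: indicator_def)
      qed
      show "integrable M (\<lambda>x. (g x)\<^sup>2 * indicator (S \<epsilon>) x)" "integrable M (\<lambda>x. \<bar>h x\<bar> * indicator (S \<epsilon>) x)"
        by (intro ind g2 integrable_abs h)+
      show "(r B g x)\<^sup>2 \<le> (g x)\<^sup>2 * indicator (S \<epsilon>) x" "\<bar>r B h x\<bar> \<le> \<bar>h x\<bar> * indicator (S \<epsilon>) x" for x
        using \<delta> by (auto simp: r_def B_def S_def indicator_def)
    qed simp
    finally show "(\<integral>\<omega>. \<bar>centered (truncate_below \<delta> f) \<omega> - centered (truncate_below \<epsilon> f) \<omega>\<bar> \<partial>P) \<le> c \<epsilon>" .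
  qed
qed

text \<open>The part removed by truncation has vanishing L^1 norm, and
  \<open>centered_L1_bound\<close> carries this over to the compensated integrals. So the limit
  defining I_1 is the compensated integral itself.\<close>

lemma poisson_orlicz_norm_integrable:
  assumes u: "integrable M u"
  shows "poisson_orlicz_norm M P u = (\<integral>\<^sup>+\<omega>. ennreal \<bar>centered u \<omega>\<bar> \<partial>P)"
proof (rule poisson_orlicz_norm_eqI)
  show um [measurable]: "u \<in> borel_measurable M" using u by auto
  then show "centered u \<in> borel_measurable P" by measurable
  let ?w = "\<lambda>\<epsilon>. 2 * (\<integral>x. \<bar>u x\<bar> * indicator {y. u y \<noteq> 0 \<and> \<bar>u y\<bar> \<le> \<epsilon>} x \<partial>M)"
  have le: "(\<integral>\<^sup>+\<omega>. ennreal \<bar>centered (truncate_below \<epsilon> u) \<omega> - centered u \<omega>\<bar> \<partial>P) \<le> ennreal (?w \<epsilon>)" for \<epsilon>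
  proof -
    let ?t = "truncate_below \<epsilon> u"
    have t: "integrable M ?t"
      by (rule Bochner_Integration.integrable_bound[OF u]) (auto simp: truncate_below_def indicator_def)
    have "(\<integral>\<^sup>+\<omega>. ennreal \<bar>centered ?t \<omega> - centered u \<omega>\<bar> \<partial>P) = (\<integral>\<^sup>+\<omega>. ennreal \<bar>centered (\<lambda>x. ?t x - u x) \<omega>\<bar> \<partial>P)"
      using AE_centered_diff[OF t u] by (intro nn_integral_cong_AE) auto
    also have "\<dots> \<le> ennreal (2 * (\<integral>x. \<bar>?t x - u x\<bar> \<partial>M))"
      using t u by (intro centered_L1_bound) auto
    also have "(\<integral>x. \<bar>?t x - u x\<bar> \<partial>M) = (\<integral>x. \<bar>u x\<bar> * indicator {y. u y \<noteq> 0 \<and> \<bar>u y\<bar> \<le> \<epsilon>} x \<partial>M)"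
      by (intro Bochner_Integration.integral_cong) (auto simp: truncate_below_def indicator_def)
    finally show ?thesis .
  qed
  have "((\<lambda>\<epsilon>. ennreal (?w \<epsilon>)) \<longlongrightarrow> ennreal (2 * 0)) (at_right 0)"
    by (intro tendsto_ennrealI tendsto_mult tendsto_const integral_small_values_tendsto_0 integrable_abs u um)
  then have "((\<lambda>\<epsilon>. ennreal (?w \<epsilon>)) \<longlongrightarrow> 0) (at_right 0)" by simp
  then show "((\<lambda>\<epsilon>. \<integral>\<^sup>+\<omega>. ennreal \<bar>centered (truncate_below \<epsilon> u) \<omega> - centered u \<omega>\<bar> \<partial>P) \<longlongrightarrow> 0) (at_right 0)"
    by (rule tendsto_sandwich[OF always_eventually always_eventually tendsto_const, rotated -1])
      (use le in auto)
qed

text \<open>On the event that \<open>D\<close> contains no point, the Poisson integral of \<open>u\<close> misses the mass of \<open>u\<close> on \<open>D\<close>.\<close>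
lemma poisson_orlicz_norm_ge:
  assumes u: "integrable M u" "\<And>x. u x \<ge> 0" and D: "D \<in> sets M" "emeasure M D < \<infinity>"
  shows "ennreal (exp (- measure M D) * (\<integral>x. u x * indicator D x \<partial>M)) \<le> poisson_orlicz_norm M P u"
proof -
  note [measurable] = D(1)
  have um [measurable]: "u \<in> borel_measurable M" using u by auto
  define p where "p = exp (- measure M D)"
  define a where "a = (\<integral>x. u x * indicator D x \<partial>M)"
  define b where "b = (\<integral>x. u x * indicator (space M - D) x \<partial>M)"
  define V where "V \<omega> = (indicator {0} (emeasure \<omega> D) :: ennreal)" for \<omega> :: "'a measure"
  define N where "N \<omega> = (\<integral>\<^sup>+x. ennreal (u x) \<partial>\<omega>)" for \<omega> :: "'a measure"
  have V [measurable]: "V \<in> borel_measurable P"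
    unfolding V_def by (rule measurable_compose[OF count_measurable[OF D(1)]]) measurable
  have N [measurable]: "N \<in> borel_measurable P"
    unfolding N_def by (rule nn_integral_configuration_measurable) measurable
  have ab0: "a \<ge> 0" "b \<ge> 0" "p \<ge> 0"
    unfolding a_def b_def p_def using u by (auto intro!: integral_nonneg_AE)
  have int: "integrable M (\<lambda>x. u x * indicator D x)" "integrable M (\<lambda>x. u x * indicator (space M - D) x)"
    using u by (auto intro!: integrable_real_mult_indicator)
  have ab: "a + b = (\<integral>x. u x \<partial>M)"
    unfolding a_def b_def Bochner_Integration.integral_add[OF int, symmetric]
    by (intro Bochner_Integration.integral_cong) (auto simp: indicator_def)
  have EV: "(\<integral>\<^sup>+\<omega>. V \<omega> \<partial>P) = ennreal p"
    unfolding V_def p_def by (rule void_probability[OF D])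
  have "(\<integral>\<^sup>+\<omega>. N \<omega> * V \<omega> \<partial>P) = (\<integral>\<^sup>+x. ennreal (u x) * (ennreal p * indicator (space M - D) x) \<partial>M)"
    unfolding N_def V_def p_def by (rule campbell_void[OF _ D]) measurable
  also have "\<dots> = (\<integral>\<^sup>+x. ennreal p * ennreal (u x * indicator (space M - D) x) \<partial>M)"
    by (intro nn_integral_cong) (auto simp: indicator_def mult.commute)
  also have "\<dots> = ennreal p * (\<integral>\<^sup>+x. ennreal (u x * indicator (space M - D) x) \<partial>M)"
    by (intro nn_integral_cmult) measurable
  also have "(\<integral>\<^sup>+x. ennreal (u x * indicator (space M - D) x) \<partial>M) = ennreal b"
    unfolding b_def using u int by (intro nn_integral_eq_integral) auto
  finally have ENV: "(\<integral>\<^sup>+\<omega>. N \<omega> * V \<omega> \<partial>P) = ennreal (p * b)" using ab0 by (simp add: ennreal_mult)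
  \<comment> \<open>\<open>a + b\<close> is the mean of \<open>u\<close>, so it is at most |centered
    u| plus the Poisson integral. On the void event that integral has expectation
    \<open>p * b\<close> only; cancelling this finite amount leaves \<open>p * a\<close>.\<close>
  have "ennreal (a + b) * ennreal p = (\<integral>\<^sup>+\<omega>. ennreal (a + b) * V \<omega> \<partial>P)"
    by (subst nn_integral_cmult) (auto simp: EV)
  also have "\<dots> \<le> (\<integral>\<^sup>+\<omega>. ennreal \<bar>centered u \<omega>\<bar> + N \<omega> * V \<omega> \<partial>P)"
  proof (rule nn_integral_mono_AE)
    show "AE \<omega> in P. ennreal (a + b) * V \<omega> \<le> ennreal \<bar>centered u \<omega>\<bar> + N \<omega> * V \<omega>"
      using AE_integrable_configuration[OF u(1)]
    proof eventually_elim
      fix \<omega> assume \<omega>: "integrable \<omega> u"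
      have N_eq: "N \<omega> = ennreal (\<integral>x. u x \<partial>\<omega>)"
        unfolding N_def using \<omega> u by (intro nn_integral_eq_integral) auto
      have "a + b \<le> \<bar>centered u \<omega>\<bar> + (\<integral>x. u x \<partial>\<omega>)" unfolding centered_def ab by linarith
      then have "ennreal (a + b) \<le> ennreal (\<bar>centered u \<omega>\<bar> + (\<integral>x. u x \<partial>\<omega>))"
        by (rule ennreal_leI)
      also have "\<dots> = ennreal \<bar>centered u \<omega>\<bar> + N \<omega>"
        unfolding N_eq using u by (intro ennreal_plus) (auto intro: integral_nonneg_AE)
      finally show "ennreal (a + b) * V \<omega> \<le> ennreal \<bar>centered u \<omega>\<bar> + N \<omega> * V \<omega>"
        by (auto simp: V_def indicator_def)
    qed
  qed
  also have "\<dots> = (\<integral>\<^sup>+\<omega>. ennreal \<bar>centered u \<omega>\<bar> \<partial>P) + ennreal (p * b)"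
    by (subst nn_integral_add) (auto simp: ENV)
  finally have "ennreal (p * a) + ennreal (p * b) \<le> poisson_orlicz_norm M P u + ennreal (p * b)"
    using ab0 unfolding poisson_orlicz_norm_integrable[OF u(1)]
    by (simp add: ennreal_mult[symmetric] ennreal_plus[symmetric] algebra_simps del: ennreal_plus)
  then show ?thesis
    unfolding a_def[symmetric] p_def[symmetric] by (simp add: add.commute)
qed

end

section \<open>Ergodic averages in the Poisson-Orlicz norm\<close>

lemma iso_real_line_sigma_finite:
  assumes "iso_real_line M"
  shows "sigma_finite_measure M"
proof -
  obtain \<phi> :: "'a \<Rightarrow> real" where "\<phi> \<in> M \<rightarrow>\<^sub>M borel" "distr M borel \<phi> = lborel"
    using assms unfolding iso_real_line_def by blast
  then show ?thesis
    using sigma_finite_measure_distr[of M borel \<phi>] sigma_finite_lborel by simp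
qed

lemma measure_endomorphismI:
  assumes T: "T \<in> M \<rightarrow>\<^sub>M M" and inv: "invariant_measure T M"
  shows "measure_endomorphism M T"
proof
  show "distr M M T = M"
  proof (rule measure_eqI)
    fix A assume "A \<in> sets (distr M M T)"
    then show "emeasure (distr M M T) A = emeasure M A"
      using inv T by (simp add: emeasure_distr invariant_measure_def)
  qed simp
qed fact

text \<open>On [0, 1] the square lies below the identity, and 2 t - 1 lies below 2 t, so
  \<open>Phi\<close> is dominated by 2 t.\<close>

lemma integrable_in_L_Phi:
  assumes f: "integrable M f"
  shows "f \<in> L_Phi M"
proof -
  have [measurable]: "f \<in> borel_measurable M" using f by auto
  have "Phi \<bar>t\<bar> \<le> \<bar>2 * t\<bar>" for t
  proof (cases "\<bar>t\<bar> \<le> 1")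
    case True
    then have "\<bar>t\<bar> * \<bar>t\<bar> \<le> 1 * \<bar>t\<bar>" by (intro mult_right_mono) auto
    then show ?thesis using True by (simp add: Phi_def power2_eq_square)
  qed (simp add: Phi_def abs_mult)
  then have "(\<integral>\<^sup>+x. ennreal (Phi \<bar>f x\<bar>) \<partial>M) \<le> (\<integral>\<^sup>+x. ennreal (norm (2 * f x)) \<partial>M)"
    by (intro nn_integral_mono ennreal_leI) auto
  also have "\<dots> < \<infinity>"
    using f integrable_mult_right[of 2 M f] unfolding integrable_iff_bounded by blast
  finally show ?thesis by (simp add: L_Phi_def)
qed

text \<open>Cut \<open>f\<close> at a large height. Above it \<open>Phi\<close> dominates |f|, so
  the tail is integrable and tends to 0 in L^1; below it f^2 is at most a constant times
  \<open>Phi\<close> of |f|.\<close>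

lemma L_Phi_decomposition:
  assumes f: "f \<in> L_Phi M" and e: "e > 0"
  obtains g h where "f = (\<lambda>x. g x + h x)" "square_integrable M g" "integrable M h" "(\<integral>x. \<bar>h x\<bar> \<partial>M) < e"
proof -
  have [measurable]: "f \<in> borel_measurable M" using f by (simp add: L_Phi_def)
  have [measurable]: "Phi \<in> borel_measurable borel"
    unfolding Phi_def[abs_def] by measurable
  have Phi_nonneg: "Phi \<bar>t\<bar> \<ge> 0" for t by (simp add: Phi_def)
  have Phi: "integrable M (\<lambda>x. Phi \<bar>f x\<bar>)"
  proof (rule integrableI_bounded)
    show "(\<integral>\<^sup>+x. ennreal (norm (Phi \<bar>f x\<bar>)) \<partial>M) < \<infinity>"
      using f Phi_nonneg by (simp add: L_Phi_def)
  qed measurable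
  \<comment> \<open>The height is at least 1, so the tail lies in the linear range of
    \<open>Phi\<close>, where t is at most 2 t - 1.\<close>
  define h where "h n x = (if \<bar>f x\<bar> > real (Suc n) then f x else 0)" for n x
  have [measurable]: "h n \<in> borel_measurable M" for n unfolding h_def by measurable
  have h_le: "\<bar>h n x\<bar> \<le> Phi \<bar>f x\<bar>" for n x
    using Phi_nonneg[of "f x"] by (auto simp: h_def Phi_def)
  have h: "integrable M (h n)" for n
    by (rule Bochner_Integration.integrable_bound[OF Phi]) (use h_le in \<open>auto intro: order_trans[OF _ abs_ge_self]\<close>)
  have "(\<lambda>n. \<integral>x. \<bar>h n x\<bar> \<partial>M) \<longlonglongrightarrow> (\<integral>x. 0 \<partial>M)"
  proof (rule integral_dominated_convergence[OF _ _ Phi])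
    show "AE x in M. (\<lambda>n. \<bar>h n x\<bar>) \<longlonglongrightarrow> 0"
    proof (rule AE_I2)
      fix x
      obtain N where N: "\<bar>f x\<bar> < real N" using reals_Archimedean2 by blast
      have "eventually (\<lambda>n. \<bar>h n x\<bar> = 0) sequentially"
        using N by (intro eventually_sequentiallyI[of N]) (auto simp: h_def)
      then show "(\<lambda>n. \<bar>h n x\<bar>) \<longlonglongrightarrow> 0" by (rule tendsto_eventually)
    qed
  qed (use h_le in auto)
  then have "eventually (\<lambda>n. (\<integral>x. \<bar>h n x\<bar> \<partial>M) < e) sequentially"
    using order_tendstoD(2)[of _ 0 _ e] e by simp
  then obtain n where n: "(\<integral>x. \<bar>h n x\<bar> \<partial>M) < e" by (auto simp: eventually_sequentially)
  define g where "g x = f x - h n x" for x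
  have gm [measurable]: "g \<in> borel_measurable M" unfolding g_def by measurable
  have "integrable M (\<lambda>x. (g x)\<^sup>2)"
  proof (rule Bochner_Integration.integrable_bound)
    show "integrable M (\<lambda>x. (real (Suc n))\<^sup>2 * Phi \<bar>f x\<bar>)" using Phi by simp
    have "(g x)\<^sup>2 \<le> (real (Suc n))\<^sup>2 * Phi \<bar>f x\<bar>" for x
    proof (cases "\<bar>f x\<bar> > real (Suc n)")
      case True
      then show ?thesis using Phi_nonneg[of "f x"] by (simp add: g_def h_def)
    next
      case le: False
      have *: "1 \<le> (real (Suc n))\<^sup>2" by (rule one_le_power) simp
      show ?thesis
      proof (cases "\<bar>f x\<bar> \<le> 1")
        case True
        have "1 * (f x)\<^sup>2 \<le> (real (Suc n))\<^sup>2 * (f x)\<^sup>2" by (intro mult_right_mono *) simp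
        then show ?thesis using True le by (simp add: g_def h_def Phi_def)
      next
        case False
        have "\<bar>f x\<bar>\<^sup>2 \<le> (real (Suc n))\<^sup>2" using le by (intro power_mono) auto
        also have "\<dots> \<le> (real (Suc n))\<^sup>2 * Phi \<bar>f x\<bar>"
          using False mult_left_mono[of 1 "Phi \<bar>f x\<bar>" "(real (Suc n))\<^sup>2"] by (simp add: Phi_def)
        finally show ?thesis using le by (simp add: g_def h_def)
      qed
    qed
    then show "AE x in M. norm ((g x)\<^sup>2) \<le> norm ((real (Suc n))\<^sup>2 * Phi \<bar>f x\<bar>)"
      using Phi_nonneg by (auto simp: abs_mult)
  qed measurable
  then have "square_integrable M g" using gm by (simp add: square_integrable_def)
  moreover have "f = (\<lambda>x. g x + h n x)" by (simp add: g_def)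
  ultimately show ?thesis using that h n by blast
qed

lemma tendsto_0_ennrealI:
  fixes X :: "'b \<Rightarrow> ennreal"
  assumes "\<And>e :: real. e > 0 \<Longrightarrow> eventually (\<lambda>i. X i \<le> ennreal e) F"
  shows "(X \<longlongrightarrow> 0) F"
proof (rule order_tendstoI)
  fix a :: ennreal assume "0 < a"
  \<comment> \<open>\<open>a\<close> may be infinite, so a smaller positive level is chosen, which
    is then a real number.\<close>
  then obtain y where y: "0 < y" "y < a" using dense by blast
  then obtain e where e: "y = ennreal e" "e > 0"
    by (cases y) (auto simp: ennreal_less_zero_iff)
  show "eventually (\<lambda>i. X i < a) F"
    using assms[OF e(2)] by eventually_elim (use y e in auto)
qed simp

section \<open>The two implications about ergodic averages\<close>

locale poisson_endomorphism = poisson_process M P + measure_endomorphism M T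
  for M :: "'a measure" and P :: "'a measure measure" and T :: "'a \<Rightarrow> 'a"
begin

lemma averages_tendsto_0:
  assumes no_inv: "\<not> (\<exists>\<nu>. prob_space \<nu> \<and> sets \<nu> = sets M \<and> invariant_measure T \<nu> \<and> absolutely_continuous M \<nu>)"
    and f: "f \<in> L_Phi M"
  shows "(\<lambda>n. poisson_orlicz_norm M P (ergodic_average T f n)) \<longlonglongrightarrow> 0"
proof (rule tendsto_0_ennrealI)
  fix e :: real assume e: "e > 0"
  \<comment> \<open>The part \<open>h\<close> enters the norm bound with factor 2, so
    \<open>e / 4\<close> leaves \<open>e / 2\<close> for the square integrable part.\<close>
  then obtain g h where f_eq: "f = (\<lambda>x. g x + h x)" and g: "square_integrable M g"
    and h: "integrable M h" "(\<integral>x. \<bar>h x\<bar> \<partial>M) < e / 4"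
    using L_Phi_decomposition[OF f, of "e / 4"] by auto
  have "(\<lambda>n. L2_norm M (ergodic_average T g n)) \<longlonglongrightarrow> 0"
    using invariant_probability_exists[OF g] no_inv by blast
  then have "eventually (\<lambda>n. L2_norm M (ergodic_average T g n) < e / 2) sequentially"
    using order_tendstoD(2)[of _ 0 _ "e / 2"] e by simp
  then show "eventually (\<lambda>n. poisson_orlicz_norm M P (ergodic_average T f n) \<le> ennreal e) sequentially"
  proof eventually_elim
    fix n assume n: "L2_norm M (ergodic_average T g n) < e / 2"
    have "poisson_orlicz_norm M P (ergodic_average T f n)
      \<le> ennreal (L2_norm M (ergodic_average T g n) + 2 * (\<integral>x. \<bar>ergodic_average T h n x\<bar> \<partial>M))"
      by (rule poisson_orlicz_norm_le[OF square_integrable_ergodic_average[OF g] integrable_ergodic_average[OF h(1)]])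
        (simp add: f_eq ergodic_average_add fun_eq_iff)
    also have "\<dots> \<le> ennreal e"
      using n h(2) integral_abs_ergodic_average_le[OF h(1), of n] by (intro ennreal_leI) linarith
    finally show "poisson_orlicz_norm M P (ergodic_average T f n) \<le> ennreal e" .
  qed
qed

lemma averages_not_tendsto_0:
  assumes \<nu>: "prob_space \<nu>" "sets \<nu> = sets M" "invariant_measure T \<nu>" "absolutely_continuous M \<nu>"
  shows "\<exists>f. integrable M f \<and> \<not> (\<lambda>n. poisson_orlicz_norm M P (ergodic_average T f n)) \<longlonglongrightarrow> 0"
proof -
  interpret \<nu>: prob_space \<nu> by fact
  have T\<nu>: "T \<in> \<nu> \<rightarrow>\<^sub>M \<nu>"
    using T_measurable measurable_cong_sets[OF \<nu>(2) \<nu>(2)] by blast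
  \<comment> \<open>Now the averages are also studied under \<open>\<nu>\<close>, where every
    iterate of \<open>T\<close> preserves the integral.\<close>
  interpret E: measure_endomorphism \<nu> T
    by (rule measure_endomorphismI[OF T\<nu> \<nu>(3)])
  have space_eq: "space \<nu> = space M" by (rule sets_eq_imp_space_eq[OF \<nu>(2)])
  obtain B :: "nat \<Rightarrow> 'a set" where B: "range B \<subseteq> sets M" "(\<Union>i. B i) = space M"
      "\<And>i. emeasure M (B i) \<noteq> \<infinity>" "incseq B"
    using M.sigma_finite_incseq by metis
  have "(\<lambda>i. measure \<nu> (B i)) \<longlonglongrightarrow> measure \<nu> (\<Union>i. B i)"
    using B \<nu>(2) by (intro \<nu>.finite_Lim_measure_incseq) auto
  then have "(\<lambda>i. measure \<nu> (B i)) \<longlonglongrightarrow> 1"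
    unfolding B(2) space_eq[symmetric] \<nu>.prob_space .
  then have "eventually (\<lambda>i. measure \<nu> (B i) > 1 / 2) sequentially"
    by (rule order_tendstoD) simp
  then obtain i where i: "measure \<nu> (B i) > 1 / 2" by (auto simp: eventually_sequentially)
  define D where "D = B i"
  have D [measurable]: "D \<in> sets M" and D_fin: "emeasure M D < \<infinity>"
    and D_half: "measure \<nu> D > 1 / 2"
    using B i by (auto simp: D_def less_top)
  have D\<nu>: "D \<in> sets \<nu>" using D \<nu>(2) by simp
  define f where "f = indicat_real D"
  define a where "a = ergodic_average T f"
  have f: "integrable M f" unfolding f_def using D D_fin by auto
  have fm: "f \<in> borel_measurable M" "f \<in> borel_measurable \<nu>" unfolding f_def using D D\<nu> by auto
  have am [measurable]: "a n \<in> borel_measurable M" "a n \<in> borel_measurable \<nu>" for n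
    unfolding a_def using ergodic_average_measurable E.ergodic_average_measurable fm by auto
  have a_bounds: "0 \<le> a n x" "a n x \<le> 1" for n x
  proof -
    have "(\<Sum>k=1..n. f ((T ^^ k) x)) \<le> (\<Sum>k=1..n. 1)" by (intro sum_mono) (simp add: f_def)
    then show "0 \<le> a n x" "a n x \<le> 1"
      by (cases "n = 0"; simp add: a_def ergodic_average_def f_def sum_nonneg divide_le_eq)+
  qed
  have "\<not> (\<lambda>n. poisson_orlicz_norm M P (a n)) \<longlonglongrightarrow> 0"
  proof
    assume lim: "(\<lambda>n. poisson_orlicz_norm M P (a n)) \<longlonglongrightarrow> 0"
    define p where "p = exp (- measure M D)"
    have "p > 0" by (simp add: p_def)
    have a: "integrable M (a n)" for n unfolding a_def by (rule integrable_ergodic_average[OF f])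
    have "(\<lambda>n. ennreal (p * (\<integral>x. a n x * indicator D x \<partial>M))) \<longlonglongrightarrow> ennreal 0"
      unfolding ennreal_0
      by (rule tendsto_sandwich[OF always_eventually always_eventually tendsto_const lim])
        (use poisson_orlicz_norm_ge[OF a a_bounds(1) D D_fin] in \<open>auto simp: p_def\<close>)
    then have "(\<lambda>n. p * (\<integral>x. a n x * indicator D x \<partial>M)) \<longlonglongrightarrow> 0"
      by (rule tendsto_ennrealD) (auto intro!: always_eventually mult_nonneg_nonneg integral_nonneg_AE simp: a_bounds p_def)
    then have "(\<lambda>n. inverse p * (p * (\<integral>x. a n x * indicator D x \<partial>M))) \<longlonglongrightarrow> inverse p * 0"
      by (intro tendsto_mult tendsto_const)
    then have "(\<lambda>n. \<integral>x. a n x * indicator D x \<partial>M) \<longlonglongrightarrow> 0"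
      using \<open>p > 0\<close> by (simp add: mult.assoc[symmetric])
    then have "(\<lambda>n. \<integral>x. norm (a n x * indicator D x) \<partial>M) \<longlonglongrightarrow> 0"
      using a_bounds by simp
    \<comment> \<open>Convergence in L^1 of \<open>M\<close> need not persist under
      \<open>\<nu>\<close>, but almost everywhere convergence does by absolute continuity. Passing
      to a subsequence makes the transfer possible, and boundedness by 1 recovers convergence of the
      \<open>\<nu>\<close>-integrals.\<close>
    then obtain r where r: "strict_mono r" "AE x in M. (\<lambda>n. a (r n) x * indicator D x) \<longlonglongrightarrow> 0"
      using tendsto_L1_AE_subseq[of M "\<lambda>n x. a n x * indicator D x"] integrable_real_mult_indicator[OF D a]
      by blast
    have "AE x in \<nu>. (\<lambda>n. a (r n) x * indicator D x) \<longlonglongrightarrow> 0"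
      by (rule absolutely_continuous_AE[OF \<nu>(2) \<nu>(4) r(2)])
    then have lim\<nu>: "(\<lambda>n. \<integral>x. a (r n) x * indicator D x \<partial>\<nu>) \<longlonglongrightarrow> (\<integral>x. 0 \<partial>\<nu>)"
      by (intro integral_dominated_convergence[where w = "\<lambda>_. 1"])
        (use D\<nu> a_bounds in \<open>auto simp: indicator_def\<close>)
    \<comment> \<open>The average has \<open>\<nu>\<close>-integral \<open>measure \<nu> D\<close>,
      of which at most \<open>1 - measure \<nu> D\<close> can come from outside \<open>D\<close>.
      The case \<open>n = 0\<close>, where the average is 0, must be excluded.\<close>
    have ge: "2 * measure \<nu> D - 1 \<le> (\<integral>x. a n x * indicator D x \<partial>\<nu>)" if n: "n \<ge> 1" for n
    proof -
      have f\<nu>: "integrable \<nu> f" unfolding f_def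
        by (intro integrable_real_indicator D\<nu>) (simp add: less_top[symmetric])
      have a\<nu>: "integrable \<nu> (a n)" unfolding a_def by (rule E.integrable_ergodic_average[OF f\<nu>])
      have on_D: "integrable \<nu> (\<lambda>x. a n x * indicator D x)"
        by (rule integrable_real_mult_indicator[OF D\<nu> a\<nu>])
      have off_D: "integrable \<nu> (indicat_real (space \<nu> - D))"
        using D\<nu> by (intro integrable_real_indicator) (auto simp: less_top[symmetric])
      have "(\<integral>x. a n x \<partial>\<nu>) = (1 / real n) * (\<Sum>k=1..n. \<integral>x. f ((T ^^ k) x) \<partial>\<nu>)"
        unfolding a_def ergodic_average_def using E.integrable_funpow[OF f\<nu>] by simp
      also have "\<dots> = (\<integral>x. f x \<partial>\<nu>)"
        using n by (simp add: E.integral_funpow[OF fm(2)])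
      also have "\<dots> = measure \<nu> D" unfolding f_def using D\<nu> by simp
      finally have "measure \<nu> D = (\<integral>x. a n x \<partial>\<nu>)" ..
      also have "\<dots> \<le> (\<integral>x. a n x * indicator D x + indicator (space \<nu> - D) x \<partial>\<nu>)"
        by (rule integral_mono[OF a\<nu> Bochner_Integration.integrable_add[OF on_D off_D]])
          (use a_bounds[of n] in \<open>auto simp: indicator_def\<close>)
      also have "\<dots> = (\<integral>x. a n x * indicator D x \<partial>\<nu>) + measure \<nu> (space \<nu> - D)"
        using D\<nu> by (subst Bochner_Integration.integral_add[OF on_D off_D]) simp
      also have "measure \<nu> (space \<nu> - D) = 1 - measure \<nu> D"
        by (rule \<nu>.prob_compl[OF D\<nu>])
      finally show ?thesis by simp
    qed
    have "2 * measure \<nu> D - 1 \<le> (\<integral>x. 0 \<partial>\<nu>)"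
    proof (rule LIMSEQ_le_const[OF lim\<nu>], intro exI allI impI)
      fix n :: nat assume "n \<ge> 1"
      \<comment> \<open>A strictly increasing index map satisfies \<open>r n \<ge> n\<close>, so the
        excluded index 0 is avoided.\<close>
      then have "r n \<ge> 1" using seq_suble[OF r(1), of n] by simp
      then show "2 * measure \<nu> D - 1 \<le> (\<integral>x. a (r n) x * indicator D x \<partial>\<nu>)" by (rule ge)
    qed
    then show False using D_half by simp
  qed
  then show ?thesis using f unfolding a_def by blast
qed

end

theorem theorem26:
  fixes M :: "'a measure" and P :: "'a measure measure" and T :: "'a \<Rightarrow> 'a"
  assumes "iso_real_line M"
    and "poisson_law M P"
    and "endomorphism M T"
  defines "a \<equiv> \<not> (\<exists>\<nu> :: 'a measure. prob_space \<nu> \<and> sets \<nu> = sets M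
                     \<and> invariant_measure T \<nu> \<and> absolutely_continuous M \<nu>)"
    and "b \<equiv> \<forall>f :: 'a \<Rightarrow> real. integrable M f \<longrightarrow>
               (\<lambda>n. poisson_orlicz_norm M P (ergodic_average T f n)) \<longlonglongrightarrow> 0"
    and "c \<equiv> \<forall>f \<in> L_Phi M.
               (\<lambda>n. poisson_orlicz_norm M P (ergodic_average T f n)) \<longlonglongrightarrow> 0"
  shows "(a \<longleftrightarrow> b) \<and> (b \<longleftrightarrow> c)"
proof -
  interpret P: prob_space P using assms(2) by (simp add: poisson_law_def)
  interpret M: sigma_finite_measure M by (rule iso_real_line_sigma_finite) fact
  interpret T: measure_endomorphism M T
    using assms(3) by (intro measure_endomorphismI) (auto simp: endomorphism_def)
  interpret poisson_endomorphism M P T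
    by unfold_locales fact
  have "a \<Longrightarrow> c" unfolding a_def c_def using averages_tendsto_0 by blast
  moreover have "c \<Longrightarrow> b" unfolding b_def c_def using integrable_in_L_Phi by blast
  moreover have "b \<Longrightarrow> a" unfolding a_def b_def using averages_not_tendsto_0 by blast
  ultimately show ?thesis by blast
qed

end
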